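(* Let $M=\Omega/\Gamma$ be a convex real projective manifold, where $\Omega\subset\mathbb{RP}^n$ is a properly convex open set and $\Gamma\subset PGL_{n+1}(\mathbb{R})$ is a subgroup acting freely and properly discontinuously on $\Omega$. Let $M^e=\Omega^e/\Gamma$ be its complexification and let $TM$ be the tangent bundle of $M$. Then there is a natural homeomorphism $f=f_M: M^e\to TM$ whose restriction to $M\subset M^e$ is the zero-section of $TM$.
   Context: A set $E\subset\mathbb{RP}^n$ is convex if it contains no projective line and its intersection with every projective line is connected. A convex set $E\subset\mathbb{RP}^n$ is properly convex if it is not contained in a projective hyperplane and contains no affine line (a projective line minus a point). Elliptic tubes: regard $\mathbb{RP}^n\subset\mathbb{CP}^n$ and write $\pi$ for the projections $\mathbb{R}^{n+1}\setminus\{0\}\to\mathbb{RP}^n$, $\mathbb{C}^{n+1}\setminus\{0\}\to\mathbb{CP}^n$. A closed segment $I\subset\mathbb{RP}^n$ with endpoints $a_0,a_1$ can be written as $I=\pi(\{c_0v_0+c_1v_1\neq 0 : c_0,c_1\in\mathbb{R},\ c_0c_1\ge 0\})$ for suitable $v_0,v_1\in\mathbb{R}^{n+1}$ with $\pi(v_i)=a_i$; put $I^e=\pi(\{c_0v_0+c_1v_1\neq 0 : c_0,c_1\in\mathbb{C},\ \mathrm{Re}(c_0\overline{c_1})\ge 0\})$. For $\Omega\subset\mathbb{RP}^n$, the elliptic tube is $\Omega^e=\bigcup\{I^e : I\subset \Omega \text{ a closed segment}\}\subset\mathbb{CP}^n$; it is open when $\Omega$ is. The construction is projectively invariant, so $\Gamma$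 acts on $\Omega^e$ through $PGL_{n+1}(\mathbb{R})\subset PGL_{n+1}(\mathbb{C})$. When $\Omega$ is properly convex and open and $\Gamma$ acts freely and properly discontinuously on $\Omega$, this action on $\Omega^e$ is also free and properly discontinuous, and the complexification of $M=\Omega/\Gamma$ is $M^e=\Omega^e/\Gamma$. The inclusion $\Omega\subset\Omega^e$ induces the inclusion $M\subset M^e$. "Natural" means that the construction is projectively invariant: for every isomorphism $h:M\to M'$ of convex real projective manifolds (induced by a projective transformation mapping $\Omega$ onto $\Omega'$ and conjugating $\Gamma$ to $\Gamma'$), with induced maps $h^e:M^e\to M'^e$ and $dh:TM\to TM'$, one has $f_{M'}\circ h^e=dh\circ f_M$. *)

theory Defs
  imports "HOL-Analysis.Analysis" "HOL-Algebra.Group"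
begin

section \<open>Projective spaces and projective transformations\<close>

text \<open>
  The index type \<^typ>\<open>'n option\<close> has \<open>n + 1\<close> elements when \<open>'n\<close> has \<open>n\<close>, so that
  \<open>('k, 'n) projective_space\<close> is the \<open>n\<close>-dimensional projective space over \<open>'k\<close>, and its
  affine charts take values in \<open>'k ^ 'n\<close>. The map \<open>proj_class\<close> is the projection \<open>\<pi>\<close>; it is
  meaningful on nonzero vectors only.
\<close>

definition proj_rel :: "'k::field ^ 'm \<Rightarrow> 'k ^ 'm \<Rightarrow> bool" where
  "proj_rel v w \<longleftrightarrow> v \<noteq> 0 \<and> w \<noteq> 0 \<and> (\<exists>c. c \<noteq> 0 \<and> w = c *s v)"

lemma part_equivp_proj_rel: "part_equivp (proj_rel :: 'k::field ^ 'm \<Rightarrow> _)"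
proof (rule part_equivpI)
  have "proj_rel (1 :: 'k ^ 'm) 1"
    unfolding proj_rel_def by (auto simp: vec_eq_iff intro!: exI[of _ 1])
  then show "\<exists>x :: 'k ^ 'm. proj_rel x x" by blast
  show "symp (proj_rel :: 'k ^ 'm \<Rightarrow> _)"
  proof (rule sympI)
    fix v w :: "'k ^ 'm" assume "proj_rel v w"
    then obtain c where c: "v \<noteq> 0" "w \<noteq> 0" "c \<noteq> 0" "w = c *s v"
      unfolding proj_rel_def by blast
    then have "v = inverse c *s w" by (simp add: vector_smult_assoc)
    with c show "proj_rel w v" unfolding proj_rel_def using nonzero_imp_inverse_nonzero by blast
  qed
  show "transp (proj_rel :: 'k ^ 'm \<Rightarrow> _)"
  proof (rule transpI)
    fix u v w :: "'k ^ 'm" assume "proj_rel u v" "proj_rel v w"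
    then obtain c d where "u \<noteq> 0" "w \<noteq> 0"
      and c: "c \<noteq> 0" "v = c *s u" and d: "d \<noteq> 0" "w = d *s v"
      unfolding proj_rel_def by blast
    moreover have "w = (d * c) *s u" "d * c \<noteq> 0" using c d by (simp_all add: vector_smult_assoc)
    ultimately show "proj_rel u w" unfolding proj_rel_def by blast
  qed
qed

quotient_type (overloaded) ('k, 'n) projective_space =
  "'k::field ^ ('n::finite option)" / partial: proj_rel
  morphisms proj_rep proj_class
  by (rule part_equivp_proj_rel)

lemma proj_class_eq_iff:
  assumes "v \<noteq> 0" "w \<noteq> 0"
  shows "proj_class v = proj_class w \<longleftrightarrow> (\<exists>c. c \<noteq> 0 \<and> w = c *s v)"
proof -
  have "proj_rel v v" "proj_rel w w"
    using assms unfolding proj_rel_def by (auto intro!: exI[of _ 1])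
  then have "proj_class v = proj_class w \<longleftrightarrow> proj_rel v w"
    using Quotient3_rel[OF Quotient3_projective_space, of v w] by simp
  then show ?thesis using assms unfolding proj_rel_def by simp
qed

text \<open>The quotient topology under \<open>\<pi>\<close>.\<close>

instantiation projective_space :: (real_normed_field, finite) topological_space
begin

definition open_projective_space :: "('a, 'b) projective_space set \<Rightarrow> bool" where
  "open_projective_space U \<longleftrightarrow> open {v. v \<noteq> 0 \<and> proj_class v \<in> U}"

instance
proof
  have "{v :: 'a ^ ('b option). v \<noteq> 0 \<and> proj_class v \<in> UNIV} = - {0}" by auto
  then show "open (UNIV :: ('a, 'b) projective_space set)"
    unfolding open_projective_space_def by (simp add: open_Compl)
next
  fix S T :: "('a, 'b) projective_space set"
  assume "open S" "open T"
  then have "open ({v. v \<noteq> 0 \<and> proj_class v \<in> S} \<inter> {v. v \<noteq> 0 \<and> proj_class v \<in> T})"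
    unfolding open_projective_space_def by (rule open_Int)
  moreover have "{v. v \<noteq> 0 \<and> proj_class v \<in> S} \<inter> {v. v \<noteq> 0 \<and> proj_class v \<in> T}
      = {v. v \<noteq> 0 \<and> proj_class v \<in> S \<inter> T}" by blast
  ultimately show "open (S \<inter> T)" unfolding open_projective_space_def by simp
next
  fix K :: "('a, 'b) projective_space set set"
  assume "\<forall>S\<in>K. open S"
  then have "open (\<Union>S\<in>K. {v. v \<noteq> 0 \<and> proj_class v \<in> S})"
    unfolding open_projective_space_def by (intro open_UN) blast
  moreover have "(\<Union>S\<in>K. {v. v \<noteq> 0 \<and> proj_class v \<in> S}) = {v. v \<noteq> 0 \<and> proj_class v \<in> \<Union>K}"
    by blast
  ultimately show "open (\<Union>K)" unfolding open_projective_space_def by simp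
qed

end

text \<open>\<open>('k, 'n) pgl\<close> is \<open>PGL\<^sub>n\<^sub>+\<^sub>1('k)\<close>: invertible matrices up to nonzero scalars.\<close>

definition matrix_smult :: "'k::field \<Rightarrow> 'k ^ 'm ^ 'l \<Rightarrow> 'k ^ 'm ^ 'l" where
  "matrix_smult c A = (\<chi> i j. c * A $ i $ j)"

definition pgl_rel :: "'k::field ^ 'm ^ 'm \<Rightarrow> 'k ^ 'm ^ 'm \<Rightarrow> bool" where
  "pgl_rel A B \<longleftrightarrow> invertible A \<and> invertible B \<and> (\<exists>c. c \<noteq> 0 \<and> B = matrix_smult c A)"

lemma matrix_smult_assoc:
  "matrix_smult c (matrix_smult d A) = matrix_smult (c * d) (A :: 'k::field ^ 'm ^ 'l)"
  by (simp add: matrix_smult_def vec_eq_iff mult.assoc)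

lemma matrix_smult_one: "matrix_smult 1 A = (A :: 'k::field ^ 'm ^ 'l)"
  by (simp add: matrix_smult_def vec_eq_iff)

lemma matrix_smult_matrix_mult:
  "(matrix_smult c A) ** (matrix_smult d B) = matrix_smult (c * d) (A ** (B :: 'k::field ^ 'm ^ 'm))"
  by (simp add: matrix_smult_def matrix_matrix_mult_def vec_eq_iff sum_distrib_left mult_ac)

lemma matrix_smult_vector_mult:
  "(matrix_smult c A) *v (d *s v) = (c * d) *s (A *v (v :: 'k::field ^ 'm))"
  by (simp add: matrix_smult_def matrix_vector_mult_def vector_scalar_mult_def
      vec_eq_iff sum_distrib_left mult_ac)

lemma invertible_mat_1: "invertible (mat 1 :: 'k::field ^ 'm ^ 'm)"
  unfolding invertible_def by (auto intro!: exI[of _ "mat 1"])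

lemma part_equivp_pgl_rel: "part_equivp (pgl_rel :: 'k::field ^ 'm ^ 'm \<Rightarrow> _)"
proof (rule part_equivpI)
  have "pgl_rel (mat 1 :: 'k ^ 'm ^ 'm) (mat 1)"
    unfolding pgl_rel_def
    by (auto simp: invertible_mat_1 matrix_smult_one intro!: exI[of _ 1])
  then show "\<exists>x :: 'k ^ 'm ^ 'm. pgl_rel x x" by blast
  show "symp (pgl_rel :: 'k ^ 'm ^ 'm \<Rightarrow> _)"
  proof (rule sympI)
    fix A B :: "'k ^ 'm ^ 'm" assume "pgl_rel A B"
    then obtain c where c: "invertible A" "invertible B" "c \<noteq> 0" "B = matrix_smult c A"
      unfolding pgl_rel_def by blast
    then have "A = matrix_smult (inverse c) B" by (simp add: matrix_smult_assoc matrix_smult_one)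
    with c show "pgl_rel B A" unfolding pgl_rel_def using nonzero_imp_inverse_nonzero by blast
  qed
  show "transp (pgl_rel :: 'k ^ 'm ^ 'm \<Rightarrow> _)"
  proof (rule transpI)
    fix A B C :: "'k ^ 'm ^ 'm" assume "pgl_rel A B" "pgl_rel B C"
    then obtain c d where "invertible A" "invertible C"
      and c: "c \<noteq> 0" "B = matrix_smult c A" and d: "d \<noteq> 0" "C = matrix_smult d B"
      unfolding pgl_rel_def by blast
    moreover have "C = matrix_smult (d * c) A" "d * c \<noteq> 0"
      using c d by (simp_all add: matrix_smult_assoc)
    ultimately show "pgl_rel A C" unfolding pgl_rel_def by blast
  qed
qed

quotient_type (overloaded) ('k, 'n) pgl =
  "'k::field ^ ('n::finite option) ^ ('n option)" / partial: pgl_rel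
  morphisms pgl_rep pgl_class
  by (rule part_equivp_pgl_rel)

lift_definition pgl_mult :: "('k::field, 'n::finite) pgl \<Rightarrow> ('k, 'n) pgl \<Rightarrow> ('k, 'n) pgl"
  is "(**)"
proof -
  fix A A' B B' :: "'k ^ ('n option) ^ ('n option)"
  assume "pgl_rel A A'" "pgl_rel B B'"
  then obtain c d where inv: "invertible A" "invertible A'" "invertible B" "invertible B'"
    and c: "c \<noteq> 0" "A' = matrix_smult c A" and d: "d \<noteq> 0" "B' = matrix_smult d B"
    unfolding pgl_rel_def by blast
  have "A' ** B' = matrix_smult (c * d) (A ** B)"
    using c(2) d(2) by (simp add: matrix_smult_matrix_mult)
  moreover have "c * d \<noteq> 0" using c d by simp
  ultimately show "pgl_rel (A ** B) (A' ** B')"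
    unfolding pgl_rel_def using inv invertible_mult by blast
qed

lift_definition pgl_one :: "('k::field, 'n::finite) pgl" is "mat 1"
  unfolding pgl_rel_def by (auto simp: invertible_mat_1 matrix_smult_one intro!: exI[of _ 1])

definition PGL :: "('k::field, 'n::finite) pgl monoid" where
  "PGL = \<lparr>carrier = UNIV, mult = pgl_mult, one = pgl_one\<rparr>"

lemma group_PGL: "group (PGL :: ('k::field, 'n::finite) pgl monoid)"
proof (rule groupI)
  have refl: "pgl_rel A A" if "invertible A" for A :: "'k ^ ('n option) ^ ('n option)"
    using that unfolding pgl_rel_def by (auto simp: matrix_smult_one intro!: exI[of _ 1])
  have inv: "invertible A" if "pgl_rel A A" for A :: "'k ^ ('n option) ^ ('n option)"
    using that unfolding pgl_rel_def by blast
  have assoc: "pgl_mult (pgl_mult x y) z = pgl_mult x (pgl_mult y z)"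
    for x y z :: "('k, 'n) pgl"
  proof transfer
    fix A B C :: "'k ^ ('n option) ^ ('n option)"
    assume "pgl_rel A A" "pgl_rel B B" "pgl_rel C C"
    then have "invertible (A ** B ** C)" using inv invertible_mult by blast
    then show "pgl_rel (A ** B ** C) (A ** (B ** C))"
      using refl by (simp add: matrix_mul_assoc)
  qed
  have one: "pgl_mult pgl_one x = x" for x :: "('k, 'n) pgl"
    by transfer simp
  have inverse: "\<exists>y. pgl_mult y x = pgl_one" for x :: "('k, 'n) pgl"
  proof transfer
    fix A :: "'k ^ ('n option) ^ ('n option)" assume "pgl_rel A A"
    then obtain B where B: "A ** B = mat 1" "B ** A = mat 1"
      using inv unfolding invertible_def by blast
    then have "invertible B" unfolding invertible_def by blast
    with B show "\<exists>B\<in>{B. pgl_rel B B}. pgl_rel (B ** A) (mat 1)"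
      using refl[of B] refl[OF invertible_mat_1] by auto
  qed
  show "x \<otimes>\<^bsub>PGL\<^esub> y \<otimes>\<^bsub>PGL\<^esub> z = x \<otimes>\<^bsub>PGL\<^esub> (y \<otimes>\<^bsub>PGL\<^esub> z)" for x y z :: "('k, 'n) pgl"
    unfolding PGL_def by (simp add: assoc)
  show "\<one>\<^bsub>PGL\<^esub> \<otimes>\<^bsub>PGL\<^esub> x = x" for x :: "('k, 'n) pgl"
    unfolding PGL_def by (simp add: one)
  show "\<exists>y\<in>carrier PGL. y \<otimes>\<^bsub>PGL\<^esub> x = \<one>\<^bsub>PGL\<^esub>" for x :: "('k, 'n) pgl"
    unfolding PGL_def using inverse by simp
qed (simp_all add: PGL_def)

lift_definition pgl_act ::
  "('k::field, 'n::finite) pgl \<Rightarrow> ('k, 'n) projective_space \<Rightarrow> ('k, 'n) projective_space"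
  is "(*v)"
proof -
  fix A B :: "'k ^ ('n option) ^ ('n option)" and v w :: "'k ^ ('n option)"
  assume AB: "pgl_rel A B" and vw: "proj_rel v w"
  have nz: "C *v u \<noteq> 0" if "invertible C" "u \<noteq> 0" for C :: "'k ^ ('n option) ^ ('n option)" and u
  proof
    assume "C *v u = 0"
    moreover obtain D where "D ** C = mat 1"
      using \<open>invertible C\<close> unfolding invertible_def by blast
    ultimately have "u = D *v 0"
      by (metis matrix_vector_mul_assoc matrix_vector_mul_lid)
    with \<open>u \<noteq> 0\<close> show False by simp
  qed
  obtain c where c: "invertible A" "invertible B" "c \<noteq> 0" "B = matrix_smult c A"
    using AB unfolding pgl_rel_def by blast
  obtain d where d: "v \<noteq> 0" "w \<noteq> 0" "d \<noteq> 0" "w = d *s v"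
    using vw unfolding proj_rel_def by blast
  have "B *v w = (c * d) *s (A *v v)"
    using c(4) d(4) by (simp add: matrix_smult_vector_mult)
  moreover have "c * d \<noteq> 0" using c d by simp
  ultimately show "proj_rel (A *v v) (B *v w)"
    unfolding proj_rel_def using nz c d by blast
qed

section \<open>Real points and complexification\<close>

definition complex_vec :: "real ^ 'm \<Rightarrow> complex ^ 'm" where
  "complex_vec v = (\<chi> i. complex_of_real (v $ i))"

definition complex_mat :: "real ^ 'm ^ 'm \<Rightarrow> complex ^ 'm ^ 'm" where
  "complex_mat A = (\<chi> i j. complex_of_real (A $ i $ j))"

text \<open>The inclusion of \<open>RP\<^sup>n\<close> in \<open>CP\<^sup>n\<close> and the homomorphism from
  \<open>PGL\<^sub>n\<^sub>+\<^sub>1\<close> over the reals to \<open>PGL\<^sub>n\<^sub>+\<^sub>1\<close> over the complex numbers.\<close>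

lift_definition complex_point ::
  "(real, 'n::finite) projective_space \<Rightarrow> (complex, 'n) projective_space" is complex_vec
proof -
  fix v w :: "real ^ ('n option)" assume "proj_rel v w"
  then obtain c where c: "v \<noteq> 0" "w \<noteq> 0" "c \<noteq> 0" "w = c *s v" unfolding proj_rel_def by blast
  have "complex_vec w = complex_of_real c *s complex_vec v"
    by (simp add: c(4) complex_vec_def vec_eq_iff)
  moreover have "complex_vec v \<noteq> 0" "complex_vec w \<noteq> 0"
    using c(1,2) by (simp_all add: complex_vec_def vec_eq_iff)
  ultimately show "proj_rel (complex_vec v) (complex_vec w)"
    using c(3) unfolding proj_rel_def
    by (intro conjI exI[of _ "complex_of_real c"]) simp_all
qed

lift_definition complex_pgl :: "(real, 'n::finite) pgl \<Rightarrow> (complex, 'n) pgl" is complex_mat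
proof -
  fix A B :: "real ^ ('n option) ^ ('n option)" assume "pgl_rel A B"
  then obtain c where c: "invertible A" "invertible B" "c \<noteq> 0" "B = matrix_smult c A"
    unfolding pgl_rel_def by blast
  have mult: "complex_mat (C ** D) = complex_mat C ** complex_mat D"
    for C D :: "real ^ ('n option) ^ ('n option)"
    by (simp add: complex_mat_def matrix_matrix_mult_def vec_eq_iff)
  have one: "complex_mat (mat 1 :: real ^ ('n option) ^ ('n option)) = mat 1"
    by (simp add: complex_mat_def mat_def vec_eq_iff)
  have inv: "invertible (complex_mat C)" if C: "invertible C"
    for C :: "real ^ ('n option) ^ ('n option)"
  proof -
    obtain D where "C ** D = mat 1" "D ** C = mat 1"
      using C unfolding invertible_def by blast
    then have "complex_mat C ** complex_mat D = mat 1" "complex_mat D ** complex_mat C = mat 1"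
      using mult[of C D] mult[of D C] one by simp_all
    then show ?thesis unfolding invertible_def by blast
  qed
  have "complex_mat B = matrix_smult (complex_of_real c) (complex_mat A)"
    by (simp add: c(4) complex_mat_def matrix_smult_def vec_eq_iff)
  then show "pgl_rel (complex_mat A) (complex_mat B)"
    unfolding pgl_rel_def using c(3) inv[OF c(1)] inv[OF c(2)]
    by (intro conjI exI[of _ "complex_of_real c"]) simp_all
qed

section \<open>Properly convex sets and elliptic tubes\<close>

definition projective_line :: "(real, 'n::finite) projective_space set \<Rightarrow> bool" where
  "projective_line L \<longleftrightarrow>
     (\<exists>V. subspace V \<and> dim V = 2 \<and> L = proj_class ` (V - {0}))"

definition projective_hyperplane :: "(real, 'n::finite) projective_space set \<Rightarrow> bool" where
  "projective_hyperplane H \<longleftrightarrow>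
     (\<exists>V. subspace V \<and> dim V = CARD('n) \<and> H = proj_class ` (V - {0}))"

definition projectively_convex :: "(real, 'n::finite) projective_space set \<Rightarrow> bool" where
  "projectively_convex E \<longleftrightarrow>
     (\<forall>L. projective_line L \<longrightarrow> \<not> L \<subseteq> E \<and> connected (E \<inter> L))"

definition properly_convex :: "(real, 'n::finite) projective_space set \<Rightarrow> bool" where
  "properly_convex E \<longleftrightarrow> projectively_convex E \<and>
     (\<forall>H. projective_hyperplane H \<longrightarrow> \<not> E \<subseteq> H) \<and>
     (\<forall>L a. projective_line L \<and> a \<in> L \<longrightarrow> \<not> L - {a} \<subseteq> E)"

definition proj_segment ::
  "real ^ ('n::finite option) \<Rightarrow> real ^ ('n option) \<Rightarrow> (real, 'n) projective_space set" where
  "proj_segment v0 v1 =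
     {proj_class (c0 *s v0 + c1 *s v1) | c0 c1. c0 *s v0 + c1 *s v1 \<noteq> 0 \<and> c0 * c1 \<ge> 0}"

definition elliptic_segment ::
  "real ^ ('n::finite option) \<Rightarrow> real ^ ('n option) \<Rightarrow> (complex, 'n) projective_space set" where
  "elliptic_segment v0 v1 =
     {proj_class (c0 *s complex_vec v0 + c1 *s complex_vec v1) | c0 c1.
        c0 *s complex_vec v0 + c1 *s complex_vec v1 \<noteq> 0 \<and> Re (c0 * cnj c1) \<ge> 0}"

text \<open>
  The vectors \<open>v0\<close>, \<open>v1\<close> presenting a segment are unique up to exchange and scaling by factors
  whose product is positive, and neither changes \<open>elliptic_segment v0 v1\<close>. So the union over all
  presentations of segments below is the union over all segments.
\<close>

definition elliptic_tube ::
  "(real, 'n::finite) projective_space set \<Rightarrow> (complex, 'n) projective_space set" where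
  "elliptic_tube \<Omega> =
     \<Union> {elliptic_segment v0 v1 | v0 v1.
          v0 \<noteq> 0 \<and> v1 \<noteq> 0 \<and> proj_class v0 \<noteq> proj_class v1 \<and> proj_segment v0 v1 \<subseteq> \<Omega>}"

section \<open>Convex real projective manifolds and their complexifications\<close>

definition quotient_topology :: "'a topology \<Rightarrow> ('a \<Rightarrow> 'b) \<Rightarrow> 'b topology" where
  "quotient_topology X q =
     topology (\<lambda>U. U \<subseteq> q ` topspace X \<and> openin X {x \<in> topspace X. q x \<in> U})"

lemma openin_quotient_topology:
  "openin (quotient_topology X q) U \<longleftrightarrow>
     U \<subseteq> q ` topspace X \<and> openin X {x \<in> topspace X. q x \<in> U}"
proof -
  have "istopology (\<lambda>U. U \<subseteq> q ` topspace X \<and> openin X {x \<in> topspace X. q x \<in> U})"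
    unfolding istopology_def
  proof (intro conjI allI impI)
    fix S T
    assume S: "S \<subseteq> q ` topspace X \<and> openin X {x \<in> topspace X. q x \<in> S}"
      and T: "T \<subseteq> q ` topspace X \<and> openin X {x \<in> topspace X. q x \<in> T}"
    show "S \<inter> T \<subseteq> q ` topspace X" using S by blast
    have "{x \<in> topspace X. q x \<in> S \<inter> T}
        = {x \<in> topspace X. q x \<in> S} \<inter> {x \<in> topspace X. q x \<in> T}" by blast
    then show "openin X {x \<in> topspace X. q x \<in> S \<inter> T}" using S T by auto
  next
    fix K assume K: "\<forall>S\<in>K. S \<subseteq> q ` topspace X \<and> openin X {x \<in> topspace X. q x \<in> S}"
    show "\<Union>K \<subseteq> q ` topspace X" using K by blast
    have "{x \<in> topspace X. q x \<in> \<Union>K} = (\<Union>S\<in>K. {x \<in> topspace X. q x \<in> S})" by blast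
    then show "openin X {x \<in> topspace X. q x \<in> \<Union>K}" using K by auto
  qed
  then show ?thesis unfolding quotient_topology_def by simp
qed

lemma topspace_quotient_topology [simp]: "topspace (quotient_topology X q) = q ` topspace X"
proof
  show "topspace (quotient_topology X q) \<subseteq> q ` topspace X"
    using openin_topspace[of "quotient_topology X q"] unfolding openin_quotient_topology by simp
  have "{x \<in> topspace X. q x \<in> q ` topspace X} = topspace X" by blast
  then have "openin (quotient_topology X q) (q ` topspace X)"
    unfolding openin_quotient_topology by simp
  then show "q ` topspace X \<subseteq> topspace (quotient_topology X q)" by (rule openin_subset)
qed

lemma quotient_map_quotient_topology: "quotient_map X (quotient_topology X q) q"
  unfolding quotient_map_def by (simp add: openin_quotient_topology)

definition orbit_of :: "('g \<Rightarrow> 'a \<Rightarrow> 'a) \<Rightarrow> 'g set \<Rightarrow> 'a \<Rightarrow> 'a set" where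
  "orbit_of act \<Gamma> x = (\<lambda>\<gamma>. act \<gamma> x) ` \<Gamma>"

definition convex_projective_manifold ::
  "(real, 'n::finite) projective_space set \<Rightarrow> (real, 'n) pgl set \<Rightarrow> bool" where
  "convex_projective_manifold \<Omega> \<Gamma> \<longleftrightarrow>
     properly_convex \<Omega> \<and> open \<Omega> \<and> subgroup \<Gamma> PGL \<and>
     (\<forall>\<gamma>\<in>\<Gamma>. pgl_act \<gamma> ` \<Omega> = \<Omega>) \<and>
     (\<forall>\<gamma>\<in>\<Gamma>. \<forall>x\<in>\<Omega>. pgl_act \<gamma> x = x \<longrightarrow> \<gamma> = \<one>\<^bsub>PGL\<^esub>) \<and>
     (\<forall>K. compact K \<and> K \<subseteq> \<Omega> \<longrightarrow> finite {\<gamma> \<in> \<Gamma>. pgl_act \<gamma> ` K \<inter> K \<noteq> {}})"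

definition manifold_top ::
  "(real, 'n::finite) projective_space set \<Rightarrow> (real, 'n) pgl set
     \<Rightarrow> (real, 'n) projective_space set topology" where
  "manifold_top \<Omega> \<Gamma> = quotient_topology (top_of_set \<Omega>) (orbit_of pgl_act \<Gamma>)"

definition complexification_top ::
  "(real, 'n::finite) projective_space set \<Rightarrow> (real, 'n) pgl set
     \<Rightarrow> (complex, 'n) projective_space set topology" where
  "complexification_top \<Omega> \<Gamma> =
     quotient_topology (top_of_set (elliptic_tube \<Omega>)) (orbit_of (\<lambda>\<gamma>. pgl_act (complex_pgl \<gamma>)) \<Gamma>)"

text \<open>Points of the quotients are orbits, so the inclusion of \<open>M\<close> in its complexification takes
  the direct image of an orbit.\<close>

definition manifold_inclusion ::
  "(real, 'n::finite) projective_space set \<Rightarrow> (complex, 'n) projective_space set" where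
  "manifold_inclusion p = complex_point ` p"

section \<open>Tangent bundles\<close>

text \<open>
  For a differentiable manifold with atlas \<open>\<A>\<close>, a tangent vector at \<open>p\<close> is an equivalence class of
  triples \<open>(c, p, u)\<close>, where \<open>c\<close> is a chart at \<open>p\<close> and \<open>u\<close> is a coordinate vector. The relation
  \<open>tangent_rel \<A> \<B> h\<close> says that the second triple represents the image of the first under
  the differential of \<open>h\<close>; for \<open>\<A> = \<B>\<close> and \<open>h = id\<close> it is the change of charts.
\<close>

type_synonym ('a, 'b) chart = "'a set \<times> ('a \<Rightarrow> 'b)"
type_synonym ('a, 'b) tangent_rep = "('a, 'b) chart \<times> 'a \<times> 'b"

definition tangent_rel ::
  "('a, 'b::euclidean_space) chart set \<Rightarrow> ('c, 'd::euclidean_space) chart set \<Rightarrow> ('a \<Rightarrow> 'c)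
     \<Rightarrow> (('a, 'b) tangent_rep \<times> ('c, 'd) tangent_rep) set" where
  "tangent_rel \<A> \<B> h =
     {(((U, \<phi>), p, u), ((V, \<psi>), q, w)) | U \<phi> p u V \<psi> q w.
        (U, \<phi>) \<in> \<A> \<and> p \<in> U \<and> (V, \<psi>) \<in> \<B> \<and> q \<in> V \<and> q = h p \<and>
        w = frechet_derivative (\<psi> \<circ> h \<circ> inv_into U \<phi>) (at (\<phi> p)) u}"

definition tangent_bundle_top ::
  "'a topology \<Rightarrow> ('a, 'b::euclidean_space) chart set \<Rightarrow> ('a, 'b) tangent_rep set topology" where
  "tangent_bundle_top X \<A> =
     quotient_topology
       (sum_topology (\<lambda>c. prod_topology (subtopology X (fst c)) euclidean) \<A>)
       (\<lambda>t. tangent_rel \<A> \<A> id `` {t})"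

definition differential ::
  "('a, 'b::euclidean_space) chart set \<Rightarrow> ('c, 'd::euclidean_space) chart set \<Rightarrow> ('a \<Rightarrow> 'c)
     \<Rightarrow> ('a, 'b) tangent_rep set \<Rightarrow> ('c, 'd) tangent_rep set" where
  "differential \<A> \<B> h \<xi> = tangent_rel \<A> \<B> h `` \<xi>"

definition zero_section ::
  "('a, 'b::euclidean_space) chart set \<Rightarrow> 'a \<Rightarrow> ('a, 'b) tangent_rep set" where
  "zero_section \<A> p = {(c, p, 0) | c. c \<in> \<A> \<and> p \<in> fst c}"

text \<open>
  The charts of \<open>M\<close> are the local inverses of the covering map \<open>\<Omega> \<rightarrow> M\<close>, followed by an affine
  chart of \<open>RP\<^sup>n\<close> in arbitrary projective coordinates.
\<close>

lift_definition affine_coords :: "(real, 'n::finite) projective_space \<Rightarrow> real ^ 'n"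
  is "\<lambda>v. \<chi> i. v $ Some i / v $ None"
  unfolding proj_rel_def by (elim conjE exE) simp

definition affine_patch :: "(real, 'n::finite) projective_space set" where
  "affine_patch = proj_class ` {v. v $ None \<noteq> 0}"

definition manifold_atlas ::
  "(real, 'n::finite) projective_space set \<Rightarrow> (real, 'n) pgl set
     \<Rightarrow> ((real, 'n) projective_space set, real ^ 'n) chart set" where
  "manifold_atlas \<Omega> \<Gamma> =
     {(orbit_of pgl_act \<Gamma> ` V,
       affine_coords \<circ> pgl_act g \<circ> inv_into V (orbit_of pgl_act \<Gamma>)) | V g.
        open V \<and> V \<subseteq> \<Omega> \<and> inj_on (orbit_of pgl_act \<Gamma>) V \<and> pgl_act g ` V \<subseteq> affine_patch}"

section \<open>Isomorphisms and naturality\<close>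

definition manifold_isomorphism ::
  "(real, 'n::finite) projective_space set \<Rightarrow> (real, 'n) pgl set
     \<Rightarrow> (real, 'n) projective_space set \<Rightarrow> (real, 'n) pgl set \<Rightarrow> (real, 'n) pgl \<Rightarrow> bool" where
  "manifold_isomorphism \<Omega> \<Gamma> \<Omega>' \<Gamma>' g \<longleftrightarrow>
     pgl_act g ` \<Omega> = \<Omega>' \<and> (\<lambda>\<gamma>. g \<otimes>\<^bsub>PGL\<^esub> \<gamma> \<otimes>\<^bsub>PGL\<^esub> inv\<^bsub>PGL\<^esub> g) ` \<Gamma> = \<Gamma>'"

text \<open>A transformation \<open>g\<close> as above takes the \<open>\<Gamma>\<close>-orbit of \<open>x\<close> onto the \<open>\<Gamma>'\<close>-orbit of its image,
  so the maps it induces on the two quotients are direct images.\<close>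

definition induced_map ::
  "(real, 'n::finite) pgl \<Rightarrow> (real, 'n) projective_space set \<Rightarrow> (real, 'n) projective_space set" where
  "induced_map g p = pgl_act g ` p"

definition induced_complex_map ::
  "(real, 'n::finite) pgl \<Rightarrow> (complex, 'n) projective_space set
     \<Rightarrow> (complex, 'n) projective_space set" where
  "induced_complex_map g z = pgl_act (complex_pgl g) ` z"

definition natural ::
  "((real, 'n::finite) projective_space set \<Rightarrow> (real, 'n) pgl set
      \<Rightarrow> (complex, 'n) projective_space set
      \<Rightarrow> ((real, 'n) projective_space set, real ^ 'n) tangent_rep set) \<Rightarrow> bool" where
  "natural f \<longleftrightarrow>
     (\<forall>\<Omega> \<Gamma> \<Omega>' \<Gamma>' g.
        convex_projective_manifold \<Omega> \<Gamma> \<and> convex_projective_manifold \<Omega>' \<Gamma>' \<and>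
        manifold_isomorphism \<Omega> \<Gamma> \<Omega>' \<Gamma>' g \<longrightarrow>
        (\<forall>z \<in> topspace (complexification_top \<Omega> \<Gamma>).
           f \<Omega>' \<Gamma>' (induced_complex_map g z) =
           differential (manifold_atlas \<Omega> \<Gamma>) (manifold_atlas \<Omega>' \<Gamma>') (induced_map g) (f \<Omega> \<Gamma> z)))"

end

theory Submission
  imports Defs
begin

text \<open>
  Lift \<open>\<Omega>\<close> to \<open>C \<union> -C\<close> with \<open>C\<close> an open convex cone. For \<open>u \<in> C\<close> the gauge
  \<open>M u w = inf {\<mu>. \<mu> u - w \<in> C}\<close> gives the Hilbert length \<open>N = (M u w + M u (-w)) / 2\<close> of
  the tangent vector represented by \<open>w\<close>, and \<open>\<sigma> = w - ((M u w - M u (-w)) / 2) u\<close> is the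
  representative for which the line through \<open>u\<close> in the direction \<open>\<sigma>\<close> leaves \<open>C\<close> at the same
  time in both directions. The inverse of \<open>f\<close> sends the tangent vector to the point
  \<open>[u + i \<sigma> / (1 + N)]\<close>. The tube consists of the points \<open>[u + i p]\<close> with \<open>u + p\<close> and
  \<open>u - p\<close> in \<open>C\<close>, and for each of them exactly one factor \<open>1 + i t\<close> with \<open>\<bar>t\<bar> \<le> 1\<close> makes the two
  exit times equal: it exists by the intermediate value theorem, and it depends continuously
  on \<open>(u, p)\<close> because its graph is closed. Hence \<open>(u, w) \<mapsto> [u + i \<sigma> / (1 + N)]\<close> is a quotient map
  onto the tube. The map sending \<open>(u, w)\<close> to the tangent vector of \<open>M\<close> is a quotient map too,
  and modulo \<open>\<Gamma>\<close> both have the same fibres. The gauge is invariant under linear maps, so the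
  homeomorphism is natural.
\<close>

section \<open>Gauges of open convex cones\<close>

text \<open>A point of the tube is a complex vector up to a complex scalar, whereas a tangent vector
  is a pair \<open>(u, w)\<close> up to a common real factor and up to adding multiples of
  \<open>u\<close> to \<open>w\<close>. The surplus freedom is the argument of the complex scalar,
  and balancing removes it. The condition on \<open>u + p\<close> and \<open>u - p\<close> is the
  condition on elliptic segments: u + i p = c0 (u + p) + c1 (u - p) with c0 = (1 + i)/2 and c1 = (1
  - i)/2, and \<open>Re (c0 * cnj c1)\<close> is 0. If both gauges of a balanced \<open>p\<close>
  equal g, it says g < 1; this is why a length N \<ge> 0 is compressed to N / (1 + N). The bound on
  the parameter comes from (1 + i)(u + i p) = (u - p) + i (u + p) and its analogue for 1 - i: at
  these two ends base point and direction are, up to sign, the two given vectors of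
  \<open>C\<close>, so the imbalance has opposite signs there. \<open>C\<close> and
  \<open>-C\<close> cannot be told apart naturally, hence everything is expressed through their
  union. Working with vectors makes it enough to find a continuous lift into the space of pairs for
  each of the two maps; no inverse has to be built on orbits.\<close>

definition symmetrize :: "'a::real_normed_vector set \<Rightarrow> 'a set" where
  "symmetrize C = {x. x \<in> C \<or> - x \<in> C}"

text \<open>For \<open>P = C \<union> -C\<close> and \<open>u \<in> C\<close> this is the infimum of the \<open>\<mu>\<close> with \<open>\<mu> u - w \<in> C\<close>; in terms
  of \<open>P\<close> it involves no choice between \<open>C\<close> and \<open>-C\<close>.\<close>
definition gauge_in :: "'a::real_normed_vector set \<Rightarrow> 'a \<Rightarrow> 'a \<Rightarrow> real" where
  "gauge_in P u w = Sup {\<mu>. \<mu> *\<^sub>R u - w \<notin> P}"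

definition hilbert_norm :: "'a::real_normed_vector set \<Rightarrow> 'a \<Rightarrow> 'a \<Rightarrow> real" where
  "hilbert_norm P u w = (gauge_in P u w + gauge_in P u (- w)) / 2"

definition balanced_lift :: "'a::real_normed_vector set \<Rightarrow> 'a \<Rightarrow> 'a \<Rightarrow> 'a" where
  "balanced_lift P u w = w - ((gauge_in P u w - gauge_in P u (- w)) / 2) *\<^sub>R u"

definition tube_part :: "'a::real_normed_vector set \<Rightarrow> 'a \<Rightarrow> 'a \<Rightarrow> 'a" where
  "tube_part P u w = balanced_lift P u w /\<^sub>R (1 + hilbert_norm P u w)"

text \<open>The source of every invariance used later: nonzero scalars, the sign change of
  \<open>u\<close>, the elements of \<open>\<Gamma>\<close> and isomorphisms of manifolds all act by
  linear maps that match the two sets.\<close>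

lemma gauge_linear_image:
  assumes "linear f" "\<And>x. f x \<in> Q \<longleftrightarrow> x \<in> P"
  shows "gauge_in Q (f u) (f w) = gauge_in P u w"
  unfolding gauge_in_def assms(2)[symmetric] by (simp add: linear_diff linear_scale assms(1))

lemma tube_part_linear_image:
  assumes "linear f" "\<And>x. f x \<in> Q \<longleftrightarrow> x \<in> P"
  shows "tube_part Q (f u) (f w) = f (tube_part P u w)"
proof -
  have "gauge_in Q (f u) (- f w) = gauge_in P u (- w)"
    using gauge_linear_image[OF assms, of u "- w"] by (simp add: linear_neg assms(1))
  then show ?thesis
    by (simp add: tube_part_def balanced_lift_def hilbert_norm_def gauge_linear_image[OF assms]
        linear_diff linear_scale assms(1))
qed

lemma symmetrize_uminus_iff: "- x \<in> symmetrize C \<longleftrightarrow> x \<in> symmetrize C"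
  by (auto simp: symmetrize_def)

text \<open>Replacing \<open>u\<close> by \<open>- u\<close> exchanges the two gauges of
  \<open>w\<close>. Their mean is unchanged, and the new sign of their difference cancels the new
  sign of the base vector.\<close>

lemma tube_part_uminus_base: "tube_part (symmetrize C) (- u) w = tube_part (symmetrize C) u w"
proof -
  let ?P = "symmetrize C"
  have "gauge_in ?P (- u) w = gauge_in ?P u (- w)" for w
    using gauge_linear_image[of uminus ?P ?P u "- w"] by (simp add: linear_iff symmetrize_uminus_iff)
  then have g: "gauge_in ?P (- u) w = gauge_in ?P u (- w)" "gauge_in ?P (- u) (- w) = gauge_in ?P u w"
    by simp_all
  have "((x - y) / 2) *\<^sub>R (- u) = ((y - x) / 2) *\<^sub>R u" for x y :: real
    by (metis minus_diff_eq minus_divide_left scaleR_minus_left scaleR_minus_right)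
  then show ?thesis
    by (simp only: tube_part_def balanced_lift_def hilbert_norm_def g add.commute)
qed

text \<open>The two sides describe the same plane sector in two bases that differ by a rotation and
  a scaling; comparing the boundary rays excludes a proper rotation.\<close>
lemma sector_rotation_trivial:
  fixes a b t t' :: real
  assumes t: "0 \<le> t" "t < 1" and t': "0 \<le> t'" "t' < 1"
    and eq: "\<And>x y. \<bar>y\<bar> * t' < x \<longleftrightarrow> \<bar>a * y - b * x\<bar> * t < a * x + b * y"
  shows "b = 0"
proof -
  \<comment> \<open>The points \<open>(t', y)\<close> with \<open>\<bar>y\<bar> = 1\<close> lie on
    the boundary of the first sector: the strict inequality fails there and holds just to the right,
    so the second one becomes an equality.\<close>
  have bd: "\<bar>a * y - b * t'\<bar> * t = a * t' + b * y" if y: "\<bar>y\<bar> = 1" for y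
  proof (rule antisym)
    show "a * t' + b * y \<le> \<bar>a * y - b * t'\<bar> * t" using eq[of y t'] y by simp
    have "((\<lambda>x. \<bar>a * y - b * x\<bar> * t) \<longlongrightarrow> \<bar>a * y - b * t'\<bar> * t) (at_right t')"
      "((\<lambda>x. a * x + b * y) \<longlongrightarrow> a * t' + b * y) (at_right t')"
      by (auto intro!: tendsto_intros)
    moreover have "eventually (\<lambda>x. \<bar>a * y - b * x\<bar> * t \<le> a * x + b * y) (at_right t')"
      unfolding eventually_at_right_field using eq[of y] y by (intro exI[of _ "t' + 1"]) auto
    ultimately show "\<bar>a * y - b * t'\<bar> * t \<le> a * t' + b * y"
      by (intro tendsto_le[OF trivial_limit_at_right_real])
  qed
  have "(\<bar>a - b * t'\<bar> * t)\<^sup>2 = (a * t' + b)\<^sup>2" "(\<bar>- a - b * t'\<bar> * t)\<^sup>2 = (a * t' - b)\<^sup>2"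
    using bd[of 1] bd[of "-1"] by simp_all
  then have sq: "(a - b * t')\<^sup>2 * t\<^sup>2 = (a * t' + b)\<^sup>2" "(- a - b * t')\<^sup>2 * t\<^sup>2 = (a * t' - b)\<^sup>2"
    by (simp_all add: power_mult_distrib)
  \<comment> \<open>Subtracting the two squared equations leaves this product. Squaring forgets
    which boundary ray goes to which, so the quarter turn \<open>a = 0\<close> survives and is
    excluded by \<open>t' * t < 1\<close>.\<close>
  then have "a * b * t' * (1 + t\<^sup>2) = 0" by (simp add: power2_eq_square) algebra
  moreover have "1 + t\<^sup>2 \<noteq> 0" using sum_power2_gt_zero_iff[of 1 t] by simp
  ultimately consider "a = 0" | "b = 0" | "t' = 0" by auto
  then show ?thesis
  proof cases
    case 1
    have "t' * t < 1" using t t' by (metis mult_strict_mono' mult_1_right)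
    then have "(t' * t)\<^sup>2 \<noteq> 1" using t t' by (simp add: power2_eq_1_iff) (metis add.right_neutral mult_nonneg_nonneg not_one_less_zero neg_less_0_iff_less zero_less_one not_le)
    moreover have "b\<^sup>2 * ((t' * t)\<^sup>2 - 1) = 0" using sq(1) 1 by (simp add: power_mult_distrib algebra_simps)
    ultimately show ?thesis by simp
  next
    case 3
    then show ?thesis using bd[of 1] bd[of "-1"] by simp
  qed
qed

section \<open>The gauge of a fixed open convex cone\<close>

locale open_convex_cone =
  fixes C :: "'a::euclidean_space set"
  assumes open_cone: "open C"
    and add_mem: "\<And>u v. u \<in> C \<Longrightarrow> v \<in> C \<Longrightarrow> u + v \<in> C"
    and scale_mem: "\<And>c u. 0 < c \<Longrightarrow> u \<in> C \<Longrightarrow> c *\<^sub>R u \<in> C"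
    and zero_not_mem: "0 \<notin> C"
begin

abbreviation "P \<equiv> symmetrize C"

lemma open_symmetrize: "open P"
proof -
  have "P = C \<union> uminus -` C" unfolding symmetrize_def by auto
  then show ?thesis using open_cone by (auto intro!: open_vimage continuous_intros)
qed

lemma not_both: "x \<in> C \<Longrightarrow> - x \<notin> C"
  using add_mem[of x "-x"] zero_not_mem by auto

lemma scale_iff: "0 < c \<Longrightarrow> c *\<^sub>R x \<in> C \<longleftrightarrow> x \<in> C"
  using scale_mem[of c x] scale_mem[of "inverse c" "c *\<^sub>R x"] by auto

text \<open>Division by \<open>\<mu>\<close> gives \<open>u - w /\<^sub>R \<mu>\<close>, which lies
  in a ball around \<open>u\<close> contained in \<open>C\<close> as soon as \<open>\<mu>\<close>
  exceeds \<open>norm w / e\<close>; the summand 1 in \<open>r\<close> makes this strict and keeps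
  \<open>r\<close> positive.\<close>

lemma large_multiple_mem:
  assumes "u \<in> C"
  shows "\<exists>r>0. \<forall>\<mu>\<ge>r. \<mu> *\<^sub>R u - w \<in> C"
proof -
  obtain e where e: "e > 0" "ball u e \<subseteq> C" using open_cone assms open_contains_ball by blast
  define r where "r = (norm w + 1) / e"
  have "r > 0" using e(1) by (simp add: r_def add_nonneg_pos)
  moreover have "\<mu> *\<^sub>R u - w \<in> C" if "\<mu> \<ge> r" for \<mu>
  proof -
    have "\<mu> > 0" using that \<open>r > 0\<close> by simp
    have "norm w + 1 \<le> \<mu> * e" using that e(1) by (simp add: r_def field_simps)
    then have "norm (w /\<^sub>R \<mu>) < e" using \<open>\<mu> > 0\<close> by (simp add: field_simps)
    then have "u - w /\<^sub>R \<mu> \<in> C" using e(2) by (auto simp: subset_iff dist_norm)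
    then have "\<mu> *\<^sub>R (u - w /\<^sub>R \<mu>) \<in> C" using \<open>\<mu> > 0\<close> scale_mem by blast
    then show ?thesis using \<open>\<mu> > 0\<close> by (simp add: algebra_simps)
  qed
  ultimately show ?thesis by blast
qed

text \<open>The line runs from \<open>-C\<close> at one end to \<open>C\<close> at the other. These
  are disjoint open sets, so by connectedness they cannot cover it.\<close>

lemma line_meets_complement:
  assumes "u \<in> C"
  shows "\<exists>\<mu>. \<mu> *\<^sub>R u - w \<notin> P"
proof (rule ccontr)
  assume "\<not> ?thesis"
  then have all: "\<mu> *\<^sub>R u - w \<in> C \<or> w - \<mu> *\<^sub>R u \<in> C" for \<mu>
    unfolding symmetrize_def by (metis (mono_tags, lifting) mem_Collect_eq minus_diff_eq)
  define X where "X = {\<mu>. \<mu> *\<^sub>R u - w \<in> C}"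
  define Y where "Y = {\<mu>. w - \<mu> *\<^sub>R u \<in> C}"
  have "open X" "open Y" unfolding X_def Y_def
    by (auto intro!: open_vimage[OF open_cone, unfolded vimage_def] continuous_intros)
  moreover have "X \<inter> Y = {}" unfolding X_def Y_def
    using not_both by (force simp: minus_diff_eq)
  moreover have "UNIV \<subseteq> X \<union> Y" using all unfolding X_def Y_def by auto
  moreover obtain r where "r *\<^sub>R u - w \<in> C" using large_multiple_mem[OF assms, of w] by blast
  moreover obtain s where "s *\<^sub>R u - (- w) \<in> C" using large_multiple_mem[OF assms, of "-w"] by blast
  then have "- s \<in> Y" unfolding Y_def by (simp add: add.commute)
  ultimately show False
    using connectedD[OF connected_UNIV, of X Y] unfolding X_def by auto
qed

text \<open>Along the line, membership in \<open>C\<close> persists upwards and membership in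
  \<open>-C\<close> downwards. The set between them is closed and bounded above, so it contains its
  supremum; a point of \<open>P\<close> beyond the supremum cannot lie in \<open>-C\<close>, hence
  lies in \<open>C\<close>.\<close>

lemma gauge_less_iff:
  assumes u: "u \<in> C"
  shows "gauge_in P u w < \<mu> \<longleftrightarrow> \<mu> *\<^sub>R u - w \<in> C"
proof -
  define S where "S = {\<mu>. \<mu> *\<^sub>R u - w \<notin> P}"
  have up: "\<nu> *\<^sub>R u - w \<in> C" if "\<mu> *\<^sub>R u - w \<in> C" "\<mu> \<le> \<nu>" for \<mu> \<nu>
  proof (cases "\<mu> = \<nu>")
    case False
    then have "(\<nu> - \<mu>) *\<^sub>R u \<in> C" using that(2) scale_mem u by simp
    then have "(\<mu> *\<^sub>R u - w) + (\<nu> - \<mu>) *\<^sub>R u \<in> C" using add_mem that(1) by blast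
    then show ?thesis by (simp add: algebra_simps)
  qed (use that in simp)
  have down: "w - \<nu> *\<^sub>R u \<in> C" if "w - \<mu> *\<^sub>R u \<in> C" "\<nu> \<le> \<mu>" for \<mu> \<nu>
  proof (cases "\<mu> = \<nu>")
    case False
    then have "(\<mu> - \<nu>) *\<^sub>R u \<in> C" using that(2) scale_mem u by simp
    then have "(w - \<mu> *\<^sub>R u) + (\<mu> - \<nu>) *\<^sub>R u \<in> C" using add_mem that(1) by blast
    then show ?thesis by (simp add: algebra_simps)
  qed (use that in simp)
  obtain r where r: "r *\<^sub>R u - w \<in> C" using large_multiple_mem[OF u, of w] by blast
  have bdd: "bdd_above S"
    using up[OF r] unfolding S_def symmetrize_def
    by (intro bdd_aboveI[of _ r]) (use nle_le in blast)
  have ne: "S \<noteq> {}" using line_meets_complement[OF u, of w] unfolding S_def by blast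
  have "S = (\<lambda>\<mu>. \<mu> *\<^sub>R u - w) -` (- P)" unfolding S_def by auto
  then have "closed S"
    using open_symmetrize by (auto intro!: closed_vimage continuous_intros)
  then have mem: "Sup S \<in> S" using bdd ne closed_contains_Sup by blast
  have "\<mu> *\<^sub>R u - w \<in> C" if "Sup S < \<mu>"
  proof -
    have "\<mu> \<notin> S" using that cSup_upper[OF _ bdd] leD by blast
    then have "\<mu> *\<^sub>R u - w \<in> C \<or> w - \<mu> *\<^sub>R u \<in> C"
      unfolding S_def symmetrize_def by simp
    moreover have "w - \<mu> *\<^sub>R u \<notin> C"
      using down[of \<mu> "Sup S"] that mem unfolding S_def symmetrize_def by auto
    ultimately show ?thesis by blast
  qed
  moreover have "Sup S < \<mu>" if "\<mu> *\<^sub>R u - w \<in> C"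
    using up[OF that, of "Sup S"] mem not_le_imp_less unfolding S_def symmetrize_def by blast
  ultimately show ?thesis unfolding gauge_in_def S_def by blast
qed

text \<open>Openness of \<open>C\<close> at \<open>u\<close> absorbs the error made by approximating
  \<open>x\<close> from within \<open>C\<close>.\<close>

lemma closure_add_mem:
  assumes "x \<in> closure C" "u \<in> C"
  shows "x + u \<in> C"
proof -
  obtain e where e: "e > 0" "ball u e \<subseteq> C" using open_cone assms(2) open_contains_ball by blast
  obtain y where y: "y \<in> C" "dist y x < e" using assms(1) e(1) closure_approachable by blast
  then have "u + (x - y) \<in> C" using e(2) by (auto simp: subset_iff dist_norm norm_minus_commute)
  then have "y + (u + (x - y)) \<in> C" using y(1) add_mem by blast
  then show ?thesis by (simp add: algebra_simps)
qed

text \<open>The closed counterpart of \<open>gauge_less_iff\<close>. It makes the sets where the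
  gauge exceeds a constant open, the half of continuity that the strict version does not
  give.\<close>

lemma gauge_le_iff:
  assumes u: "u \<in> C"
  shows "gauge_in P u w \<le> \<mu> \<longleftrightarrow> \<mu> *\<^sub>R u - w \<in> closure C"
proof
  assume le: "gauge_in P u w \<le> \<mu>"
  have "\<forall>n. (\<mu> + inverse (real (Suc n))) *\<^sub>R u - w \<in> C"
    using le gauge_less_iff[OF u, of w]
    by (metis add_strict_increasing2 add.commute inverse_positive_iff_positive of_nat_0_less_iff zero_less_Suc less_add_same_cancel1 order_le_less_trans)
  moreover have "(\<lambda>n. (\<mu> + inverse (real (Suc n))) *\<^sub>R u - w) \<longlonglongrightarrow> (\<mu> + 0) *\<^sub>R u - w"
    by (intro tendsto_intros LIMSEQ_inverse_real_of_nat)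
  ultimately show "\<mu> *\<^sub>R u - w \<in> closure C"
    unfolding closure_sequential by auto
next
  assume cl: "\<mu> *\<^sub>R u - w \<in> closure C"
  have "gauge_in P u w < \<nu>" if "\<mu> < \<nu>" for \<nu>
  proof -
    have "(\<mu> *\<^sub>R u - w) + (\<nu> - \<mu>) *\<^sub>R u \<in> C"
      using closure_add_mem[OF cl scale_mem[OF _ u]] that by simp
    then show ?thesis unfolding gauge_less_iff[OF u] by (simp add: algebra_simps)
  qed
  then show "gauge_in P u w \<le> \<mu>" using dense_ge by (metis less_imp_le)
qed

text \<open>For each \<open>\<mu>\<close> the sets where the gauge is below or above
  \<open>\<mu>\<close> are the preimages of \<open>C\<close> and of the complement of its closure
  under the continuous map \<open>(u, w) \<mapsto> \<mu> *\<^sub>R u - w\<close>.\<close>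

lemma continuous_on_gauge: "continuous_on (C \<times> UNIV) (\<lambda>(u, w). gauge_in P u w)"
proof -
  let ?f = "\<lambda>z. gauge_in P (fst z) (snd z)"
  have "\<exists>A. open A \<and> A \<inter> (C \<times> UNIV) = ?f -` {..<\<mu>} \<inter> (C \<times> UNIV)" for \<mu>
    by (rule exI[of _ "(\<lambda>z. \<mu> *\<^sub>R fst z - snd z) -` C"])
      (auto simp: gauge_less_iff intro!: open_vimage open_cone continuous_intros)
  moreover have "\<exists>A. open A \<and> A \<inter> (C \<times> UNIV) = ?f -` {\<mu><..} \<inter> (C \<times> UNIV)" for \<mu>
    by (rule exI[of _ "(\<lambda>z. \<mu> *\<^sub>R fst z - snd z) -` (- closure C)"])
      (auto simp: not_le[symmetric] gauge_le_iff intro!: open_vimage continuous_intros)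
  ultimately show ?thesis
    unfolding case_prod_beta by (intro continuous_on_generate_topology[OF open_generated_order])
      auto
qed

lemma gauge_eqI:
  assumes "u \<in> C" and "\<And>\<mu>. x < \<mu> \<longleftrightarrow> \<mu> *\<^sub>R u - w \<in> C"
  shows "gauge_in P u w = x"
  using assms gauge_less_iff[OF assms(1), of w] by (metis linorder_neq_iff)

text \<open>A negative sum leaves room for a \<open>\<mu>\<close> such that
  \<open>\<mu> *\<^sub>R u - w\<close> and its negative both lie in \<open>C\<close>; they add up to
  0.\<close>

lemma gauge_nonneg: "u \<in> C \<Longrightarrow> 0 \<le> gauge_in P u w + gauge_in P u (- w)"
proof (rule ccontr)
  assume u: "u \<in> C" and "\<not> 0 \<le> gauge_in P u w + gauge_in P u (- w)"
  then have "gauge_in P u w < - gauge_in P u (- w)" by simp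
  then obtain \<mu> where "gauge_in P u w < \<mu>" "\<mu> < - gauge_in P u (- w)" using dense by blast
  then have "\<mu> *\<^sub>R u - w \<in> C" "- \<mu> *\<^sub>R u - - w \<in> C"
    using gauge_less_iff[OF u, of w \<mu>] gauge_less_iff[OF u, of "-w" "-\<mu>"] by simp_all
  then have "(\<mu> *\<^sub>R u - w) + (- \<mu> *\<^sub>R u - - w) \<in> C" by (rule add_mem)
  then show False using zero_not_mem by simp
qed

lemma gauge_shift: "u \<in> C \<Longrightarrow> gauge_in P u (w + c *\<^sub>R u) = gauge_in P u w + c"
proof (rule gauge_eqI)
  assume u: "u \<in> C"
  show "gauge_in P u w + c < \<mu> \<longleftrightarrow> \<mu> *\<^sub>R u - (w + c *\<^sub>R u) \<in> C" for \<mu>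
    using gauge_less_iff[OF u, of w "\<mu> - c"] by (simp add: algebra_simps less_diff_eq)
qed

lemma gauge_scale: "u \<in> C \<Longrightarrow> 0 < c \<Longrightarrow> gauge_in P u (c *\<^sub>R w) = c * gauge_in P u w"
proof (rule gauge_eqI)
  assume u: "u \<in> C" and c: "0 < c"
  show "c * gauge_in P u w < \<mu> \<longleftrightarrow> \<mu> *\<^sub>R u - c *\<^sub>R w \<in> C" for \<mu>
  proof -
    have "c * gauge_in P u w < \<mu> \<longleftrightarrow> gauge_in P u w < \<mu> / c" using c by (simp add: field_simps)
    also have "\<dots> \<longleftrightarrow> c *\<^sub>R ((\<mu> / c) *\<^sub>R u - w) \<in> C" using gauge_less_iff[OF u] scale_iff[OF c] by simp
    finally show ?thesis using c by (simp add: algebra_simps)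
  qed
qed

lemma gauge_zero: "u \<in> C \<Longrightarrow> gauge_in P u 0 = 0"
  using gauge_scale[of u 2 0] by simp

text \<open>In the coordinates \<open>(x, y)\<close> on combinations of \<open>u\<close> and a
  balanced \<open>p\<close>, the cone is a sector symmetric about the \<open>x\<close>-axis. This
  reduces uniqueness of balancing to plane geometry.\<close>

lemma combination_mem_iff:
  assumes u: "u \<in> C" and t: "gauge_in P u p = t" "gauge_in P u (- p) = t"
  shows "x *\<^sub>R u + y *\<^sub>R p \<in> C \<longleftrightarrow> \<bar>y\<bar> * t < x"
proof -
  have "gauge_in P u (- (y *\<^sub>R p)) = \<bar>y\<bar> * t"
    using gauge_scale[OF u, of y "-p"] gauge_scale[OF u, of "-y" p] gauge_zero[OF u] t
    by (cases y "0::real" rule: linorder_cases) auto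
  then show ?thesis using gauge_less_iff[OF u, of "- (y *\<^sub>R p)" x] by simp
qed

lemma hilbert_norm_nonneg: "u \<in> C \<Longrightarrow> 0 \<le> hilbert_norm P u w"
  using gauge_nonneg[of u w] by (simp add: hilbert_norm_def)

lemma balanced_gauge_nonneg: "u \<in> C \<Longrightarrow> gauge_in P u p = t \<Longrightarrow> gauge_in P u (- p) = t \<Longrightarrow> 0 \<le> t"
  using gauge_nonneg[of u p] by simp

lemma gauge_balanced_lift:
  assumes u: "u \<in> C"
  shows "gauge_in P u (balanced_lift P u w) = hilbert_norm P u w"
    "gauge_in P u (- balanced_lift P u w) = hilbert_norm P u w"
proof -
  let ?c = "(gauge_in P u w - gauge_in P u (- w)) / 2"
  show "gauge_in P u (balanced_lift P u w) = hilbert_norm P u w"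
    using gauge_shift[OF u, of w "- ?c"]
    by (simp add: balanced_lift_def hilbert_norm_def field_simps)
  have "- balanced_lift P u w = - w + ?c *\<^sub>R u" by (simp add: balanced_lift_def)
  then show "gauge_in P u (- balanced_lift P u w) = hilbert_norm P u w"
    using gauge_shift[OF u, of "- w" ?c]
    by (simp only: hilbert_norm_def) (simp add: field_simps)
qed

text \<open>The common value N / (1 + N) is below 1, which puts \<open>u\<close> plus or minus the
  tube part into \<open>C\<close>, and it determines N, which is what injectivity needs.\<close>

lemma gauge_tube_part:
  fixes u w defines "N \<equiv> hilbert_norm P u w"
  assumes u: "u \<in> C"
  shows "gauge_in P u (tube_part P u w) = N / (1 + N)"
    "gauge_in P u (- tube_part P u w) = N / (1 + N)"
proof -
  have N: "0 < inverse (1 + N)" using hilbert_norm_nonneg[OF u, of w] by (simp add: N_def add_pos_nonneg)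
  show "gauge_in P u (tube_part P u w) = N / (1 + N)"
    using gauge_scale[OF u N, of "balanced_lift P u w"] gauge_balanced_lift(1)[OF u, of w]
    by (simp add: tube_part_def N_def divide_inverse mult.commute)
  show "gauge_in P u (- tube_part P u w) = N / (1 + N)"
    using gauge_scale[OF u N, of "- balanced_lift P u w"] gauge_balanced_lift(2)[OF u, of w]
    by (simp add: tube_part_def N_def divide_inverse mult.commute)
qed

lemma tube_part_mem:
  assumes u: "u \<in> C"
  shows "u + tube_part P u w \<in> C" "u - tube_part P u w \<in> C"
proof -
  define N where "N = hilbert_norm P u w"
  have "N / (1 + N) < 1" using hilbert_norm_nonneg[OF u, of w] by (simp add: N_def)
  then show "u + tube_part P u w \<in> C" "u - tube_part P u w \<in> C"
    using combination_mem_iff[OF u gauge_tube_part[OF u, of w], of 1 1]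
      combination_mem_iff[OF u gauge_tube_part[OF u, of w], of 1 "-1"] by (simp_all add: N_def)
qed

text \<open>If \<open>t\<close> equals N / (1 + N), then 1 / (1 - t) equals 1 + N, so this rescaling
  undoes the compression; \<open>p\<close> is already balanced and needs no correction along
  \<open>u\<close>.\<close>

lemma tube_part_inverse:
  assumes u: "u \<in> C" and t: "gauge_in P u p = t" "gauge_in P u (- p) = t" "t < 1"
  shows "tube_part P u (p /\<^sub>R (1 - t)) = p"
proof -
  have c: "0 < inverse (1 - t)" using t by simp
  have "gauge_in P u (p /\<^sub>R (1 - t)) = t / (1 - t)" "gauge_in P u (- (p /\<^sub>R (1 - t))) = t / (1 - t)"
    using gauge_scale[OF u c, of p] gauge_scale[OF u c, of "-p"] t by (simp_all add: field_simps)
  then have "hilbert_norm P u (p /\<^sub>R (1 - t)) = t / (1 - t)"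
    "balanced_lift P u (p /\<^sub>R (1 - t)) = p /\<^sub>R (1 - t)"
    using t(3) by (simp_all only: hilbert_norm_def balanced_lift_def) (simp_all add: divide_simps)
  moreover have "1 + t / (1 - t) = inverse (1 - t)" using t(3) by (simp add: field_simps)
  ultimately show ?thesis using c by (simp add: tube_part_def)
qed

text \<open>The second pair is (a + i b)(u + i p). Reading membership in \<open>C\<close> in both
  frames describes one sector in two ways that differ by this rotation and scaling, so
  \<open>sector_rotation_trivial\<close> applies.\<close>

lemma balanced_unique:
  assumes u: "u \<in> C" and t: "gauge_in P u p = t" "gauge_in P u (- p) = t" "t < 1"
    and u': "a *\<^sub>R u - b *\<^sub>R p \<in> C"
    and t': "gauge_in P (a *\<^sub>R u - b *\<^sub>R p) (b *\<^sub>R u + a *\<^sub>R p) = t'"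
      "gauge_in P (a *\<^sub>R u - b *\<^sub>R p) (- (b *\<^sub>R u + a *\<^sub>R p)) = t'" "t' < 1"
  shows "b = 0"
proof (rule sector_rotation_trivial)
  show "0 \<le> t" "0 \<le> t'" using balanced_gauge_nonneg u u' t t' by blast+
  show "\<bar>y\<bar> * t' < x \<longleftrightarrow> \<bar>a * y - b * x\<bar> * t < a * x + b * y" for x y
  proof -
    have "\<bar>y\<bar> * t' < x \<longleftrightarrow> x *\<^sub>R (a *\<^sub>R u - b *\<^sub>R p) + y *\<^sub>R (b *\<^sub>R u + a *\<^sub>R p) \<in> C"
      using combination_mem_iff[OF u' t'(1,2)] by simp
    also have "x *\<^sub>R (a *\<^sub>R u - b *\<^sub>R p) + y *\<^sub>R (b *\<^sub>R u + a *\<^sub>R p)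
        = (a * x + b * y) *\<^sub>R u + (a * y - b * x) *\<^sub>R p"
      by (simp add: algebra_simps)
    also have "\<dots> \<in> C \<longleftrightarrow> \<bar>a * y - b * x\<bar> * t < a * x + b * y"
      by (rule combination_mem_iff[OF u t(1,2)])
    finally show ?thesis .
  qed
qed (use t t' in auto)

section \<open>Balancing the pairs that parametrise the tube\<close>

definition tube_pairs :: "('a \<times> 'a) set" where
  "tube_pairs = {(u, p). u + p \<in> C \<and> u - p \<in> C}"

text \<open>The parameter \<open>t\<close> stands for multiplication of \<open>u + i p\<close> by \<open>1 + i t\<close>.\<close>
definition imbalance :: "('a \<times> 'a) \<Rightarrow> real \<Rightarrow> real" where
  "imbalance z t = gauge_in P (fst z - t *\<^sub>R snd z) (snd z + t *\<^sub>R fst z)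
     - gauge_in P (fst z - t *\<^sub>R snd z) (- (snd z + t *\<^sub>R fst z))"

text \<open>The vector is the combination of \<open>u + p\<close> and \<open>u - p\<close> with
  weights \<open>(1 - t) / 2\<close> and \<open>(1 + t) / 2\<close>. One weight vanishes when
  \<open>t\<close> is 1 or -1, and \<open>scale_mem\<close> wants positive factors, hence the
  cases.\<close>

lemma rotated_mem:
  assumes "(u, p) \<in> tube_pairs" "\<bar>t\<bar> \<le> 1"
  shows "u - t *\<^sub>R p \<in> C"
proof -
  have v: "u + p \<in> C" "u - p \<in> C" using assms(1) by (auto simp: tube_pairs_def)
  have eq: "u - t *\<^sub>R p = ((1 - t) / 2) *\<^sub>R (u + p) + ((1 + t) / 2) *\<^sub>R (u - p)"
    by (simp add: algebra_simps flip: scaleR_add_left) (simp add: field_simps flip: scaleR_add_left scaleR_diff_left)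
  consider "t = 1" | "t = -1" | "-1 < t" "t < 1" using assms(2) by linarith
  then show ?thesis
  proof cases
    case 3
    then show ?thesis unfolding eq by (intro add_mem scale_mem v) auto
  qed (use v in auto)
qed

lemma continuous_on_gauge_compose:
  assumes "continuous_on T f" "continuous_on T g" "\<And>z. z \<in> T \<Longrightarrow> f z \<in> C"
  shows "continuous_on T (\<lambda>z. gauge_in P (f z) (g z))"
  using continuous_on_compose2[OF continuous_on_gauge continuous_on_Pair[OF assms(1,2)]] assms(3)
  by auto

lemma continuous_on_imbalance:
  "continuous_on (tube_pairs \<times> {-1..1}) (\<lambda>(z, t). imbalance z t)"
  unfolding imbalance_def case_prod_beta
  by (intro continuous_on_diff continuous_on_gauge_compose continuous_intros)
    (auto intro!: rotated_mem)

text \<open>At balance it suffices to bound one of the two gauges, and the sign of \<open>t\<close>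
  decides which: sum and difference of the rotated pair are
  \<open>(u + p) + t *\<^sub>R (u - p)\<close> and \<open>(u - p) - t *\<^sub>R (u + p)\<close>, and
  one of them is visibly in \<open>C\<close>.\<close>

lemma balanced_lt_one:
  assumes z: "(u, p) \<in> tube_pairs" and t: "\<bar>t\<bar> \<le> 1" and "imbalance (u, p) t = 0"
  shows "gauge_in P (u - t *\<^sub>R p) (p + t *\<^sub>R u) < 1"
proof -
  have v: "u + p \<in> C" "u - p \<in> C" using z by (auto simp: tube_pairs_def)
  note m = rotated_mem[OF z t]
  have eq: "gauge_in P (u - t *\<^sub>R p) (p + t *\<^sub>R u) = gauge_in P (u - t *\<^sub>R p) (- (p + t *\<^sub>R u))"
    using assms(3) by (simp add: imbalance_def)
  have *: "x + t *\<^sub>R y \<in> C" if "t \<ge> 0" "x \<in> C" "y \<in> C" for x y t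
    using that add_mem[OF that(2) scale_mem[of t y]] by (cases "t = 0") auto
  show ?thesis
  proof (cases "t \<ge> 0")
    case True
    have "(u + p) + t *\<^sub>R (u - p) \<in> C" using * True v by blast
    then show ?thesis unfolding eq gauge_less_iff[OF m] by (simp add: algebra_simps)
  next
    case False
    have "(u - p) + (- t) *\<^sub>R (u + p) \<in> C" by (intro *) (use False v in auto)
    then show ?thesis unfolding gauge_less_iff[OF m] by (simp add: algebra_simps)
  qed
qed

text \<open>At the ends of the interval the rotated pair consists of \<open>u + p\<close> and
  \<open>u - p\<close> up to sign. A direction in \<open>C\<close> has nonnegative gauge and its
  negative has negative gauge, so the imbalance changes sign.\<close>

lemma imbalance_zero_exists:
  assumes z: "(u, p) \<in> tube_pairs"
  shows "\<exists>t\<in>{-1..1}. imbalance (u, p) t = 0"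
proof -
  have v: "u + p \<in> C" "u - p \<in> C" using z by (auto simp: tube_pairs_def)
  have sgn: "gauge_in P x (- y) < gauge_in P x y" if "x \<in> C" "y \<in> C" for x y
    using gauge_less_iff[OF that(1), of "-y" 0] gauge_less_iff[OF that(1), of y 0] that(2)
      not_both[OF that(2)] by simp
  have "imbalance (u, p) (-1) \<le> 0" using sgn[OF v] by (simp add: imbalance_def)
  moreover have "imbalance (u, p) 1 \<ge> 0" using sgn[OF v(2,1)] by (simp add: imbalance_def add.commute)
  moreover have "continuous_on {-1..1} (imbalance (u, p))"
    using continuous_on_compose2[OF continuous_on_imbalance, of "{-1..1}" "\<lambda>t. ((u, p), t)"] z
    by (simp add: image_subset_iff continuous_intros)
  ultimately show ?thesis using IVT'[of "imbalance (u, p)" "-1" 0 1] by auto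
qed

lemma imbalance_zero_unique:
  assumes z: "(u, p) \<in> tube_pairs"
    and t: "\<bar>t\<bar> \<le> 1" "imbalance (u, p) t = 0" and s: "\<bar>s\<bar> \<le> 1" "imbalance (u, p) s = 0"
  shows "t = s"
proof -
  let ?u = "u - t *\<^sub>R p" and ?p = "p + t *\<^sub>R u"
  define k where "k = inverse (1 + t\<^sup>2)"
  have k: "k * (1 + t\<^sup>2) = 1" using sum_power2_gt_zero_iff[of 1 t] by (simp add: k_def)
  \<comment> \<open>The real and imaginary parts of (1 + i s) / (1 + i t), the factor that turns the
    pair rotated by \<open>t\<close> into the pair rotated by \<open>s\<close>. Hence
    \<open>b = 0\<close> means \<open>s = t\<close>.\<close>
  define a b where "a = k * (1 + s * t)" and "b = k * (s - t)"
  have ab: "a + b * (- t) = 1" "a * t + b = s"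
    using k unfolding a_def b_def by (simp_all add: power2_eq_square algebra_simps) algebra+
  have "a *\<^sub>R ?u - b *\<^sub>R ?p = (a + b * (- t)) *\<^sub>R u - (a * t + b) *\<^sub>R p"
    "b *\<^sub>R ?u + a *\<^sub>R ?p = (a * t + b) *\<^sub>R u + (a + b * (- t)) *\<^sub>R p"
    by (simp_all add: algebra_simps)
  then have eq: "a *\<^sub>R ?u - b *\<^sub>R ?p = u - s *\<^sub>R p" "b *\<^sub>R ?u + a *\<^sub>R ?p = p + s *\<^sub>R u"
    unfolding ab by (simp_all add: add.commute)
  have t': "gauge_in P ?u (- ?p) = gauge_in P ?u ?p"
    and s': "gauge_in P (u - s *\<^sub>R p) (- (p + s *\<^sub>R u)) = gauge_in P (u - s *\<^sub>R p) (p + s *\<^sub>R u)"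
    using t(2) s(2) by (simp_all add: imbalance_def)
  have "b = 0"
    using balanced_unique[OF rotated_mem[OF z t(1)] refl t' balanced_lt_one[OF z t], of a b]
      rotated_mem[OF z s(1)] s' balanced_lt_one[OF z s] unfolding eq by blast
  then show ?thesis using k by (auto simp: b_def)
qed

definition balance_param :: "('a \<times> 'a) \<Rightarrow> real" where
  "balance_param z = (THE t. t \<in> {-1..1} \<and> imbalance z t = 0)"

lemma balance_param:
  assumes "z \<in> tube_pairs"
  shows "balance_param z \<in> {-1..1}" "imbalance z (balance_param z) = 0"
proof -
  obtain u p where z: "z = (u, p)" by fastforce
  have "\<exists>!t. t \<in> {-1..1} \<and> imbalance z t = 0"
    using imbalance_zero_exists[of u p] imbalance_zero_unique[of u p] assms z
    by (metis abs_le_iff atLeastAtMost_iff minus_le_iff)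
  from theI'[OF this] show "balance_param z \<in> {-1..1}" "imbalance z (balance_param z) = 0"
    unfolding balance_param_def by blast+
qed

text \<open>By uniqueness the graph is the zero set of the continuous \<open>imbalance\<close>,
  hence closed; compactness of \<open>{-1..1}\<close> turns a closed graph into continuity.\<close>

lemma continuous_on_balance_param: "continuous_on tube_pairs balance_param"
proof (subst continuous_closed_graph_eq)
  show "compact {-1..1::real}" by simp
  show "balance_param \<in> tube_pairs \<rightarrow> {-1..1}" using balance_param by blast
  have eq: "(\<lambda>z. (z, balance_param z)) ` tube_pairs
      = (tube_pairs \<times> {-1..1}) \<inter> (\<lambda>(z, t). imbalance z t) -` {0}" (is "?L = ?R")
  proof (intro equalityI subsetI)
    fix x assume "x \<in> ?R"
    then obtain u p t where x: "x = ((u, p), t)" "(u, p) \<in> tube_pairs" "t \<in> {-1..1}" "imbalance (u, p) t = 0"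
      by auto
    then have "t = balance_param (u, p)"
      using imbalance_zero_unique[of u p t "balance_param (u, p)"] balance_param[of "(u, p)"] by auto
    then show "x \<in> ?L" using x by blast
  qed (use balance_param in auto)
  show "closedin (top_of_set (tube_pairs \<times> {-1..1})) ((\<lambda>z. (z, balance_param z)) ` tube_pairs)"
    using continuous_closedin_preimage[OF continuous_on_imbalance, of "{0}"] unfolding eq by simp
qed

lemma scale_symmetrize_iff: "c \<noteq> 0 \<Longrightarrow> c *\<^sub>R x \<in> P \<longleftrightarrow> x \<in> P"
  using scale_iff[of c x] scale_iff[of c "-x"] scale_iff[of "-c" x] scale_iff[of "-c" "-x"]
  unfolding symmetrize_def by (cases c "0::real" rule: linorder_cases) auto

text \<open>This and \<open>tube_part_shift\<close> cover the ambiguity of a pair representing a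
  tangent vector of projective space: a common nonzero factor, and multiples of \<open>u\<close>
  added to \<open>w\<close>.\<close>

lemma tube_part_scale: "c \<noteq> 0 \<Longrightarrow> tube_part P (c *\<^sub>R u) (c *\<^sub>R w) = c *\<^sub>R tube_part P u w"
  using tube_part_linear_image[of "(*\<^sub>R) c" P P] scale_symmetrize_iff linear_scaleR by blast

text \<open>Adding \<open>d *\<^sub>R u\<close> moves the two gauges by \<open>d\<close> in opposite
  directions. The mean stays, and half the difference grows by exactly the amount to be subtracted
  again.\<close>

lemma tube_part_shift:
  assumes u: "u \<in> P"
  shows "tube_part P u (w + d *\<^sub>R u) = tube_part P u w"
proof -
  have *: "tube_part P u (w + d *\<^sub>R u) = tube_part P u w" if u: "u \<in> C" for u d
  proof -
    have "gauge_in P u (- (w + d *\<^sub>R u)) = gauge_in P u (- w) - d"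
      using gauge_shift[OF u, of "- w" "- d"] by simp
    then have g: "gauge_in P u (w + d *\<^sub>R u) + gauge_in P u (- (w + d *\<^sub>R u)) = gauge_in P u w + gauge_in P u (- w)"
      "(gauge_in P u (w + d *\<^sub>R u) - gauge_in P u (- (w + d *\<^sub>R u))) / 2 = (gauge_in P u w - gauge_in P u (- w)) / 2 + d"
      using gauge_shift[OF u, of w d] by (simp_all add: field_simps)
    then have "hilbert_norm P u (w + d *\<^sub>R u) = hilbert_norm P u w"
      "balanced_lift P u (w + d *\<^sub>R u) = balanced_lift P u w"
      by (simp only: hilbert_norm_def) (simp only: balanced_lift_def g scaleR_add_left, simp)
    then show ?thesis by (simp add: tube_part_def)
  qed
  show ?thesis
    using u *[of u d] *[of "-u" "-d"] tube_part_uminus_base[of C u] unfolding symmetrize_def by auto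
qed

lemma tube_part_mem_symmetrize:
  assumes "u \<in> P"
  shows "(u, tube_part P u w) \<in> tube_pairs \<or> (- u, - tube_part P u w) \<in> tube_pairs"
proof -
  consider "u \<in> C" | "- u \<in> C" using assms by (auto simp: symmetrize_def)
  then show ?thesis
  proof cases
    case 1
    then show ?thesis using tube_part_mem[of u w] by (simp add: tube_pairs_def)
  next
    case 2
    then show ?thesis using tube_part_mem[of "-u" w] tube_part_uminus_base[of C u]
      by (simp add: tube_pairs_def add.commute) (metis minus_diff_commute)
  qed
qed

text \<open>On \<open>C\<close> the formula is continuous since its denominator is at least 1. The
  case of \<open>-C\<close> follows because the tube part ignores the sign of the base, and
  \<open>P\<close> is the union of these two open sets.\<close>

lemma continuous_on_tube_part: "continuous_on (P \<times> UNIV) (\<lambda>(u, w). tube_part P u w)"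
proof -
  have C: "continuous_on (C \<times> UNIV) (\<lambda>(u, w). tube_part P u w)"
  proof -
    have "1 + hilbert_norm P u w \<noteq> 0" if "u \<in> C" for u w
      using hilbert_norm_nonneg[OF that, of w] by simp
    then show ?thesis
      unfolding case_prod_beta tube_part_def balanced_lift_def hilbert_norm_def
      by (intro continuous_intros continuous_on_gauge_compose) auto
  qed
  have "continuous_on (uminus ` C \<times> UNIV) ((\<lambda>(u, w). tube_part P u w) \<circ> (\<lambda>(u, w). (- u, w)))"
    by (intro continuous_on_compose continuous_on_subset[OF C]) (auto intro!: continuous_intros simp: case_prod_beta)
  then have C': "continuous_on (uminus ` C \<times> UNIV) (\<lambda>(u, w). tube_part P u w)"
    by (simp add: o_def case_prod_beta tube_part_uminus_base)
  have "P \<times> UNIV = C \<times> UNIV \<union> uminus ` C \<times> (UNIV :: 'a set)"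
    by (auto simp: symmetrize_def image_iff) (metis minus_minus)
  then show ?thesis using continuous_on_open_Un[OF _ _ C C'] open_cone
    by (simp add: open_Times open_negations)
qed

text \<open>The hypotheses say that the second complex vector is \<open>a + i b\<close> times the
  first. Balance forces \<open>b = 0\<close>; then \<open>a *\<^sub>R w\<close> and
  \<open>w'\<close> have the same tube part over \<open>u'\<close>, hence the same norm and balanced
  lift, so they differ by a multiple of \<open>u'\<close>.\<close>

lemma tube_part_inj:
  assumes u: "u \<in> P" and u': "u' \<in> P"
    and eq: "u' = a *\<^sub>R u - b *\<^sub>R tube_part P u w" "tube_part P u' w' = b *\<^sub>R u + a *\<^sub>R tube_part P u w"
  shows "b = 0 \<and> (\<exists>d. w' = a *\<^sub>R w + d *\<^sub>R u)"
proof -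
  have main: "b = 0 \<and> (\<exists>d. w' = a *\<^sub>R w + d *\<^sub>R u)"
    if u: "u \<in> C" and u': "u' \<in> C"
      and eq: "u' = a *\<^sub>R u - b *\<^sub>R tube_part P u w" "tube_part P u' w' = b *\<^sub>R u + a *\<^sub>R tube_part P u w"
    for u u' a b w w'
  proof -
    define N N' where "N = hilbert_norm P u w" and "N' = hilbert_norm P u' w'"
    have N: "0 \<le> N" "0 \<le> N'" using hilbert_norm_nonneg u u' by (simp_all add: N_def N'_def)
    have b: "b = 0"
    proof (rule balanced_unique[OF u gauge_tube_part[OF u, of w]])
      show "a *\<^sub>R u - b *\<^sub>R tube_part P u w \<in> C" using u' eq(1) by simp
      show "gauge_in P (a *\<^sub>R u - b *\<^sub>R tube_part P u w) (b *\<^sub>R u + a *\<^sub>R tube_part P u w) = N' / (1 + N')"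
        "gauge_in P (a *\<^sub>R u - b *\<^sub>R tube_part P u w) (- (b *\<^sub>R u + a *\<^sub>R tube_part P u w)) = N' / (1 + N')"
        unfolding eq[symmetric] using gauge_tube_part[OF u', of w'] by (simp_all add: N'_def)
    qed (use N in \<open>auto simp: N_def[symmetric]\<close>)
    have a0: "a \<noteq> 0" using eq(1) u' zero_not_mem b by auto
    have a: "a > 0"
    proof (rule ccontr)
      assume "\<not> a > 0"
      then have "- a > 0" using a0 by simp
      then have "(- a) *\<^sub>R u \<in> C" using u scale_mem by blast
      then show False using not_both[OF u'] eq(1) b by simp
    qed
    define M where "M = hilbert_norm P u' (a *\<^sub>R w)"
    have M: "0 \<le> M" using hilbert_norm_nonneg u' by (simp add: M_def)
    have tp: "tube_part P u' (a *\<^sub>R w) = tube_part P u' w'" using tube_part_scale[OF a0, of u w] eq b by simp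
    then have "M / (1 + M) = N' / (1 + N')"
      using gauge_tube_part(1)[OF u', of w'] gauge_tube_part(1)[OF u', of "a *\<^sub>R w"] by (simp add: M_def N'_def)
    \<comment> \<open>The map N \<mapsto> N / (1 + N) is injective on nonnegative numbers.\<close>
    then have "M = N'" using M N(2) by (simp add: field_simps)
    then have "balanced_lift P u' (a *\<^sub>R w) = balanced_lift P u' w'"
      using tp M by (simp add: tube_part_def M_def N'_def)
    then obtain d d' where "a *\<^sub>R w - d *\<^sub>R u' = w' - d' *\<^sub>R u'"
      unfolding balanced_lift_def by blast
    then have "w' = a *\<^sub>R w + (d' - d) *\<^sub>R u'" by (simp add: algebra_simps)
    then have "w' = a *\<^sub>R w + ((d' - d) * a) *\<^sub>R u" using eq(1) b by simp
    then show ?thesis using b by blast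
  qed
  have sgn: "\<exists>s::real. (s = 1 \<or> s = -1) \<and> s *\<^sub>R x \<in> C" if "x \<in> P" for x
    using that unfolding symmetrize_def by (metis mem_Collect_eq scaleR_minus1_left scaleR_one)
  \<comment> \<open>The signs carry \<open>u\<close> and \<open>u'\<close> into \<open>C\<close>;
    the factor \<open>a + i b\<close> then becomes \<open>s * s' * (a + i b)\<close>.\<close>
  obtain s where s: "s = 1 \<or> s = -1" "s *\<^sub>R u \<in> C" using sgn[OF u] by blast
  obtain s' where s': "s' = 1 \<or> s' = -1" "s' *\<^sub>R u' \<in> C" using sgn[OF u'] by blast
  have tp: "tube_part P (s *\<^sub>R u) (s *\<^sub>R w) = s *\<^sub>R tube_part P u w"
    "tube_part P (s' *\<^sub>R u') (s' *\<^sub>R w') = s' *\<^sub>R tube_part P u' w'"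
    using s(1) s'(1) by (intro tube_part_scale, force)+
  have "s * s' * b = 0 \<and> (\<exists>d. s' *\<^sub>R w' = (s * s' * a) *\<^sub>R s *\<^sub>R w + d *\<^sub>R s *\<^sub>R u)"
    by (rule main[OF s(2) s'(2)]) (use s(1) s'(1) eq in \<open>auto simp: tp algebra_simps\<close>)
  then obtain d where "b = 0" "s' *\<^sub>R w' = (s * s' * a) *\<^sub>R s *\<^sub>R w + d *\<^sub>R s *\<^sub>R u" using s(1) s'(1) by auto
  then have "w' = a *\<^sub>R w + (s' * d * s) *\<^sub>R u"
    using s(1) s'(1) by (auto simp: algebra_simps minus_equation_iff)
  then show ?thesis using \<open>b = 0\<close> by blast
qed

text \<open>The real and imaginary parts of (1 + i t)(u + i p).\<close>

definition rotate_pair :: "real \<Rightarrow> 'a \<times> 'a \<Rightarrow> 'a \<times> 'a" where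
  "rotate_pair t z = (fst z - t *\<^sub>R snd z, snd z + t *\<^sub>R fst z)"

text \<open>The rotation balances the pair and the division undoes the compression, so the result is
  a pair \<open>(u, w)\<close> over the same point of the tube. This continuous lift is what makes
  the parametrisation by pairs \<open>(u, w)\<close> a quotient map.\<close>

definition balance :: "'a \<times> 'a \<Rightarrow> 'a \<times> 'a" where
  "balance z = (let (u, p) = rotate_pair (balance_param z) z in (u, p /\<^sub>R (1 - gauge_in P u p)))"

lemma balance:
  assumes z: "z \<in> tube_pairs"
  shows "fst (balance z) \<in> C"
    "rotate_pair (balance_param z) z = (fst (balance z), tube_part P (fst (balance z)) (snd (balance z)))"
proof -
  obtain u p where up: "rotate_pair (balance_param z) z = (u, p)" by fastforce
  have t: "\<bar>balance_param z\<bar> \<le> 1" "imbalance z (balance_param z) = 0" using balance_param[OF z] by auto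
  have u: "u \<in> C" using rotated_mem[of "fst z" "snd z", OF _ t(1)] z up by (auto simp: rotate_pair_def)
  have "gauge_in P u p < 1" "gauge_in P u (- p) = gauge_in P u p"
    using balanced_lt_one[of "fst z" "snd z", OF _ t(1)] z up t(2) by (auto simp: rotate_pair_def imbalance_def)
  then have "tube_part P u (p /\<^sub>R (1 - gauge_in P u p)) = p" using tube_part_inverse[OF u] by blast
  then show "fst (balance z) \<in> C"
    "rotate_pair (balance_param z) z = (fst (balance z), tube_part P (fst (balance z)) (snd (balance z)))"
    using u up by (simp_all add: balance_def)
qed

lemma continuous_on_balance: "continuous_on tube_pairs balance"
proof -
  let ?u = "\<lambda>z. fst (rotate_pair (balance_param z) z)" and ?p = "\<lambda>z. snd (rotate_pair (balance_param z) z)"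
  have m: "?u z \<in> C" "gauge_in P (?u z) (?p z) < 1" if "z \<in> tube_pairs" for z
    using balance[OF that] gauge_tube_part(1)[of "fst (balance z)" "snd (balance z)"]
      hilbert_norm_nonneg[of "fst (balance z)" "snd (balance z)"] by auto
  have c: "continuous_on tube_pairs ?u" "continuous_on tube_pairs ?p"
    unfolding rotate_pair_def using continuous_on_balance_param by (auto intro!: continuous_intros)
  have "continuous_on tube_pairs (\<lambda>z. (?u z, ?p z /\<^sub>R (1 - gauge_in P (?u z) (?p z))))"
    by (intro continuous_on_Pair continuous_on_scaleR continuous_on_inverse continuous_on_diff
        continuous_on_const continuous_on_gauge_compose c) (use m in force)+
  then show ?thesis by (simp add: balance_def[abs_def] case_prod_beta Let_def)
qed

end

section \<open>Convex subsets of projective space\<close>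

lemma proj_class_cases:
  obtains v :: "'k::field ^ ('n::finite option)" where "v \<noteq> 0" "x = proj_class v"
proof
  have "proj_rel (proj_rep x) (proj_rep x)"
    by (rule Quotient3_rep_reflp[OF Quotient3_projective_space])
  then show "proj_rep x \<noteq> 0" by (simp add: proj_rel_def)
  show "x = proj_class (proj_rep x)"
    using Quotient3_abs_rep[OF Quotient3_projective_space] by metis
qed

lemma proj_class_scale: "c \<noteq> 0 \<Longrightarrow> proj_class (c *s v) = proj_class v"
proof (cases "v = 0")
  case False
  then show "c \<noteq> 0 \<Longrightarrow> proj_class (c *s v) = proj_class v"
    by (subst eq_commute, subst proj_class_eq_iff) auto
qed simp

definition cone_over :: "('k::field, 'n::finite) projective_space set \<Rightarrow> ('k ^ ('n option)) set" where
  "cone_over X = {v. v \<noteq> 0 \<and> proj_class v \<in> X}"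

lemma open_cone_over: "open (cone_over X) \<longleftrightarrow> open X"
  unfolding cone_over_def open_projective_space_def ..

lemma cone_over_scale: "c \<noteq> 0 \<Longrightarrow> c *s v \<in> cone_over X \<longleftrightarrow> v \<in> cone_over X"
  by (simp add: cone_over_def proj_class_scale)

lemma continuous_on_proj_class:
  "continuous_on (- {0}) (proj_class :: 'k::real_normed_field ^ ('n::finite option) \<Rightarrow> _)"
proof (subst continuous_on_open_vimage)
  show "\<forall>B. open B \<longrightarrow> open ((proj_class :: 'k ^ ('n option) \<Rightarrow> _) -` B \<inter> - {0})"
    using open_cone_over unfolding cone_over_def by (auto simp: vimage_def Int_def conj_commute)
qed (simp add: open_Compl)

text \<open>The vectors lying over the image form the union of the preimages of \<open>W\<close>
  under all nonzero scalings.\<close>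

lemma open_proj_class_image:
  fixes W :: "('k::real_normed_field ^ ('n::finite option)) set"
  assumes "open W" "0 \<notin> W"
  shows "open (proj_class ` W)"
proof -
  have "cone_over (proj_class ` W) = (\<Union>c\<in>-{0}. (\<lambda>v. c *s v) -` W)"
  proof (intro equalityI subsetI)
    fix v assume "v \<in> cone_over (proj_class ` W)"
    then obtain w where "v \<noteq> 0" "w \<in> W" "proj_class v = proj_class w" by (auto simp: cone_over_def)
    moreover from this have "w \<noteq> 0" using assms(2) by auto
    ultimately obtain c where "c \<noteq> 0" "w = c *s v" using proj_class_eq_iff by blast
    then show "v \<in> (\<Union>c\<in>-{0}. (\<lambda>v. c *s v) -` W)" using \<open>w \<in> W\<close> by auto
  next
    fix v assume "v \<in> (\<Union>c\<in>-{0}. (\<lambda>v. c *s v) -` W)"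
    then obtain c where c: "c \<noteq> 0" "c *s v \<in> W" by blast
    then have "v \<noteq> 0" "proj_class v \<in> proj_class ` W" using assms(2) proj_class_scale[of c v] by (force, metis imageI)
    then show "v \<in> cone_over (proj_class ` W)" by (simp add: cone_over_def)
  qed
  moreover have "open ((\<lambda>v. c *s v) -` W)" for c :: 'k
    unfolding vector_scalar_mult_def by (intro open_vimage assms continuous_intros continuous_on_vec_lambda)
  ultimately show ?thesis unfolding open_cone_over[symmetric] by auto
qed

text \<open>The sign of a function homogeneous of degree two is well defined on projective space.
  The disjoint open sets obtained this way serve both for disconnecting a line and for separating
  points.\<close>

lemma proj_sign_sets:
  fixes F :: "real ^ ('n::finite option) \<Rightarrow> real"
  assumes cont: "continuous_on UNIV F" and scale: "\<And>c w. F (c *\<^sub>R w) = c\<^sup>2 * F w"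
  shows "open (proj_class ` (F -` {0<..}))" "open (proj_class ` (F -` {..<0}))"
    "proj_class ` (F -` {0<..}) \<inter> proj_class ` (F -` {..<0}) = {}"
proof -
  have F0: "F 0 = 0" using scale[of 0 0] by simp
  have "open (F -` {0<..})" "open (F -` {..<0})" using cont by (auto intro!: open_vimage)
  then show "open (proj_class ` (F -` {0<..}))" "open (proj_class ` (F -` {..<0}))"
    using F0 by (auto intro!: open_proj_class_image)
  have False if F: "0 < F x" "F y < 0" "proj_class x = proj_class y" for x y
  proof -
    have "x \<noteq> 0" "y \<noteq> 0" using F F0 by auto
    then obtain c where "c \<noteq> 0" "y = c *s x" using F(3) by (auto simp: proj_class_eq_iff)
    then have "F y > 0" using scale F(1) by (simp add: scalar_mult_eq_scaleR)
    then show False using F(2) by simp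
  qed
  then show "proj_class ` (F -` {0<..}) \<inter> proj_class ` (F -` {..<0}) = {}" by force
qed

lemma span_pairE:
  fixes w :: "'a::real_vector"
  assumes "w \<in> span {u, v}"
  obtains a b where "w = a *\<^sub>R u + b *\<^sub>R v"
proof -
  obtain a where "w - a *\<^sub>R u \<in> span {v}" using assms by (auto simp: span_insert[of u])
  then obtain b where "w - a *\<^sub>R u = b *\<^sub>R v" by (auto simp: span_singleton)
  then have "w = a *\<^sub>R u + b *\<^sub>R v" by (simp add: algebra_simps)
  then show thesis by (rule that)
qed

lemma projective_line_span:
  fixes u v :: "real ^ ('n::finite option)"
  assumes "u \<noteq> 0" "v \<noteq> 0" "proj_class u \<noteq> proj_class v"
  shows "projective_line (proj_class ` (span {u, v} - {0}))" "independent {u, v}" "u \<noteq> v"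
proof -
  show ne: "u \<noteq> v" using assms by auto
  have "u \<notin> span {v}"
  proof
    assume "u \<in> span {v}"
    then obtain k where k: "u = k *s v" by (auto simp: span_singleton scalar_mult_eq_scaleR)
    then show False using assms proj_class_scale[of k v] by auto
  qed
  then show ind: "independent {u, v}" using assms ne by (simp add: independent_insert)
  then have "dim (span {u, v}) = 2" using ne by (simp add: dim_eq_card_independent)
  then show "projective_line (proj_class ` (span {u, v} - {0}))"
    unfolding projective_line_def using subspace_span by blast
qed

section \<open>The two opposite cones over a convex open set\<close>

context
  fixes E :: "(real, 'n::finite) projective_space set" and P
  assumes convex: "projectively_convex E" and open_E: "open E"
  defines "P \<equiv> cone_over E"
begin

text \<open>The segment runs between the vectors, not their classes: for independent vectors,
  replacing \<open>v\<close> by \<open>- v\<close> selects the complementary arc of the projective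
  line. On the cone over \<open>E\<close> this turns out to be an equivalence relation with two
  opposite classes.\<close>

definition joined :: "real ^ ('n option) \<Rightarrow> real ^ ('n option) \<Rightarrow> bool" where
  "joined u v \<longleftrightarrow> (\<forall>t\<in>{0..1}. (1 - t) *\<^sub>R u + t *\<^sub>R v \<in> cone_over E)"

lemma scaleR_mem_P: "c \<noteq> 0 \<Longrightarrow> c *\<^sub>R v \<in> P \<longleftrightarrow> v \<in> P"
  using cone_over_scale[of c v E] by (simp add: P_def scalar_mult_eq_scaleR)

lemma zero_not_mem_P: "0 \<notin> P" by (simp add: P_def cone_over_def)

lemma uminus_mem_P: "- v \<in> P \<longleftrightarrow> v \<in> P" using scaleR_mem_P[of "-1" v] by simp

lemma joined_sym: "joined u v \<Longrightarrow> joined v u"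
  unfolding joined_def
proof
  fix t :: real assume "\<forall>t\<in>{0..1}. (1 - t) *\<^sub>R u + t *\<^sub>R v \<in> cone_over E" "t \<in> {0..1}"
  from bspec[OF this(1), of "1 - t"] this(2) show "(1 - t) *\<^sub>R v + t *\<^sub>R u \<in> cone_over E"
    by (simp add: add.commute)
qed

lemma joined_mem: "joined u v \<Longrightarrow> u \<in> P" "joined u v \<Longrightarrow> v \<in> P"
  unfolding joined_def P_def by (drule bspec[of _ _ 0], simp, simp) (drule bspec[of _ _ 1], simp, simp)

lemma joined_multiple: "u \<in> P \<Longrightarrow> c > 0 \<Longrightarrow> joined u (c *\<^sub>R u)"
  unfolding joined_def
proof
  fix t :: real assume u: "u \<in> P" and c: "c > 0" and t: "t \<in> {0..1}"
  have "1 - t + t * c > 0"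
    using t c by (cases "t = 1") (auto intro: add_pos_nonneg)
  then have "(1 - t + t * c) *\<^sub>R u \<in> P" using scaleR_mem_P u by simp
  then show "(1 - t) *\<^sub>R u + t *\<^sub>R c *\<^sub>R u \<in> cone_over E" by (simp add: P_def scaleR_add_left)
qed

lemma joined_subsegment: "joined u v \<Longrightarrow> t \<in> {0..1} \<Longrightarrow> joined u ((1 - t) *\<^sub>R u + t *\<^sub>R v)"
  unfolding joined_def
proof
  fix s assume *: "\<forall>t\<in>{0..1}. (1 - t) *\<^sub>R u + t *\<^sub>R v \<in> cone_over E" "t \<in> {0..1}" and s: "s \<in> {0..1::real}"
  have "s * t \<in> {0..1}" using *(2) s by (auto intro: mult_le_one)
  from bspec[OF *(1) this]
  show "(1 - s) *\<^sub>R u + s *\<^sub>R ((1 - t) *\<^sub>R u + t *\<^sub>R v) \<in> cone_over E" by (simp add: algebra_simps)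
qed

lemma same_proj_classE:
  assumes "u \<in> P" "v \<in> P" "proj_class u = proj_class v"
  obtains k where "k \<noteq> 0" "v = k *\<^sub>R u"
proof -
  have "u \<noteq> 0" "v \<noteq> 0" using assms by (auto simp: P_def cone_over_def)
  then show ?thesis using assms(3) that by (auto simp: proj_class_eq_iff scalar_mult_eq_scaleR)
qed

text \<open>If both arcs from \<open>u\<close> to \<open>v\<close> left \<open>E\<close>, the two
  missing points would separate the classes of \<open>u\<close> and \<open>v\<close> inside the
  intersection of \<open>E\<close> with their line, which is connected.\<close>

lemma joined_or_joined_uminus:
  assumes u: "u \<in> P" and v: "v \<in> P"
  shows "joined u v \<or> joined u (- v)"
proof (cases "proj_class u = proj_class v")
  case True
  then obtain k where k: "k \<noteq> 0" "v = k *\<^sub>R u" using same_proj_classE[OF u v] by blast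
  then show ?thesis using joined_multiple[OF u, of k] joined_multiple[OF u, of "-k"]
    by (cases "k > 0") auto
next
  case False
  have nz: "u \<noteq> 0" "v \<noteq> 0" using u v by (auto simp: P_def cone_over_def)
  note line = projective_line_span[OF nz False]
  define L where "L = proj_class ` (span {u, v} - {0})"
  show ?thesis
  proof (rule ccontr)
    assume "\<not> ?thesis"
    then obtain s t where s: "s \<in> {0..1}" "(1 - s) *\<^sub>R u + s *\<^sub>R v \<notin> P"
      and t: "t \<in> {0..1}" "(1 - t) *\<^sub>R u + t *\<^sub>R (- v) \<notin> P" unfolding joined_def P_def by blast
    have "s \<noteq> 0" by (rule notI) (use s(2) u in simp)
    moreover have "s \<noteq> 1" by (rule notI) (use s(2) v in simp)
    moreover have "t \<noteq> 0" by (rule notI) (use t(2) u in simp)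
    moreover have "t \<noteq> 1" by (rule notI) (use t(2) v in \<open>simp add: uminus_mem_P\<close>)
    ultimately have s': "0 < s" "s < 1" and t': "0 < t" "t < 1" using s(1) t(1) by auto
    obtain \<alpha> :: "real ^ ('n option) \<Rightarrow> real" where \<alpha>: "linear \<alpha>" "\<alpha> u = 1" "\<alpha> v = 0"
      using linear_independent_extend[OF line(2), of "\<lambda>x. if x = u then 1 else 0"] line(3) by auto
    obtain \<beta> :: "real ^ ('n option) \<Rightarrow> real" where \<beta>: "linear \<beta>" "\<beta> u = 0" "\<beta> v = 1"
      using linear_independent_extend[OF line(2), of "\<lambda>x. if x = u then 0 else 1"] line(3) by auto
    \<comment> \<open>A product of two linear forms that, on the plane of \<open>u\<close> and
      \<open>v\<close>, vanish exactly on the two missing points; it is positive at \<open>u\<close>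
      and negative at \<open>v\<close>.\<close>
    define F where "F w = (\<alpha> w * s - \<beta> w * (1 - s)) * (\<alpha> w * t + \<beta> w * (1 - t))" for w
    have F_scale: "F (c *\<^sub>R w) = c\<^sup>2 * F w" for c w
      unfolding F_def linear_scale[OF \<alpha>(1)] linear_scale[OF \<beta>(1)]
      by (simp add: power2_eq_square algebra_simps)
    have contF: "continuous_on UNIV F" unfolding F_def
      using linear_continuous_on[OF linear_conv_bounded_linear[THEN iffD1, OF \<alpha>(1)]]
        linear_continuous_on[OF linear_conv_bounded_linear[THEN iffD1, OF \<beta>(1)]]
      by (intro continuous_intros)
    note op = proj_sign_sets(1,2)[OF contF F_scale] and disj = proj_sign_sets(3)[OF contF F_scale]
    have cover: "E \<inter> L \<subseteq> proj_class ` (F -` {0<..}) \<union> proj_class ` (F -` {..<0})"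
    proof
      fix x assume "x \<in> E \<inter> L"
      then obtain w where w: "x = proj_class w" "w \<in> span {u, v}" "w \<noteq> 0" "w \<in> P"
        by (auto simp: L_def P_def cone_over_def)
      obtain a b where ab: "w = a *\<^sub>R u + b *\<^sub>R v"
        using w(2) span_pairE by blast
      then have "\<alpha> w = a" "\<beta> w = b"
        using \<alpha> \<beta> by (simp_all add: linear_add linear_scale)
      then have F: "F w = (a * s - b * (1 - s)) * (a * t + b * (1 - t))" by (simp add: F_def)
      have "F w \<noteq> 0"
      proof
        assume "F w = 0"
        then consider "a * s = b * (1 - s)" | "a * t = - b * (1 - t)" unfolding F by force
        then show False
        proof cases
          case 1
          then have "(1 - s) *\<^sub>R w = (a * (1 - s)) *\<^sub>R u + (a * s) *\<^sub>R v"
            unfolding ab by (simp add: scaleR_add_right 1 mult.commute)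
          also have "\<dots> = a *\<^sub>R ((1 - s) *\<^sub>R u + s *\<^sub>R v)" by (simp add: algebra_simps)
          finally have "a *\<^sub>R ((1 - s) *\<^sub>R u + s *\<^sub>R v) \<in> P" using scaleR_mem_P[of "1 - s" w] w(4) s' by simp
          then show False using s(2) scaleR_mem_P zero_not_mem_P by (cases "a = 0") auto
        next
          case 2
          then have "(1 - t) *\<^sub>R w = (a * (1 - t)) *\<^sub>R u + (- (a * t)) *\<^sub>R v"
          proof -
            have "(1 - t) * b = - (a * t)" using 2 by (simp add: mult.commute)
            then show ?thesis unfolding ab by (simp only: scaleR_add_right scaleR_scaleR mult.commute[of "1 - t" a])
          qed
          also have "\<dots> = a *\<^sub>R ((1 - t) *\<^sub>R u + t *\<^sub>R (- v))" by (simp add: algebra_simps)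
          finally have "a *\<^sub>R ((1 - t) *\<^sub>R u + t *\<^sub>R (- v)) \<in> P" using scaleR_mem_P[of "1 - t" w] w(4) t' by simp
          then show False using t(2) scaleR_mem_P[of a] zero_not_mem_P by (cases "a = 0") auto
        qed
      qed
      then show "x \<in> proj_class ` (F -` {0<..}) \<union> proj_class ` (F -` {..<0})"
        unfolding w(1) by (cases "F w" "0::real" rule: linorder_cases) auto
    qed
    have "connected (E \<inter> L)" using convex line(1) unfolding projectively_convex_def L_def by blast
    from connectedD[OF this op] have "proj_class ` (F -` {0<..}) \<inter> (E \<inter> L) = {} \<or> proj_class ` (F -` {..<0}) \<inter> (E \<inter> L) = {}"
      using disj cover by blast
    moreover have "F u > 0" "F v < 0"
      using s' t' \<alpha> \<beta> by (simp_all add: F_def mult_neg_pos)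
    moreover have "proj_class u \<in> E \<inter> L" "proj_class v \<in> E \<inter> L"
      using u v nz by (auto simp: P_def cone_over_def L_def intro!: imageI span_base)
    ultimately show False by blast
  qed
qed

text \<open>For distinct classes the two arcs fill a whole projective line, which a convex set does
  not contain. For equal classes one of the two segments passes through 0.\<close>

lemma not_joined_both:
  assumes "joined u v" "joined u (- v)"
  shows False
proof -
  have u: "u \<in> P" and v: "v \<in> P" using joined_mem assms by blast+
  show ?thesis
  proof (cases "proj_class u = proj_class v")
    case True
    then obtain k where k: "k \<noteq> 0" "v = k *\<^sub>R u" using same_proj_classE[OF u v] by blast
    \<comment> \<open>The parameter at which the segment from \<open>u\<close> to
      \<open>- \<bar>k\<bar> *\<^sub>R u\<close> hits 0; its endpoint is \<open>v\<close> or
      \<open>- v\<close>.\<close>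
    define t where "t = 1 / (1 + \<bar>k\<bar>)"
    have t: "t \<in> {0..1}" "1 - t - t * \<bar>k\<bar> = 0" by (auto simp: t_def field_simps)
    have "(1 - t) *\<^sub>R u + t *\<^sub>R (- \<bar>k\<bar>) *\<^sub>R u = (1 - t - t * \<bar>k\<bar>) *\<^sub>R u" by (simp add: algebra_simps)
    then have 0: "(1 - t) *\<^sub>R u + t *\<^sub>R (- \<bar>k\<bar>) *\<^sub>R u \<notin> P" using t(2) zero_not_mem_P by simp
    have "- \<bar>k\<bar> *\<^sub>R u = v \<or> - \<bar>k\<bar> *\<^sub>R u = - v" using k(2) by (auto simp: abs_if)
    then have "(1 - t) *\<^sub>R u + t *\<^sub>R (- \<bar>k\<bar>) *\<^sub>R u \<in> P"
      using assms t(1) unfolding joined_def P_def by metis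
    then show False using 0 by blast
  next
    case False
    have nz: "u \<noteq> 0" "v \<noteq> 0" using u v by (auto simp: P_def cone_over_def)
    note line = projective_line_span[OF nz False]
    have "proj_class ` (span {u, v} - {0}) \<subseteq> E"
    proof
      fix x assume "x \<in> proj_class ` (span {u, v} - {0})"
      then obtain w where w: "x = proj_class w" "w \<in> span {u, v}" "w \<noteq> 0" by auto
      obtain a b where ab: "w = a *\<^sub>R u + b *\<^sub>R v"
        using w(2) span_pairE by blast
      have pos: "a *\<^sub>R u + b *\<^sub>R z \<in> P" if "joined u z" "a \<ge> 0" "b \<ge> 0" "a + b \<noteq> 0" for a b z
      proof -
        have "b / (a + b) \<in> {0..1}" using that by (auto simp: divide_le_eq_1)
        then have "(1 - b / (a + b)) *\<^sub>R u + (b / (a + b)) *\<^sub>R z \<in> P"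
          using that(1) unfolding joined_def P_def by blast
        then have "(a + b) *\<^sub>R ((1 - b / (a + b)) *\<^sub>R u + (b / (a + b)) *\<^sub>R z) \<in> P"
          using scaleR_mem_P that(4) by blast
        then show ?thesis using that(4) by (simp add: scaleR_add_right right_diff_distrib)
      qed
      have ne: "a \<noteq> 0 \<or> b \<noteq> 0" using w(3) ab by auto
      have "w \<in> P"
      proof (cases "a \<ge> 0"; cases "b \<ge> 0")
        assume "a \<ge> 0" "b \<ge> 0" then show ?thesis using pos[OF assms(1), of a b] ne ab by auto
      next
        assume "a \<ge> 0" "\<not> b \<ge> 0" then show ?thesis using pos[OF assms(2), of a "-b"] ab by auto
      next
        assume "\<not> a \<ge> 0" "b \<ge> 0" then have "- w \<in> P" using pos[OF assms(2), of "-a" b] ab by auto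
        then show ?thesis using uminus_mem_P by blast
      next
        assume "\<not> a \<ge> 0" "\<not> b \<ge> 0" then have "- w \<in> P" using pos[OF assms(1), of "-a" "-b"] ab by auto
        then show ?thesis using uminus_mem_P by blast
      qed
      then show "x \<in> E" using w(1) by (simp add: P_def cone_over_def)
    qed
    then show False using convex line(1) unfolding projectively_convex_def by blast
  qed
qed

text \<open>The complement is the projection of a closed set along the compact interval
  \<open>{0..1}\<close>, hence closed.\<close>

lemma open_joined: "open {x. joined w x}"
proof -
  have "closed ((\<lambda>z. (1 - fst z) *\<^sub>R w + fst z *\<^sub>R snd z) -` (- P))"
    using open_E open_cone_over[of E] by (intro closed_vimage) (auto simp: P_def intro!: continuous_intros)
  then have "closedin (top_of_set ({0..1} \<times> UNIV)) (({0..1} \<times> UNIV) \<inter> (\<lambda>z. (1 - fst z) *\<^sub>R w + fst z *\<^sub>R snd z) -` (- P))"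
    using closedin_closed_Int by blast
  from closedin_compact_projection[OF compact_Icc this]
  have "closed {x. \<exists>t. t \<in> {0..1} \<and> (t, x) \<in> {0..1} \<times> UNIV \<inter> (\<lambda>z. (1 - fst z) *\<^sub>R w + fst z *\<^sub>R snd z) -` (- P)}" (is "closed ?N")
    by simp
  moreover have "{x. joined w x} = - ?N" by (auto simp: joined_def P_def)
  ultimately show ?thesis by (simp add: open_Compl)
qed

text \<open>Each point \<open>?x t\<close> of the segment from \<open>u\<close> to \<open>v\<close>
  is joined to \<open>w\<close> for exactly one choice of sign, and both choices are open in
  \<open>t\<close>. Connectedness propagates the sign from \<open>u\<close> to
  \<open>v\<close>.\<close>

lemma joined_trans:
  assumes uv: "joined w u" "joined u v"
  shows "joined w v"
proof -
  let ?x = "\<lambda>t. (1 - t) *\<^sub>R u + t *\<^sub>R v"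
  define A B where "A = ?x -` {x. joined w x}" and "B = (\<lambda>t. - ?x t) -` {x. joined w x}"
  have "open A" "open B" unfolding A_def B_def by (intro open_vimage open_joined continuous_intros)+
  moreover have "A \<inter> B \<inter> {0..1} = {}"
  proof -
    have False if "joined w (?x t)" "joined w (- ?x t)" for t using not_joined_both that by blast
    then show ?thesis unfolding A_def B_def by blast
  qed
  moreover have "{0..1} \<subseteq> A \<union> B"
  proof
    fix t :: real assume "t \<in> {0..1}"
    then have "?x t \<in> P" using uv(2) unfolding joined_def P_def by blast
    then show "t \<in> A \<union> B" using joined_or_joined_uminus[of w "?x t"] joined_mem(1)[OF uv(1)]
      unfolding A_def B_def by blast
  qed
  ultimately have "A \<inter> {0..1} = {} \<or> B \<inter> {0..1} = {}"
    using connectedD[of "{0..1::real}" A B] by auto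
  moreover have "0 \<in> A \<inter> {0..1}" using uv(1) by (simp add: A_def)
  ultimately have "B \<inter> {0..1} = {}" by blast
  moreover have "(1::real) \<in> {0..1}" by simp
  ultimately have "1 \<notin> B" by blast
  then have "\<not> joined w (- v)" by (simp add: B_def)
  then show ?thesis using joined_or_joined_uminus[of w v] joined_mem uv by blast
qed

lemma open_convex_cone_joined:
  assumes u0: "u0 \<in> P"
  shows "open_convex_cone {x. joined u0 x}" "symmetrize {x. joined u0 x} = P"
proof -
  have scale: "joined u0 (c *\<^sub>R x)" if "joined u0 x" "c > 0" for c x
    using joined_trans[OF that(1) joined_multiple[OF joined_mem(2)[OF that(1)] that(2)]] .
  show "open_convex_cone {x. joined u0 x}"
  proof
    show "open {x. joined u0 x}" by (rule open_joined)
    show "c *\<^sub>R x \<in> {x. joined u0 x}" if "0 < c" "x \<in> {x. joined u0 x}" for c x using scale that by blast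
    show "0 \<notin> {x. joined u0 x}" using joined_mem(2) zero_not_mem_P by blast
    show "x + y \<in> {x. joined u0 x}" if "x \<in> {x. joined u0 x}" "y \<in> {x. joined u0 x}" for x y
    proof -
      have "joined x y" using that joined_sym joined_trans by blast
      \<comment> \<open>The sum is twice the midpoint of a segment that stays in the cone.\<close>
      then have "joined x ((1 - 1/2) *\<^sub>R x + (1/2) *\<^sub>R y)" by (rule joined_subsegment) simp
      then have "joined u0 (2 *\<^sub>R ((1 - 1/2) *\<^sub>R x + (1/2) *\<^sub>R y))"
        using scale[OF joined_trans] that(1) by simp
      then show ?thesis by (simp add: algebra_simps)
    qed
  qed
  show "symmetrize {x. joined u0 x} = P"
    unfolding symmetrize_def using joined_mem(2)[of u0] uminus_mem_P joined_or_joined_uminus[OF u0] by auto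
qed

end

lemma projectively_convex_cone:
  fixes \<Omega> :: "(real, 'n::finite) projective_space set"
  assumes "projectively_convex \<Omega>" "open \<Omega>"
  obtains C where "open_convex_cone C" "symmetrize C = cone_over \<Omega>"
proof (cases "cone_over \<Omega> = {}")
  case True
  \<comment> \<open>The axioms of the locale admit the empty cone.\<close>
  have "open_convex_cone ({} :: (real ^ ('n option)) set)" by unfold_locales auto
  then show ?thesis using that[of "{}"] True by (simp add: symmetrize_def)
next
  case False
  then obtain u0 where "u0 \<in> cone_over \<Omega>" by blast
  then show ?thesis using open_convex_cone_joined[OF assms] that by blast
qed

section \<open>Elliptic tubes\<close>

lemma matrix_vector_mult_nonzero:
  fixes A :: "'k::field ^ 'm ^ 'm"
  assumes "invertible A" "v \<noteq> 0"
  shows "A *v v \<noteq> 0"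
proof
  assume 0: "A *v v = 0"
  obtain B where "B ** A = mat 1" using assms(1) unfolding invertible_def by blast
  then have "v = B *v (A *v v)" by (simp add: matrix_vector_mul_assoc)
  with 0 assms(2) show False by simp
qed

lemma pgl_rel_refl: "invertible A \<Longrightarrow> pgl_rel A A"
  unfolding pgl_rel_def by (auto simp: matrix_smult_one intro!: exI[of _ 1])

lemma proj_rel_refl: "v \<noteq> 0 \<Longrightarrow> proj_rel v v"
  unfolding proj_rel_def by (auto intro!: exI[of _ 1])

lemma pgl_act_class:
  "invertible A \<Longrightarrow> v \<noteq> 0 \<Longrightarrow> pgl_act (pgl_class A) (proj_class v) = proj_class (A *v v)"
  by (rule pgl_act.abs_eq[OF pgl_rel_refl proj_rel_refl])

lemma pgl_class_cases:
  obtains A :: "'k::field ^ ('n::finite option) ^ ('n option)" where "invertible A" "\<gamma> = pgl_class A"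
proof
  have "pgl_rel (pgl_rep \<gamma>) (pgl_rep \<gamma>)"
    by (rule Quotient3_rep_reflp[OF Quotient3_pgl])
  then show "invertible (pgl_rep \<gamma>)" by (simp add: pgl_rel_def)
  show "\<gamma> = pgl_class (pgl_rep \<gamma>)" using Quotient3_abs_rep[OF Quotient3_pgl] by metis
qed

lemma pgl_mult_class:
  "invertible A \<Longrightarrow> invertible B \<Longrightarrow> pgl_mult (pgl_class A) (pgl_class B) = pgl_class (A ** B)"
  by (rule pgl_mult.abs_eq[OF pgl_rel_refl pgl_rel_refl])

text \<open>Lets a scalar factor between vectors be absorbed into the matrix representing an element
  of \<open>\<Gamma>\<close>.\<close>

lemma pgl_class_smult:
  assumes "c \<noteq> 0" "invertible A"
  shows "pgl_class (matrix_smult c A) = pgl_class A" "invertible (matrix_smult c A)"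
proof -
  obtain B where B: "A ** B = mat 1" "B ** A = mat 1" using assms(2) unfolding invertible_def by blast
  then have "matrix_smult c A ** matrix_smult (inverse c) B = mat 1"
    "matrix_smult (inverse c) B ** matrix_smult c A = mat 1"
    using assms(1) by (simp_all add: matrix_smult_matrix_mult matrix_smult_one)
  then show inv: "invertible (matrix_smult c A)" unfolding invertible_def by blast
  have "pgl_rel A (matrix_smult c A)" unfolding pgl_rel_def using assms inv by blast
  then show "pgl_class (matrix_smult c A) = pgl_class A"
    using Quotient3_rel_abs[OF Quotient3_pgl] by metis
qed

lemma pgl_act_mult: "pgl_act (pgl_mult a b) x = pgl_act a (pgl_act b x)"
proof -
  obtain A where A: "invertible A" "a = pgl_class A" using pgl_class_cases by blast
  obtain B where B: "invertible B" "b = pgl_class B" using pgl_class_cases by blast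
  obtain v where v: "v \<noteq> 0" "x = proj_class v" using proj_class_cases by blast
  show ?thesis unfolding A(2) B(2) v(2)
    by (simp add: A B v pgl_mult_class pgl_act_class invertible_mult matrix_vector_mult_nonzero
        matrix_vector_mul_assoc)
qed

lemma pgl_act_one: "pgl_act pgl_one x = x"
proof -
  obtain v where v: "v \<noteq> 0" "x = proj_class v" using proj_class_cases by blast
  show ?thesis unfolding pgl_one.abs_eq v(2) by (simp add: pgl_act_class invertible_mat_1 v)
qed

lemma PGL_simps: "x \<otimes>\<^bsub>PGL\<^esub> y = pgl_mult x y" "\<one>\<^bsub>PGL\<^esub> = pgl_one" "carrier PGL = UNIV"
  by (simp_all add: PGL_def)

lemma pgl_act_inv: "pgl_act (inv\<^bsub>PGL\<^esub> a) (pgl_act a x) = x" "pgl_act a (pgl_act (inv\<^bsub>PGL\<^esub> a) x) = x"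
proof -
  interpret group "PGL :: ('a, 'b) pgl monoid" by (rule group_PGL)
  show "pgl_act (inv\<^bsub>PGL\<^esub> a) (pgl_act a x) = x" "pgl_act a (pgl_act (inv\<^bsub>PGL\<^esub> a) x) = x"
    using l_inv[of a] r_inv[of a] by (simp_all add: PGL_simps flip: pgl_act_mult) (simp_all add: pgl_act_one)
qed

lemma inj_pgl_act: "inj (pgl_act a)"
  by (rule inj_on_inverseI[of _ "pgl_act (inv\<^bsub>PGL\<^esub> a)"]) (rule pgl_act_inv)

lemma mem_cone_over_image:
  assumes "invertible A" "pgl_act (pgl_class A) ` X = Y"
  shows "A *v v \<in> cone_over Y \<longleftrightarrow> v \<in> cone_over X"
proof (cases "v = 0")
  case False
  then show ?thesis
    using assms(1) inj_image_mem_iff[OF inj_pgl_act, of "pgl_class A" "proj_class v" X]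
    by (simp add: cone_over_def matrix_vector_mult_nonzero pgl_act_class flip: assms(2))
qed (simp add: cone_over_def)

text \<open>Stated for an abstract action so that it serves the real action and the action through
  \<open>complex_pgl\<close> alike.\<close>

lemma orbit_of_eq_iff:
  fixes act :: "('k::field, 'n::finite) pgl \<Rightarrow> 'a \<Rightarrow> 'a"
  assumes \<Gamma>: "subgroup \<Gamma> PGL" and mult: "\<And>a b x. act (pgl_mult a b) x = act a (act b x)"
    and one: "\<And>x. act pgl_one x = x"
  shows "orbit_of act \<Gamma> x = orbit_of act \<Gamma> y \<longleftrightarrow> (\<exists>\<gamma>\<in>\<Gamma>. y = act \<gamma> x)"
proof
  have "pgl_one \<in> \<Gamma>" using subgroup.one_closed[OF \<Gamma>] by (simp add: PGL_simps)
  then have "y \<in> orbit_of act \<Gamma> y" unfolding orbit_of_def by (rule rev_image_eqI) (simp add: one)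
  then show "orbit_of act \<Gamma> x = orbit_of act \<Gamma> y \<Longrightarrow> \<exists>\<gamma>\<in>\<Gamma>. y = act \<gamma> x"
    unfolding orbit_of_def by auto
next
  assume "\<exists>\<gamma>\<in>\<Gamma>. y = act \<gamma> x"
  then obtain \<gamma> where \<gamma>: "\<gamma> \<in> \<Gamma>" "y = act \<gamma> x" by blast
  interpret group "PGL :: ('k, 'n) pgl monoid" by (rule group_PGL)
  have "act \<delta> y \<in> orbit_of act \<Gamma> x" if "\<delta> \<in> \<Gamma>" for \<delta>
    using subgroup.m_closed[OF \<Gamma> that \<gamma>(1)] unfolding orbit_of_def \<gamma>(2)
    by (metis PGL_simps(1) image_eqI mult)
  moreover have "act \<delta> x \<in> orbit_of act \<Gamma> y" if "\<delta> \<in> \<Gamma>" for \<delta>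
  proof -
    have "act (pgl_mult \<delta> (inv\<^bsub>PGL\<^esub> \<gamma>)) y = act (pgl_mult \<delta> (pgl_mult (inv\<^bsub>PGL\<^esub> \<gamma>) \<gamma>)) x"
      by (simp add: \<gamma>(2) mult)
    also have "pgl_mult (inv\<^bsub>PGL\<^esub> \<gamma>) \<gamma> = pgl_one" using l_inv[of \<gamma>] by (simp add: PGL_simps)
    finally have "act \<delta> x = act (pgl_mult \<delta> (inv\<^bsub>PGL\<^esub> \<gamma>)) y" by (simp add: mult one)
    moreover have "pgl_mult \<delta> (inv\<^bsub>PGL\<^esub> \<gamma>) \<in> \<Gamma>"
      using subgroup.m_closed[OF \<Gamma> that subgroup.m_inv_closed[OF \<Gamma> \<gamma>(1)]] by (simp add: PGL_simps)
    ultimately show ?thesis unfolding orbit_of_def by blast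
  qed
  ultimately show "orbit_of act \<Gamma> x = orbit_of act \<Gamma> y" unfolding orbit_of_def by blast
qed

section \<open>Complex vectors as pairs of real vectors\<close>

definition complex_pair :: "real ^ 'm \<Rightarrow> real ^ 'm \<Rightarrow> complex ^ 'm" where
  "complex_pair u p = (\<chi> i. Complex (u $ i) (p $ i))"

lemma complex_pair_eq_iff: "complex_pair u p = complex_pair u' p' \<longleftrightarrow> u = u' \<and> p = p'"
  by (auto simp: complex_pair_def vec_eq_iff)

lemma complex_pair_eq_0_iff: "complex_pair u p = 0 \<longleftrightarrow> u = 0 \<and> p = 0"
  by (auto simp: complex_pair_def vec_eq_iff complex_eq_iff)

lemma complex_vec_eq_pair: "complex_vec u = complex_pair u 0"
  by (simp add: complex_vec_def complex_pair_def vec_eq_iff complex_of_real_def)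

lemma scale_complex_pair:
  "c *s complex_pair u p = complex_pair (Re c *\<^sub>R u - Im c *\<^sub>R p) (Im c *\<^sub>R u + Re c *\<^sub>R p)"
  by (simp add: complex_pair_def vec_eq_iff complex_eq_iff algebra_simps)

lemma add_complex_pair: "complex_pair u p + complex_pair u' p' = complex_pair (u + u') (p + p')"
  by (simp add: complex_pair_def vec_eq_iff complex_eq_iff)

lemma complex_mat_mult_pair: "complex_mat A *v complex_pair u p = complex_pair (A *v u) (A *v p)"
  by (simp add: complex_mat_def complex_pair_def vec_eq_iff complex_eq_iff matrix_vector_mult_def)

lemma continuous_on_complex_pair:
  assumes "continuous_on S f" "continuous_on S g"
  shows "continuous_on S (\<lambda>x. complex_pair (f x) (g x))"
  unfolding complex_pair_def Complex_eq using assms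
  by (intro continuous_on_vec_lambda continuous_intros)

lemma open_complex_pair_image:
  fixes S :: "((real ^ 'm) \<times> (real ^ 'm)) set"
  assumes "open S"
  shows "open ((\<lambda>(u, p). complex_pair u p) ` S)"
proof -
  have "(\<lambda>(u, p). complex_pair u p) ` S = (\<lambda>z. (\<chi> i. Re (z $ i), \<chi> i. Im (z $ i))) -` S"
    by (auto simp: complex_pair_def image_iff vec_nth_inverse) (auto simp: vec_eq_iff intro!: bexI)
  also have "open \<dots>"
    by (intro open_vimage assms continuous_on_Pair continuous_on_vec_lambda continuous_intros)
  finally show ?thesis .
qed

lemma complex_mat_invertible:
  fixes A :: "real ^ 'm ^ 'm"
  assumes "invertible A"
  shows "invertible (complex_mat A)"
proof -
  have mult: "complex_mat (C ** D) = complex_mat C ** complex_mat D" for C D :: "real ^ 'm ^ 'm"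
    by (simp add: complex_mat_def matrix_matrix_mult_def vec_eq_iff)
  have "complex_mat (mat 1 :: real ^ 'm ^ 'm) = mat 1"
    by (simp add: complex_mat_def mat_def vec_eq_iff)
  then show ?thesis using assms mult unfolding invertible_def by metis
qed

lemma complex_pgl_class: "invertible A \<Longrightarrow> complex_pgl (pgl_class A) = pgl_class (complex_mat A)"
  by (rule complex_pgl.abs_eq[OF pgl_rel_refl])

lemma complex_pgl_mult: "complex_pgl (pgl_mult a b) = pgl_mult (complex_pgl a) (complex_pgl b)"
proof -
  obtain A where A: "invertible A" "a = pgl_class A" using pgl_class_cases by blast
  obtain B where B: "invertible B" "b = pgl_class B" using pgl_class_cases by blast
  have "complex_mat (A ** B) = complex_mat A ** complex_mat B"
    by (simp add: complex_mat_def matrix_matrix_mult_def vec_eq_iff)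
  then show ?thesis
    by (simp add: A B pgl_mult_class complex_pgl_class complex_mat_invertible invertible_mult)
qed

lemma complex_pgl_one: "complex_pgl (pgl_one :: (real, 'n::finite) pgl) = pgl_one"
proof -
  have "complex_mat (mat 1 :: real ^ ('n option) ^ ('n option)) = mat 1"
    by (simp add: complex_mat_def mat_def vec_eq_iff)
  then show ?thesis unfolding pgl_one.abs_eq by (simp add: complex_pgl_class invertible_mat_1)
qed

lemma complex_point_class: "u \<noteq> 0 \<Longrightarrow> complex_point (proj_class u) = proj_class (complex_pair u 0)"
  using complex_point.abs_eq[OF proj_rel_refl] by (simp add: complex_vec_eq_pair)

lemma complex_point_act: "complex_point (pgl_act a x) = pgl_act (complex_pgl a) (complex_point x)"
proof -
  obtain A where A: "invertible A" "a = pgl_class A" using pgl_class_cases by blast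
  obtain v where v: "v \<noteq> 0" "x = proj_class v" using proj_class_cases by blast
  show ?thesis unfolding A(2) v(2)
    by (simp add: A v pgl_act_class complex_point_class matrix_vector_mult_nonzero complex_pgl_class
        complex_mat_invertible complex_pair_eq_0_iff complex_mat_mult_pair)
qed

definition tube_point ::
  "(real, 'n::finite) projective_space set \<Rightarrow> real ^ ('n option) \<Rightarrow> real ^ ('n option)
     \<Rightarrow> (complex, 'n) projective_space" where
  "tube_point \<Omega> u w = proj_class (complex_pair u (tube_part (cone_over \<Omega>) u w))"

lemma tube_point_equivariant:
  assumes A: "invertible A" "pgl_act (pgl_class A) ` \<Omega> = \<Omega>'" and u: "u \<noteq> 0"
  shows "tube_point \<Omega>' (A *v u) (A *v w) = pgl_act (complex_pgl (pgl_class A)) (tube_point \<Omega> u w)"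
proof -
  have "tube_part (cone_over \<Omega>') (A *v u) (A *v w) = A *v tube_part (cone_over \<Omega>) u w"
    by (rule tube_part_linear_image[OF matrix_vector_mul_linear mem_cone_over_image[OF A]])
  then show ?thesis unfolding tube_point_def
    using A(1) u by (simp add: complex_pgl_class pgl_act_class complex_mat_invertible complex_pair_eq_0_iff complex_mat_mult_pair)
qed

text \<open>Some rotation of \<open>(c0, c1)\<close> is symmetric about the real axis up to positive factors:
  multiply by the conjugate of the bisecting direction.\<close>
lemma bisecting_scalar:
  fixes c0 c1 :: complex
  assumes "c0 \<noteq> 0 \<or> c1 \<noteq> 0" "0 \<le> Re (c0 * cnj c1)"
  obtains k where "k \<noteq> 0"
    "\<bar>Im (k * c0)\<bar> \<le> Re (k * c0)" "\<bar>Im (k * c1)\<bar> \<le> Re (k * c1)"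
    "0 < (Re (k * c0) + Im (k * c0)) + (Re (k * c1) + Im (k * c1))"
    "0 < (Re (k * c0) - Im (k * c0)) + (Re (k * c1) - Im (k * c1))"
proof (cases "c0 = 0 \<or> c1 = 0")
  case True
  then show ?thesis using assms(1) that[of "inverse c0"] that[of "inverse c1"] by auto
next
  case False
  define r0 r1 where "r0 = cmod c0" and "r1 = cmod c1"
  have r: "0 < r0" "0 < r1" using False by (simp_all add: r0_def r1_def)
  define d where "d = c0 * cnj c1"
  have d: "0 \<le> Re d" using assms(2) by (simp add: d_def)
  have "cmod d = r0 * r1" by (simp add: d_def r0_def r1_def norm_mult)
  then have Im: "\<bar>Im d\<bar> \<le> r0 * r1" using abs_Im_le_cmod[of d] by simp
  have sq: "c0 * cnj c0 = of_real (r0 * r0)" "c1 * cnj c1 = of_real (r1 * r1)"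
    using complex_norm_square[of c0] complex_norm_square[of c1]
    by (simp_all add: r0_def r1_def power2_eq_square)
  \<comment> \<open>The conjugate of r1 c0 + r0 c1, a positive multiple of the sum of the unit
    vectors in the directions of \<open>c0\<close> and \<open>c1\<close>.\<close>
  define k where "k = of_real r1 * cnj c0 + of_real r0 * cnj c1"
  have "k * c0 = of_real r1 * (c0 * cnj c0) + of_real r0 * d"
    "k * c1 = of_real r1 * cnj d + of_real r0 * (c1 * cnj c1)"
    by (simp_all add: k_def d_def algebra_simps)
  then have k: "Re (k * c0) = r0 * (r0 * r1 + Re d)" "Im (k * c0) = r0 * Im d"
    "Re (k * c1) = r1 * (r0 * r1 + Re d)" "Im (k * c1) = - (r1 * Im d)"
    unfolding sq by (simp_all add: algebra_simps)
  have le: "\<bar>Im (k * c0)\<bar> \<le> Re (k * c0)" "\<bar>Im (k * c1)\<bar> \<le> Re (k * c1)"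
    unfolding k abs_mult abs_minus_cancel using r Im d by (auto intro!: mult_left_mono)
  have "0 < r0 * r1" using r by simp
  \<comment> \<open>The two numbers have a positive sum, so at least one is positive; this yields
    strict positivity although each summand below is only known to be nonnegative.\<close>
  then have strict: "0 < r0 * r1 + Re d + x \<or> 0 < r0 * r1 + Re d - x" for x using d by linarith
  have "0 < (Re (k * c0) + Im (k * c0)) + (Re (k * c1) + Im (k * c1))"
    "0 < (Re (k * c0) - Im (k * c0)) + (Re (k * c1) - Im (k * c1))"
  proof -
    have "0 \<le> r0 * r1 + Re d + Im d" "0 \<le> r0 * r1 + Re d - Im d" using d Im by linarith+
    then have "0 < r0 * (r0 * r1 + Re d + Im d) + r1 * (r0 * r1 + Re d - Im d)"
      "0 < r0 * (r0 * r1 + Re d - Im d) + r1 * (r0 * r1 + Re d + Im d)"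
      using r strict[of "Im d"] by (auto intro: add_pos_nonneg add_nonneg_pos)
    then show "0 < (Re (k * c0) + Im (k * c0)) + (Re (k * c1) + Im (k * c1))"
      "0 < (Re (k * c0) - Im (k * c0)) + (Re (k * c1) - Im (k * c1))"
      unfolding k by (simp_all add: algebra_simps)
  qed
  moreover from this have "k \<noteq> 0" by auto
  ultimately show ?thesis using that le by blast
qed

section \<open>The elliptic tube of a convex domain\<close>

locale convex_domain = open_convex_cone C for C :: "(real ^ ('n::finite option)) set" +
  fixes \<Omega> :: "(real, 'n) projective_space set"
  assumes symmetrize_eq: "symmetrize C = cone_over \<Omega>"
begin

lemma mem_cone_over_iff: "v \<in> cone_over \<Omega> \<longleftrightarrow> v \<in> C \<or> - v \<in> C"
  unfolding symmetrize_eq[symmetric] symmetrize_def by simp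

lemma nonzero: "v \<in> C \<Longrightarrow> v \<noteq> 0"
  using mem_cone_over_iff[of v] by (auto simp: cone_over_def)

lemma nonneg_combination_mem:
  assumes "v0 \<in> C" "v1 \<in> C" "0 \<le> a" "0 \<le> b" "0 < a + b"
  shows "a *\<^sub>R v0 + b *\<^sub>R v1 \<in> C"
  using assms add_mem scale_mem by (cases "a = 0"; cases "b = 0") auto

text \<open>After multiplication by the bisecting scalar, \<open>u + p\<close> and
  \<open>u - p\<close> have nonnegative coefficients with positive sum in \<open>v0\<close> and
  \<open>v1\<close>.\<close>

lemma elliptic_segment_subset:
  assumes "v0 \<in> C" "v1 \<in> C"
  shows "elliptic_segment v0 v1 \<subseteq> (\<lambda>(u, p). proj_class (complex_pair u p)) ` tube_pairs"
proof
  fix z assume "z \<in> elliptic_segment v0 v1"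
  then obtain c0 c1 where z: "z = proj_class (c0 *s complex_vec v0 + c1 *s complex_vec v1)"
    "c0 *s complex_vec v0 + c1 *s complex_vec v1 \<noteq> 0" "Re (c0 * cnj c1) \<ge> 0"
    unfolding elliptic_segment_def by blast
  have "c0 \<noteq> 0 \<or> c1 \<noteq> 0" using z(2) by auto
  then obtain k where k: "k \<noteq> 0"
    "\<bar>Im (k * c0)\<bar> \<le> Re (k * c0)" "\<bar>Im (k * c1)\<bar> \<le> Re (k * c1)"
    "0 < (Re (k * c0) + Im (k * c0)) + (Re (k * c1) + Im (k * c1))"
    "0 < (Re (k * c0) - Im (k * c0)) + (Re (k * c1) - Im (k * c1))"
    using bisecting_scalar[OF _ z(3)] by metis
  define u p where "u = Re (k * c0) *\<^sub>R v0 + Re (k * c1) *\<^sub>R v1"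
    and "p = Im (k * c0) *\<^sub>R v0 + Im (k * c1) *\<^sub>R v1"
  have "k *s (c0 *s complex_vec v0 + c1 *s complex_vec v1) = (k * c0) *s complex_vec v0 + (k * c1) *s complex_vec v1"
    by (simp add: vector_scalar_mult_def vec_eq_iff algebra_simps)
  also have "\<dots> = complex_pair u p"
    unfolding complex_vec_eq_pair scale_complex_pair add_complex_pair by (simp add: u_def p_def)
  finally have "z = proj_class (complex_pair u p)" using z(1) proj_class_scale[OF k(1)] by metis
  moreover have "u + p = (Re (k * c0) + Im (k * c0)) *\<^sub>R v0 + (Re (k * c1) + Im (k * c1)) *\<^sub>R v1"
    "u - p = (Re (k * c0) - Im (k * c0)) *\<^sub>R v0 + (Re (k * c1) - Im (k * c1)) *\<^sub>R v1"
    by (simp_all add: u_def p_def algebra_simps)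
  then have "u + p \<in> C" "u - p \<in> C"
    using k by (auto intro!: nonneg_combination_mem assms)
  ultimately show "z \<in> (\<lambda>(u, p). proj_class (complex_pair u p)) ` tube_pairs"
    by (auto simp: tube_pairs_def image_iff)
qed

text \<open>The tube is built from segments with distinct endpoints, so a real point needs a second
  endpoint. Moving \<open>v\<close> along one axis while keeping a nonzero coordinate at another
  index changes its class.\<close>

lemma exists_independent_mem:
  assumes "v \<in> C"
  obtains v' where "v' \<in> C" "proj_class v' \<noteq> proj_class v"
proof -
  obtain i :: "'n option" where i: "v $ i \<noteq> 0" using nonzero[OF assms] by (auto simp: vec_eq_iff)
  obtain j :: "'n option" where j: "j \<noteq> i" by (metis option.distinct(1))
  obtain e where e: "e > 0" "ball v e \<subseteq> C" using open_cone assms open_contains_ball by blast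
  define v' where "v' = v + (e / 2) *\<^sub>R axis j 1"
  have "v' \<in> C" using e by (auto simp: v'_def subset_iff dist_norm)
  moreover have "proj_class v' \<noteq> proj_class v"
  proof
    assume "proj_class v' = proj_class v"
    then obtain c where "c \<noteq> 0" "v' = c *s v"
      using nonzero[OF assms] nonzero[OF \<open>v' \<in> C\<close>] proj_class_eq_iff by metis
    then have "v' $ i = c * v $ i" "v' $ j = c * v $ j" by simp_all
    then have "v $ i = c * v $ i" "v $ j + e / 2 = c * v $ j" using j by (simp_all add: v'_def axis_def)
    then show False using i e(1) by simp
  qed
  ultimately show thesis by (rule that)
qed

lemma proj_segment_subset:
  assumes "v0 \<in> C" "v1 \<in> C"
  shows "proj_segment v0 v1 \<subseteq> \<Omega>"
proof
  fix x assume "x \<in> proj_segment v0 v1"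
  then obtain c0 c1 where x: "x = proj_class (c0 *\<^sub>R v0 + c1 *\<^sub>R v1)" "c0 *\<^sub>R v0 + c1 *\<^sub>R v1 \<noteq> 0" "c0 * c1 \<ge> 0"
    unfolding proj_segment_def scalar_mult_eq_scaleR by blast
  have nz: "c0 \<noteq> 0 \<or> c1 \<noteq> 0" using x(2) by auto
  have "c0 *\<^sub>R v0 + c1 *\<^sub>R v1 \<in> cone_over \<Omega>"
  proof (cases "0 \<le> c0 \<and> 0 \<le> c1")
    case True
    then show ?thesis using nonneg_combination_mem[OF assms, of c0 c1] nz mem_cone_over_iff by force
  next
    case False
    then have "0 \<le> - c0" "0 \<le> - c1" "0 < - c0 + - c1" using x(3) nz by (auto simp: zero_le_mult_iff)
    then have "- (c0 *\<^sub>R v0 + c1 *\<^sub>R v1) \<in> C"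
      using nonneg_combination_mem[OF assms, of "- c0" "- c1"] by simp
    then show ?thesis using mem_cone_over_iff by blast
  qed
  then show "x \<in> \<Omega>" using x(1) by (simp add: cone_over_def)
qed

lemma elliptic_segmentI:
  assumes "v0 \<in> C" "v1 \<in> C" "proj_class v0 \<noteq> proj_class v1"
  shows "elliptic_segment v0 v1 \<subseteq> elliptic_tube \<Omega>"
  unfolding elliptic_tube_def using assms proj_segment_subset nonzero by blast

text \<open>A presentation of a segment inside \<open>\<Omega>\<close> must have both vectors in
  \<open>C\<close> or both in \<open>-C\<close>, which gives one inclusion. Conversely
  \<open>u + p\<close> and \<open>u - p\<close> span a segment whose elliptic segment contains the
  point, unless they are proportional.\<close>

lemma elliptic_tube_eq: "elliptic_tube \<Omega> = (\<lambda>(u, p). proj_class (complex_pair u p)) ` tube_pairs"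
proof
  show "elliptic_tube \<Omega> \<subseteq> (\<lambda>(u, p). proj_class (complex_pair u p)) ` tube_pairs"
  proof
    fix z assume "z \<in> elliptic_tube \<Omega>"
    then obtain v0 v1 where v: "v0 \<noteq> 0" "v1 \<noteq> 0" "proj_class v0 \<noteq> proj_class v1"
      "proj_segment v0 v1 \<subseteq> \<Omega>" "z \<in> elliptic_segment v0 v1" unfolding elliptic_tube_def by blast
    have mem: "a *\<^sub>R v0 + b *\<^sub>R v1 \<in> cone_over \<Omega>" if "a * b \<ge> 0" "a \<noteq> 0 \<or> b \<noteq> 0" for a b
    proof -
      have "a *\<^sub>R v0 + b *\<^sub>R v1 \<noteq> 0"
      proof
        assume eq: "a *\<^sub>R v0 + b *\<^sub>R v1 = 0"
        then have "a \<noteq> 0" "b \<noteq> 0" using that(2) v by auto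
        moreover have "a *\<^sub>R v0 = (- b) *\<^sub>R v1" using eq by (simp add: add_eq_0_iff)
        ultimately have "proj_class v0 = proj_class v1"
          using proj_class_scale[of a v0] proj_class_scale[of "- b" v1] by (simp add: scalar_mult_eq_scaleR)
        then show False using v(3) by blast
      qed
      moreover from this have "proj_class (a *\<^sub>R v0 + b *\<^sub>R v1) \<in> proj_segment v0 v1"
        unfolding proj_segment_def scalar_mult_eq_scaleR using that(1) by blast
      ultimately show ?thesis using v(4) by (auto simp: cone_over_def)
    qed
    \<comment> \<open>Some \<open>\<mu> *\<^sub>R x - y\<close> lies outside the cone over
      \<open>\<Omega>\<close>. For \<open>\<mu> \<le> 0\<close> its negative represents a point of
      the segment, and for \<open>\<mu> > 0\<close> it is a sum of vectors of \<open>D\<close>;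
      either way a contradiction.\<close>
    have no_sign_change: False if x: "x \<in> D" "open_convex_cone D" "symmetrize D = cone_over \<Omega>"
      "- y \<in> D" "{x, y} = {v0, v1}" for x y D
    proof -
      interpret D: open_convex_cone D by (rule x)
      have xy: "a *\<^sub>R x + b *\<^sub>R y \<in> cone_over \<Omega>" if "a * b \<ge> 0" "a \<noteq> 0 \<or> b \<noteq> 0" for a b
        using mem[of a b] mem[of b a] x(5) that by (auto simp: doubleton_eq_iff add.commute mult.commute)
      obtain \<mu> where \<mu>: "\<mu> *\<^sub>R x - y \<notin> cone_over \<Omega>" using D.line_meets_complement[OF x(1)] x(3) by blast
      show False
      proof (cases "\<mu> \<le> 0")
        case True
        then show False using xy[of "- \<mu>" 1] \<mu> symmetrize_uminus_iff[of "\<mu> *\<^sub>R x - y" D] x(3)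
          by (simp add: add.commute)
      next
        case False
        then have "\<mu> *\<^sub>R x + - y \<in> D" by (intro D.add_mem D.scale_mem x) simp
        then show False using \<mu> x(3) by (auto simp: symmetrize_def)
      qed
    qed
    have "v0 \<in> cone_over \<Omega>" "v1 \<in> cone_over \<Omega>" using mem[of 1 0] mem[of 0 1] by simp_all
    moreover have "\<not> (v0 \<in> C \<and> - v1 \<in> C)" "\<not> (- v0 \<in> C \<and> v1 \<in> C)"
      using no_sign_change[OF _ open_convex_cone_axioms symmetrize_eq] by (blast, metis insert_commute)
    ultimately consider "v0 \<in> C" "v1 \<in> C" | "- v0 \<in> C" "- v1 \<in> C" using mem_cone_over_iff by blast
    then show "z \<in> (\<lambda>(u, p). proj_class (complex_pair u p)) ` tube_pairs"
    proof cases
      case 1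
      then show ?thesis using elliptic_segment_subset v(5) by blast
    next
      case 2
      have uminus: "complex_vec (- v) = - complex_vec v" for v :: "real ^ 'n option"
        by (simp add: complex_vec_def vec_eq_iff)
      have "elliptic_segment v0 v1 \<subseteq> elliptic_segment (- v0) (- v1)"
      proof
        fix y assume "y \<in> elliptic_segment v0 v1"
        then obtain c0 c1 where y: "y = proj_class (c0 *s complex_vec v0 + c1 *s complex_vec v1)"
          "c0 *s complex_vec v0 + c1 *s complex_vec v1 \<noteq> 0" "Re (c0 * cnj c1) \<ge> 0"
          unfolding elliptic_segment_def by blast
        have "c0 *s complex_vec v0 + c1 *s complex_vec v1 = (- c0) *s complex_vec (- v0) + (- c1) *s complex_vec (- v1)"
          by (simp add: uminus vec_eq_iff)
        then show "y \<in> elliptic_segment (- v0) (- v1)"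
          unfolding elliptic_segment_def using y
          by (intro CollectI exI[of _ "- c0"] exI[of _ "- c1"]) auto
      qed
      then show ?thesis using elliptic_segment_subset[OF 2] v(5) by blast
    qed
  qed
next
  show "(\<lambda>(u, p). proj_class (complex_pair u p)) ` tube_pairs \<subseteq> elliptic_tube \<Omega>"
  proof clarify
    fix u p assume "(u, p) \<in> tube_pairs"
    then have v: "u + p \<in> C" "u - p \<in> C" by (auto simp: tube_pairs_def)
    show "proj_class (complex_pair u p) \<in> elliptic_tube \<Omega>"
    proof (cases "proj_class (u + p) = proj_class (u - p)")
      case False
      \<comment> \<open>The product \<open>c0 * cnj c1\<close> is i/2, so the condition on its real
        part holds with equality.\<close>
      define c0 c1 where "c0 = Complex (1/2) (1/2)" and "c1 = Complex (1/2) (- 1/2)"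
      have eq: "c0 *s complex_vec (u + p) + c1 *s complex_vec (u - p) = complex_pair u p"
        unfolding complex_vec_eq_pair scale_complex_pair add_complex_pair complex_pair_eq_iff
        by (simp add: c0_def c1_def algebra_simps flip: scaleR_add_left)
      have "2 *\<^sub>R u \<in> C" using add_mem[OF v] by (simp add: scaleR_2)
      then have "u \<noteq> 0" using zero_not_mem by auto
      then have "complex_pair u p \<noteq> 0" by (simp add: complex_pair_eq_0_iff)
      then have "proj_class (complex_pair u p) \<in> elliptic_segment (u + p) (u - p)"
        unfolding elliptic_segment_def eq[symmetric]
        by (intro CollectI exI[of _ c0] exI[of _ c1]) (simp add: c0_def c1_def)
      then show ?thesis using elliptic_segmentI[OF v False] by blast
    next
      case True
      \<comment> \<open>Here \<open>u\<close> and \<open>p\<close> are real multiples of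
        \<open>v0\<close>, so the point is real. It lies on any segment starting at
        \<open>v0\<close>, with second coefficient 0.\<close>
      then obtain k where k: "k \<noteq> 0" "u - p = k *\<^sub>R (u + p)"
        using proj_class_eq_iff nonzero v scalar_mult_eq_scaleR by metis
      define v0 where "v0 = u + p"
      have up: "u = ((1 + k) / 2) *\<^sub>R v0" "p = ((1 - k) / 2) *\<^sub>R v0"
      proof -
        have "2 *\<^sub>R u = (u + p) + (u - p)" "2 *\<^sub>R p = (u + p) - (u - p)" by (simp_all add: scaleR_2)
        then have "2 *\<^sub>R u = (1 + k) *\<^sub>R v0" "2 *\<^sub>R p = (1 - k) *\<^sub>R v0"
          unfolding k(2) v0_def by (simp_all add: scaleR_add_left scaleR_diff_left)
        then have "(1/2) *\<^sub>R 2 *\<^sub>R u = (1/2) *\<^sub>R (1 + k) *\<^sub>R v0" "(1/2) *\<^sub>R 2 *\<^sub>R p = (1/2) *\<^sub>R (1 - k) *\<^sub>R v0" by metis+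
        then show "u = ((1 + k) / 2) *\<^sub>R v0" "p = ((1 - k) / 2) *\<^sub>R v0" by simp_all
      qed
      define c where "c = Complex ((1 + k) / 2) ((1 - k) / 2)"
      have eq: "complex_pair u p = c *s complex_vec v0"
        unfolding complex_vec_eq_pair scale_complex_pair up by (simp add: c_def)
      have c: "c \<noteq> 0" by (auto simp: c_def complex_eq_iff)
      have v0: "v0 \<in> C" using v by (simp add: v0_def)
      obtain v' where v': "v' \<in> C" "proj_class v' \<noteq> proj_class v0" using exists_independent_mem[OF v0] by blast
      have "complex_pair u p \<noteq> 0" using c nonzero[OF v0] unfolding eq by (auto simp: complex_vec_def vec_eq_iff)
      then have "proj_class (complex_pair u p) \<in> elliptic_segment v0 v'"
        unfolding elliptic_segment_def eq by (intro CollectI exI[of _ c] exI[of _ 0]) simp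
      then show ?thesis using elliptic_segmentI[OF v0 v'(1)] v'(2) by auto
    qed
  qed
qed

lemma tube_pairs_nonzero: "(u, p) \<in> tube_pairs \<Longrightarrow> u \<noteq> 0"
  using rotated_mem[of u p 0] nonzero by auto

lemma open_tube_pairs: "open tube_pairs"
proof -
  have "tube_pairs = (\<lambda>z. fst z + snd z) -` C \<inter> (\<lambda>z. fst z - snd z) -` C"
    by (auto simp: tube_pairs_def)
  then show ?thesis using open_cone by (auto intro!: open_Int open_vimage continuous_intros)
qed

text \<open>The map is open: \<open>complex_pair\<close> carries open sets of pairs to open sets,
  and the projection to projective space is open.\<close>

lemma quotient_map_tube_pairs:
  "quotient_map (top_of_set tube_pairs) (top_of_set (elliptic_tube \<Omega>)) (\<lambda>(u, p). proj_class (complex_pair u p))"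
    (is "quotient_map _ _ ?f")
proof (rule continuous_open_imp_quotient_map)
  have "continuous_on tube_pairs (proj_class \<circ> (\<lambda>(u, p). complex_pair u p))"
    by (intro continuous_on_compose continuous_on_subset[OF continuous_on_proj_class])
      (auto simp: case_prod_beta complex_pair_eq_0_iff tube_pairs_nonzero intro!: continuous_on_complex_pair continuous_intros)
  then have "continuous_on tube_pairs ?f" by (simp add: o_def case_prod_beta)
  then show "continuous_map (top_of_set tube_pairs) (top_of_set (elliptic_tube \<Omega>)) ?f"
    unfolding elliptic_tube_eq by (auto simp: continuous_map_in_subtopology)
  have "open (?f ` U)" if "open U" "U \<subseteq> tube_pairs" for U
  proof -
    have "?f ` U = proj_class ` ((\<lambda>(u, p). complex_pair u p) ` U)" by (auto simp: image_image case_prod_beta)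
    moreover have "0 \<notin> (\<lambda>(u, p). complex_pair u p) ` U"
      using that(2) tube_pairs_nonzero by (force simp: complex_pair_eq_0_iff)
    ultimately show ?thesis using open_proj_class_image open_complex_pair_image that(1) by metis
  qed
  then show "open_map (top_of_set tube_pairs) (top_of_set (elliptic_tube \<Omega>)) ?f"
    unfolding open_map_def openin_open_eq[OF open_tube_pairs] elliptic_tube_eq
    by (auto intro!: open_subset image_mono)
  show "?f ` topspace (top_of_set tube_pairs) = topspace (top_of_set (elliptic_tube \<Omega>))"
    by (simp add: elliptic_tube_eq)
qed

lemma tube_point_mem: "u \<in> cone_over \<Omega> \<Longrightarrow> tube_point \<Omega> u w \<in> elliptic_tube \<Omega>"
proof -
  assume "u \<in> cone_over \<Omega>"
  then consider "(u, tube_part P u w) \<in> tube_pairs" | "(- u, - tube_part P u w) \<in> tube_pairs"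
    using tube_part_mem_symmetrize[of u w] symmetrize_eq by auto
  then show ?thesis
  proof cases
    case 1
    then show ?thesis unfolding tube_point_def elliptic_tube_eq symmetrize_eq by force
  next
    case 2
    have "complex_pair (- u) (- tube_part P u w) = (- 1) *s complex_pair u (tube_part P u w)"
      by (simp add: scale_complex_pair)
    then have "proj_class (complex_pair u (tube_part P u w)) = proj_class (complex_pair (- u) (- tube_part P u w))"
      using proj_class_scale[of "- 1"] by (metis neg_equal_0_iff_equal one_neq_zero)
    then show ?thesis using 2 unfolding tube_point_def elliptic_tube_eq symmetrize_eq by force
  qed
qed

text \<open>A continuous map is a quotient map once its composite with some continuous map is one;
  here the inner map is \<open>balance\<close>.\<close>

lemma quotient_map_tube_point:
  "quotient_map (top_of_set (cone_over \<Omega> \<times> UNIV)) (top_of_set (elliptic_tube \<Omega>)) (\<lambda>(u, w). tube_point \<Omega> u w)"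
    (is "quotient_map ?X ?Y ?g")
proof (rule quotient_map_from_composition)
  have "continuous_on (cone_over \<Omega> \<times> UNIV) (proj_class \<circ> (\<lambda>(u, w). complex_pair u (tube_part (cone_over \<Omega>) u w)))"
    using continuous_on_tube_part
    by (intro continuous_on_compose continuous_on_subset[OF continuous_on_proj_class])
      (auto simp: case_prod_beta complex_pair_eq_0_iff cone_over_def symmetrize_eq intro!: continuous_on_complex_pair continuous_intros)
  then show "continuous_map ?X ?Y ?g"
    using tube_point_mem by (auto simp: continuous_map_in_subtopology o_def case_prod_beta tube_point_def)
  show "continuous_map (top_of_set tube_pairs) ?X balance"
    using continuous_on_balance balance(1) mem_cone_over_iff by (fastforce simp: continuous_map_in_subtopology mem_Times_iff)
  \<comment> \<open>\<open>balance\<close> changes u + i p only by the nonzero factor 1 + i t, which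
    the class does not see.\<close>
  have "proj_class (complex_pair u p) = (?g \<circ> balance) (u, p)" if z: "(u, p) \<in> tube_pairs" for u p
  proof -
    let ?t = "balance_param (u, p)"
    have "complex_pair (fst (balance (u, p))) (tube_part P (fst (balance (u, p))) (snd (balance (u, p))))
        = Complex 1 ?t *s complex_pair u p"
      using balance(2)[OF z] by (simp add: scale_complex_pair rotate_pair_def complex_pair_eq_iff add.commute)
    moreover have "Complex 1 ?t \<noteq> 0" by (simp add: complex_eq_iff)
    ultimately show ?thesis
      by (simp add: case_prod_beta tube_point_def flip: symmetrize_eq) (metis proj_class_scale)
  qed
  then show "quotient_map (top_of_set tube_pairs) ?Y (?g \<circ> balance)"
    by (intro quotient_map_eq[OF quotient_map_tube_pairs]) auto
qed

text \<open>The complex scalar between two balanced representatives is real by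
  \<open>tube_part_inj\<close>. What remains is precisely the ambiguity of \<open>(u, w)\<close> as
  a tangent vector of projective space.\<close>

lemma tube_point_eq_iff:
  assumes u: "u \<in> cone_over \<Omega>" and u': "u' \<in> cone_over \<Omega>"
  shows "tube_point \<Omega> u w = tube_point \<Omega> u' w' \<longleftrightarrow> (\<exists>a d. a \<noteq> 0 \<and> u' = a *\<^sub>R u \<and> w' = a *\<^sub>R w + d *\<^sub>R u)"
proof
  have nz: "u \<noteq> 0" "u' \<noteq> 0" using u u' by (auto simp: cone_over_def)
  assume "tube_point \<Omega> u w = tube_point \<Omega> u' w'"
  then obtain c where c: "c \<noteq> 0" "complex_pair u' (tube_part P u' w') = c *s complex_pair u (tube_part P u w)"
    unfolding tube_point_def symmetrize_eq using nz by (auto simp: proj_class_eq_iff complex_pair_eq_0_iff)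
  then have eq: "u' = Re c *\<^sub>R u - Im c *\<^sub>R tube_part P u w" "tube_part P u' w' = Im c *\<^sub>R u + Re c *\<^sub>R tube_part P u w"
    unfolding scale_complex_pair complex_pair_eq_iff by blast+
  from tube_part_inj[OF _ _ eq] u u' obtain d where "Im c = 0" "w' = Re c *\<^sub>R w + d *\<^sub>R u"
    unfolding symmetrize_eq by blast
  moreover from this have "Re c \<noteq> 0" using c(1) by (auto simp: complex_eq_iff)
  ultimately show "\<exists>a d. a \<noteq> 0 \<and> u' = a *\<^sub>R u \<and> w' = a *\<^sub>R w + d *\<^sub>R u" using eq(1) by auto
next
  assume "\<exists>a d. a \<noteq> 0 \<and> u' = a *\<^sub>R u \<and> w' = a *\<^sub>R w + d *\<^sub>R u"
  then obtain a d where a: "a \<noteq> 0" "u' = a *\<^sub>R u" "w' = a *\<^sub>R w + d *\<^sub>R u" by blast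
  then have "w' = a *\<^sub>R (w + (d / a) *\<^sub>R u)" by (simp add: algebra_simps)
  then have "tube_part P u' w' = a *\<^sub>R tube_part P u w"
    using tube_part_scale[OF a(1), of u] a(2) tube_part_shift[of u w] u unfolding symmetrize_eq by simp
  then have "complex_pair u' (tube_part P u' w') = of_real a *s complex_pair u (tube_part P u w)"
    using a(2) by (simp add: scale_complex_pair)
  moreover have "complex_of_real a \<noteq> 0" using a(1) by simp
  ultimately show "tube_point \<Omega> u w = tube_point \<Omega> u' w'"
    unfolding tube_point_def symmetrize_eq[symmetric] by (metis proj_class_scale)
qed

lemma tube_point_zero:
  assumes "u \<in> cone_over \<Omega>"
  shows "tube_point \<Omega> u 0 = complex_point (proj_class u)"
proof -
  have nz: "u \<noteq> 0" using assms by (auto simp: cone_over_def)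
  have "tube_part P u 0 = 0" by (simp add: tube_part_def balanced_lift_def)
  then show ?thesis using nz unfolding tube_point_def symmetrize_eq by (simp add: complex_point_class)
qed

end

section \<open>Charts of the quotient manifold\<close>

definition affine_vec :: "real ^ ('n::finite option) \<Rightarrow> real ^ 'n" where
  "affine_vec v = (\<chi> i. v $ Some i / v $ None)"

text \<open>The quotient rule applied to \<open>affine_vec\<close> at \<open>z\<close> in the
  direction \<open>h\<close>.\<close>

definition affine_deriv :: "real ^ ('n::finite option) \<Rightarrow> real ^ ('n option) \<Rightarrow> real ^ 'n" where
  "affine_deriv z h = (\<chi> i. (h $ Some i * z $ None - z $ Some i * h $ None) / (z $ None)\<^sup>2)"

text \<open>A section of \<open>affine_vec\<close> with values in the hyperplane where coordinate
  \<open>None\<close> is 1; \<open>affine_direction\<close> is its linear part.\<close>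

definition affine_point :: "real ^ 'n::finite \<Rightarrow> real ^ ('n option)" where
  "affine_point x = (\<chi> j. case j of None \<Rightarrow> 1 | Some i \<Rightarrow> x $ i)"

definition affine_direction :: "real ^ 'n::finite \<Rightarrow> real ^ ('n option)" where
  "affine_direction x = (\<chi> j. case j of None \<Rightarrow> 0 | Some i \<Rightarrow> x $ i)"

lemma affine_coords_class: "v \<noteq> 0 \<Longrightarrow> affine_coords (proj_class v) = affine_vec v"
  using affine_coords.abs_eq[OF proj_rel_refl] by (simp add: affine_vec_def)

lemma proj_class_mem_affine_patch: "v \<noteq> 0 \<Longrightarrow> proj_class v \<in> affine_patch \<longleftrightarrow> v $ None \<noteq> 0"
proof
  assume v: "v \<noteq> 0" and "proj_class v \<in> affine_patch"
  then obtain w where w: "w $ None \<noteq> 0" "proj_class v = proj_class w" by (auto simp: affine_patch_def)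
  then have "w \<noteq> 0" by auto
  then obtain c where "c \<noteq> 0" "w = c *s v" using w(2) v proj_class_eq_iff by blast
  then show "v $ None \<noteq> 0" using w(1) by auto
qed (auto simp: affine_patch_def)

lemma open_affine_patch: "open (affine_patch :: (real, 'n::finite) projective_space set)"
proof -
  have "open ((\<lambda>v :: real ^ ('n option). v $ None) -` (- {0}))"
    by (auto intro!: open_vimage continuous_intros)
  then show ?thesis unfolding affine_patch_def by (intro open_proj_class_image) (simp_all add: vimage_def Compl_eq)
qed

lemma affine_vec_point: "affine_vec (affine_point x) = x"
  by (simp add: affine_vec_def affine_point_def vec_eq_iff)

lemma affine_point_vec: "z $ None \<noteq> 0 \<Longrightarrow> affine_point (affine_vec z) = inverse (z $ None) *\<^sub>R z"
  by (auto simp: affine_vec_def affine_point_def vec_eq_iff divide_inverse mult.commute split: option.split)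

lemma affine_point_None: "affine_point x $ None = 1" by (simp add: affine_point_def)

lemma affine_point_nonzero: "affine_point x \<noteq> 0"
  using affine_point_None[of x] by (metis zero_index zero_neq_one)

lemma linear_affine_direction: "linear affine_direction"
  by (rule linearI) (auto simp: affine_direction_def vec_eq_iff split: option.split)

lemma affine_point_eq: "affine_point x = affine_point 0 + affine_direction x"
  by (auto simp: affine_point_def affine_direction_def vec_eq_iff split: option.split)

lemma has_derivative_affine_point: "(affine_point has_derivative affine_direction) (at x)"
proof -
  have "((\<lambda>x. affine_point 0 + affine_direction x) has_derivative (\<lambda>x. 0 + affine_direction x)) (at x)"
    using linear_affine_direction
    by (intro has_derivative_add has_derivative_const linear_imp_has_derivative)
  then show ?thesis by (simp flip: affine_point_eq)
qed

lemma has_derivative_affine_vec: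
  fixes z :: "real ^ ('n::finite option)"
  assumes "z $ None \<noteq> 0"
  shows "(affine_vec has_derivative affine_deriv z) (at z)"
proof (subst has_derivative_componentwise_within, rule ballI)
  fix b :: "real ^ 'n" assume "b \<in> Basis"
  then obtain i where b: "b = axis i 1" by (auto simp: Basis_vec_def)
  have nth: "((\<lambda>v :: real ^ ('n option). v $ j) has_derivative (\<lambda>v. v $ j)) (at z)" for j
    by (intro bounded_linear_imp_has_derivative bounded_linear_vec_nth)
  have "((\<lambda>v. v $ Some i / v $ None) has_derivative
      (\<lambda>h. - (z $ Some i) * (inverse (z $ None) * h $ None * inverse (z $ None)) + h $ Some i / z $ None)) (at z)"
    by (rule has_derivative_divide[OF nth nth assms])
  moreover have "(\<lambda>h. - (z $ Some i) * (inverse (z $ None) * h $ None * inverse (z $ None)) + h $ Some i / z $ None)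
      = (\<lambda>h. affine_deriv z h \<bullet> b)"
    using assms by (auto simp: affine_deriv_def b inner_axis field_simps power2_eq_square)
  ultimately show "((\<lambda>v. affine_vec v \<bullet> b) has_derivative (\<lambda>h. affine_deriv z h \<bullet> b)) (at z)"
    by (simp add: affine_vec_def b inner_axis)
qed

text \<open>The kernel of the derivative is the radial line through \<open>z\<close>; coordinate
  \<open>None\<close> determines the factor \<open>d\<close>.\<close>

lemma affine_deriv_eq_iff:
  assumes "z $ None \<noteq> 0"
  shows "affine_deriv z h = affine_deriv z h' \<longleftrightarrow> (\<exists>d. h' = h + d *\<^sub>R z)"
proof
  assume eq: "affine_deriv z h = affine_deriv z h'"
  define d where "d = (h' $ None - h $ None) / z $ None"
  have "h' $ j = h $ j + d * z $ j" for j
  proof (cases j)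
    case (Some i)
    have "(h $ Some i * z $ None - z $ Some i * h $ None) / (z $ None)\<^sup>2
        = (h' $ Some i * z $ None - z $ Some i * h' $ None) / (z $ None)\<^sup>2"
      using arg_cong[OF eq, of "\<lambda>v. v $ i"] by (simp add: affine_deriv_def)
    then have "h $ Some i * z $ None - z $ Some i * h $ None = h' $ Some i * z $ None - z $ Some i * h' $ None"
      using assms by simp
    then show ?thesis unfolding Some d_def using assms by (simp add: field_simps)
  qed (use assms in \<open>simp add: d_def\<close>)
  then show "\<exists>d. h' = h + d *\<^sub>R z" by (auto simp: vec_eq_iff)
qed (auto simp: affine_deriv_def vec_eq_iff algebra_simps)

lemma continuous_on_affine_deriv:
  assumes "continuous_on S f" "continuous_on S g" "\<And>x. x \<in> S \<Longrightarrow> f x $ None \<noteq> 0"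
  shows "continuous_on S (\<lambda>x. affine_deriv (f x) (g x))"
  unfolding affine_deriv_def using assms by (intro continuous_on_vec_lambda continuous_intros) auto

lemma continuous_on_affine_vec:
  assumes "continuous_on S f" "\<And>x. x \<in> S \<Longrightarrow> f x $ None \<noteq> 0"
  shows "continuous_on S (\<lambda>x. affine_vec (f x))"
  unfolding affine_vec_def using assms by (intro continuous_on_vec_lambda continuous_intros) auto

lemma exists_affine_transformation:
  fixes v :: "real ^ ('n::finite option)"
  assumes "v \<noteq> 0"
  obtains A :: "real ^ ('n option) ^ ('n option)" where "invertible A" "(A *v v) $ None \<noteq> 0"
proof -
  obtain j where j: "v $ j \<noteq> 0" using assms by (auto simp: vec_eq_iff)
  \<comment> \<open>Exchanging the coordinates \<open>None\<close> and \<open>j\<close> is an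
    involution, so its matrix is its own inverse.\<close>
  define f where "f w = (\<chi> i. w $ Transposition.transpose None j i)" for w :: "real ^ ('n option)"
  have f: "linear f" by (rule linearI) (simp_all add: f_def vec_eq_iff)
  have ff: "f \<circ> f = id" by (auto simp: f_def vec_eq_iff)
  have "matrix f ** matrix f = mat 1" using matrix_compose[OF f f] by (simp add: ff matrix_id_mat_1 id_def[symmetric])
  then have "invertible (matrix f)" unfolding invertible_def by blast
  moreover have "(matrix f *v v) $ None = v $ j" by (simp add: matrix_works f f_def)
  ultimately show thesis using that[of "matrix f"] j by simp
qed

lemma open_pgl_act_vimage:
  fixes a :: "(real, 'n::finite) pgl"
  assumes "open X"
  shows "open (pgl_act a -` X)"
proof -
  obtain A where A: "invertible A" "a = pgl_class A" using pgl_class_cases by blast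
  have "cone_over (pgl_act a -` X) = (*v) A -` cone_over X"
  proof (intro equalityI subsetI)
    fix v assume "v \<in> (*v) A -` cone_over X"
    then have "A *v v \<noteq> 0" "proj_class (A *v v) \<in> X" by (auto simp: cone_over_def)
    moreover from this have "v \<noteq> 0" by auto
    ultimately show "v \<in> cone_over (pgl_act a -` X)" by (simp add: cone_over_def A pgl_act_class)
  qed (use A(1) in \<open>auto simp: cone_over_def A(2) pgl_act_class matrix_vector_mult_nonzero\<close>)
  moreover have "open ((*v) A -` cone_over X)"
    using assms open_cone_over[of X]
    by (intro open_vimage) (auto intro!: linear_continuous_on)
  ultimately show ?thesis using open_cone_over by metis
qed

lemma open_pgl_act_image:
  fixes a :: "(real, 'n::finite) pgl"
  assumes "open X"
  shows "open (pgl_act a ` X)"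
proof -
  have "pgl_act a ` X = pgl_act (inv\<^bsub>PGL\<^esub> a) -` X"
    by (auto simp: pgl_act_inv) (metis image_eqI pgl_act_inv(2))
  then show ?thesis using open_pgl_act_vimage[OF assms] by simp
qed

text \<open>A quadratic form positive on one line and negative on the other separates the two points
  by \<open>proj_sign_sets\<close>.\<close>

lemma proj_separation:
  fixes x y :: "(real, 'n::finite) projective_space"
  assumes "x \<noteq> y"
  obtains S T where "open S" "open T" "x \<in> S" "y \<in> T" "S \<inter> T = {}"
proof -
  obtain a where a: "a \<noteq> 0" "x = proj_class a" using proj_class_cases by blast
  obtain b where b: "b \<noteq> 0" "y = proj_class b" using proj_class_cases by blast
  define b' where "b' = b - (b \<bullet> a / (a \<bullet> a)) *\<^sub>R a"
  have aa: "a \<bullet> a \<noteq> 0" using a by simp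
  have b'a: "a \<bullet> b' = 0" using aa by (simp add: b'_def inner_diff_right inner_commute)
  have "b' \<noteq> 0"
  proof
    assume "b' = 0"
    then have "b = (b \<bullet> a / (a \<bullet> a)) *s a" by (simp add: b'_def scalar_mult_eq_scaleR)
    then show False using a b assms proj_class_scale by (metis vector_smult_lzero)
  qed
  moreover have "b \<bullet> b' = b' \<bullet> b'"
  proof -
    have "b = b' + (b \<bullet> a / (a \<bullet> a)) *\<^sub>R a" by (simp add: b'_def)
    then have "b \<bullet> b' = (b' + (b \<bullet> a / (a \<bullet> a)) *\<^sub>R a) \<bullet> b'" by simp
    then show ?thesis using b'a by (simp add: inner_add_left)
  qed
  ultimately have bb': "b \<bullet> b' \<noteq> 0" by simp
  \<comment> \<open>With \<open>b'\<close> the part of \<open>b\<close> orthogonal to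
    \<open>a\<close>, this constant makes \<open>F b\<close> equal to -1, while \<open>F a\<close>
    is the square of \<open>a \<bullet> a\<close>.\<close>
  define c where "c = ((b \<bullet> a)\<^sup>2 + 1) / (b \<bullet> b')\<^sup>2"
  define F where "F v = (v \<bullet> a)\<^sup>2 - c * (v \<bullet> b')\<^sup>2" for v
  have cont: "continuous_on UNIV F" unfolding F_def by (intro continuous_intros)
  have scale: "F (k *\<^sub>R w) = k\<^sup>2 * F w" for k w by (simp add: F_def power_mult_distrib algebra_simps)
  have "F a > 0" using aa b'a by (simp add: F_def)
  moreover have "c * (b \<bullet> b')\<^sup>2 = (b \<bullet> a)\<^sup>2 + 1" using bb' by (simp add: c_def)
  then have "F b < 0" by (simp add: F_def)
  ultimately have "x \<in> proj_class ` (F -` {0<..})" "y \<in> proj_class ` (F -` {..<0})"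
    unfolding a(2) b(2) by (auto intro!: imageI)
  then show thesis
    by (rule that[OF proj_sign_sets(1,2)[OF cont scale] _ _ proj_sign_sets(3)[OF cont scale]])
qed

section \<open>The covering map and its charts in linear coordinates\<close>

locale projective_manifold =
  fixes \<Omega> :: "(real, 'n::finite) projective_space set" and \<Gamma> :: "(real, 'n) pgl set"
  assumes manifold: "convex_projective_manifold \<Omega> \<Gamma>"
begin

abbreviation "q \<equiv> orbit_of pgl_act \<Gamma>"

lemma open_domain: "open \<Omega>" and subgroup: "subgroup \<Gamma> PGL"
  and convex_domain: "projectively_convex \<Omega>"
  and image_domain: "\<And>\<gamma>. \<gamma> \<in> \<Gamma> \<Longrightarrow> pgl_act \<gamma> ` \<Omega> = \<Omega>"
  and free: "\<And>\<gamma> x. \<gamma> \<in> \<Gamma> \<Longrightarrow> x \<in> \<Omega> \<Longrightarrow> pgl_act \<gamma> x = x \<Longrightarrow> \<gamma> = pgl_one"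
  and proper: "\<And>K. compact K \<Longrightarrow> K \<subseteq> \<Omega> \<Longrightarrow> finite {\<gamma> \<in> \<Gamma>. pgl_act \<gamma> ` K \<inter> K \<noteq> {}}"
proof -
  note m = manifold[unfolded convex_projective_manifold_def PGL_simps]
  show "open \<Omega>" "subgroup \<Gamma> PGL" "projectively_convex \<Omega>" using m by (simp_all add: properly_convex_def)
  show "pgl_act \<gamma> ` \<Omega> = \<Omega>" if "\<gamma> \<in> \<Gamma>" for \<gamma> using m that by simp
  show "\<gamma> = pgl_one" if "\<gamma> \<in> \<Gamma>" "x \<in> \<Omega>" "pgl_act \<gamma> x = x" for \<gamma> x using m that by meson
  show "finite {\<gamma> \<in> \<Gamma>. pgl_act \<gamma> ` K \<inter> K \<noteq> {}}" if "compact K" "K \<subseteq> \<Omega>" for K using m that by simp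
qed

lemma act_mem_iff: "\<gamma> \<in> \<Gamma> \<Longrightarrow> pgl_act \<gamma> x \<in> \<Omega> \<longleftrightarrow> x \<in> \<Omega>"
  using image_domain[of \<gamma>] inj_image_mem_iff[OF inj_pgl_act] by metis

lemma q_eq_iff: "q x = q y \<longleftrightarrow> (\<exists>\<gamma>\<in>\<Gamma>. y = pgl_act \<gamma> x)"
  by (rule orbit_of_eq_iff[OF subgroup pgl_act_mult pgl_act_one])

lemma q_act: "\<gamma> \<in> \<Gamma> \<Longrightarrow> q (pgl_act \<gamma> x) = q x"
  using q_eq_iff by metis

lemma topspace_manifold [simp]: "topspace (manifold_top \<Omega> \<Gamma>) = q ` \<Omega>"
  by (simp add: manifold_top_def)

lemma continuous_map_q: "continuous_map (top_of_set \<Omega>) (manifold_top \<Omega> \<Gamma>) q"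
  unfolding manifold_top_def by (intro quotient_imp_continuous_map quotient_map_quotient_topology)

text \<open>The saturation of \<open>W\<close> is the union of its translates under
  \<open>\<Gamma>\<close>.\<close>

lemma openin_q_image:
  assumes "open W" "W \<subseteq> \<Omega>"
  shows "openin (manifold_top \<Omega> \<Gamma>) (q ` W)"
proof -
  have "{x \<in> \<Omega>. q x \<in> q ` W} = (\<Union>\<gamma>\<in>\<Gamma>. pgl_act \<gamma> ` W)"
  proof (intro equalityI subsetI)
    fix x assume "x \<in> {x \<in> \<Omega>. q x \<in> q ` W}"
    then obtain w where "w \<in> W" "q w = q x" by auto
    then show "x \<in> (\<Union>\<gamma>\<in>\<Gamma>. pgl_act \<gamma> ` W)" using q_eq_iff by blast
  next
    fix x assume "x \<in> (\<Union>\<gamma>\<in>\<Gamma>. pgl_act \<gamma> ` W)"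
    then obtain \<gamma> w where "\<gamma> \<in> \<Gamma>" "w \<in> W" "x = pgl_act \<gamma> w" by blast
    then show "x \<in> {x \<in> \<Omega>. q x \<in> q ` W}" using assms(2) act_mem_iff q_act by auto
  qed
  moreover have "open (\<Union>\<gamma>\<in>\<Gamma>. pgl_act \<gamma> ` W)" using open_pgl_act_image[OF assms(1)] by blast
  ultimately show ?thesis
    using assms open_domain unfolding manifold_top_def openin_quotient_topology
    by (auto simp: openin_open_eq)
qed

lemma mem_cone_over_act:
  assumes "invertible A" "pgl_class A \<in> \<Gamma>"
  shows "A *v u \<in> cone_over \<Omega> \<longleftrightarrow> u \<in> cone_over \<Omega>"
  by (rule mem_cone_over_image[OF assms(1) image_domain[OF assms(2)]])

text \<open>Proper discontinuity on a compact neighbourhood leaves finitely many nontrivial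
  elements; freeness and the Hausdorff property give each a neighbourhood of \<open>x\<close> that
  it moves off itself.\<close>

lemma exists_injective_neighbourhood:
  assumes "x \<in> \<Omega>"
  obtains V where "open V" "x \<in> V" "V \<subseteq> \<Omega>" "inj_on q V"
proof -
  obtain u where u: "u \<noteq> 0" "x = proj_class u" using proj_class_cases by blast
  have "u \<in> cone_over \<Omega>" using u assms by (simp add: cone_over_def)
  then obtain e where e: "e > 0" "cball u e \<subseteq> cone_over \<Omega>"
    using open_domain open_contains_cball open_cone_over by metis
  define K where "K = proj_class ` cball u e"
  have "0 \<notin> cone_over \<Omega>" by (simp add: cone_over_def)
  then have "0 \<notin> cball u e" using e(2) by blast
  then have "compact K" unfolding K_def
    by (intro compact_continuous_image continuous_on_subset[OF continuous_on_proj_class]) auto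
  moreover have "K \<subseteq> \<Omega>" unfolding K_def using e(2) by (auto simp: cone_over_def)
  ultimately have fin: "finite {\<gamma> \<in> \<Gamma>. pgl_act \<gamma> ` K \<inter> K \<noteq> {}}" using proper by blast
  define F where "F = {\<gamma> \<in> \<Gamma>. pgl_act \<gamma> ` K \<inter> K \<noteq> {}} - {pgl_one}"
  have "\<exists>W. open W \<and> x \<in> W \<and> pgl_act \<gamma> ` W \<inter> W = {}" if "\<gamma> \<in> F" for \<gamma>
  proof -
    have "x \<noteq> pgl_act \<gamma> x" using that free[of \<gamma> x] assms by (auto simp: F_def)
    then obtain S T where "open S" "open T" "x \<in> S" "pgl_act \<gamma> x \<in> T" "S \<inter> T = {}"
      using proj_separation by metis
    then show ?thesis
      by (intro exI[of _ "S \<inter> pgl_act \<gamma> -` T"]) (auto intro!: open_Int open_pgl_act_vimage)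
  qed
  then obtain W where W: "\<And>\<gamma>. \<gamma> \<in> F \<Longrightarrow> open (W \<gamma>) \<and> x \<in> W \<gamma> \<and> pgl_act \<gamma> ` W \<gamma> \<inter> W \<gamma> = {}" by metis
  define V where "V = proj_class ` ball u e \<inter> (\<Inter>\<gamma>\<in>F. W \<gamma>)"
  have "0 \<notin> ball u e" using \<open>0 \<notin> cball u e\<close> by auto
  then have "open V" unfolding V_def using W fin
    by (intro open_Int open_proj_class_image open_INT) (auto simp: F_def)
  moreover have "x \<in> V" using W u e by (auto simp: V_def)
  moreover have VK: "V \<subseteq> K" unfolding V_def K_def by (auto intro!: imageI)
  moreover have "inj_on q V"
  proof (rule inj_onI)
    fix y z assume yz: "y \<in> V" "z \<in> V" "q y = q z"
    then obtain \<gamma> where \<gamma>: "\<gamma> \<in> \<Gamma>" "z = pgl_act \<gamma> y" using q_eq_iff by blast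
    have "\<gamma> \<notin> F"
    proof
      assume "\<gamma> \<in> F"
      then have "pgl_act \<gamma> y \<in> pgl_act \<gamma> ` W \<gamma> \<inter> W \<gamma>" using yz \<gamma> by (auto simp: V_def)
      then show False using W[OF \<open>\<gamma> \<in> F\<close>] by blast
    qed
    moreover have "z \<in> pgl_act \<gamma> ` K \<inter> K" using yz \<gamma>(2) VK by auto
    ultimately have "\<gamma> = pgl_one" using \<gamma>(1) by (auto simp: F_def)
    then show "y = z" using \<gamma>(2) by (simp add: pgl_act_one)
  qed
  ultimately show thesis using that[of V] \<open>K \<subseteq> \<Omega>\<close> by (meson order_trans)
qed

lemma exists_chart:
  assumes "x \<in> \<Omega>"
  obtains U \<phi> where "(U, \<phi>) \<in> manifold_atlas \<Omega> \<Gamma>" "q x \<in> U"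
proof -
  obtain u where u: "u \<noteq> 0" "x = proj_class u" using proj_class_cases by blast
  obtain A :: "real ^ ('n option) ^ ('n option)" where A: "invertible A" "(A *v u) $ None \<noteq> 0"
    by (rule exists_affine_transformation[OF u(1)])
  obtain V where V: "open V" "x \<in> V" "V \<subseteq> \<Omega>" "inj_on q V" using exists_injective_neighbourhood[OF assms] by blast
  let ?g = "pgl_class A"
  define V' where "V' = V \<inter> pgl_act ?g -` affine_patch"
  have "open V'" unfolding V'_def by (intro open_Int V open_pgl_act_vimage open_affine_patch)
  moreover have "x \<in> V'" using V(2) A u
    by (simp add: V'_def pgl_act_class proj_class_mem_affine_patch matrix_vector_mult_nonzero)
  moreover have "V' \<subseteq> \<Omega>" "inj_on q V'" "pgl_act ?g ` V' \<subseteq> affine_patch"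
    using V inj_on_subset[OF V(4)] by (auto simp: V'_def)
  ultimately show thesis
    using that[of "q ` V'" "affine_coords \<circ> pgl_act ?g \<circ> inv_into V' q"]
    unfolding manifold_atlas_def by blast
qed

lemma atlas_subset: "(U, \<phi>) \<in> manifold_atlas \<Omega> \<Gamma> \<Longrightarrow> U \<subseteq> q ` \<Omega>"
  unfolding manifold_atlas_def by blast

text \<open>The class of \<open>u\<close> need not lie in the sheet \<open>V\<close> that defines
  the chart. An element of \<open>\<Gamma>\<close> moves it there, and its matrix is absorbed into
  \<open>A\<close>.\<close>

lemma chart_local_form:
  assumes c: "(U, \<phi>) \<in> manifold_atlas \<Omega> \<Gamma>" and u: "u \<in> cone_over \<Omega>" "q (proj_class u) \<in> U"
  obtains A W where "invertible A" "open W" "u \<in> W" "W \<subseteq> cone_over \<Omega>"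
    "\<And>v. v \<in> W \<Longrightarrow> q (proj_class v) \<in> U" "\<And>v. v \<in> W \<Longrightarrow> (A *v v) $ None \<noteq> 0"
    "\<And>v. v \<in> W \<Longrightarrow> \<phi> (q (proj_class v)) = affine_vec (A *v v)"
proof -
  obtain V g where V: "U = q ` V" "\<phi> = affine_coords \<circ> pgl_act g \<circ> inv_into V q"
    "open V" "V \<subseteq> \<Omega>" "inj_on q V" "pgl_act g ` V \<subseteq> affine_patch"
    using c unfolding manifold_atlas_def by blast
  obtain A where A: "invertible A" "g = pgl_class A" using pgl_class_cases by blast
  obtain x where "x \<in> V" "q (proj_class u) = q x" using u(2) V(1) by blast
  then obtain \<gamma> where \<gamma>: "\<gamma> \<in> \<Gamma>" "pgl_act \<gamma> (proj_class u) \<in> V"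
    using q_eq_iff[of "proj_class u" x] by auto
  obtain B where B: "invertible B" "\<gamma> = pgl_class B" using pgl_class_cases by blast
  define W where "W = cone_over (pgl_act \<gamma> -` V)"
  have inv: "invertible (A ** B)" using A B invertible_mult by blast
  have "open W" unfolding W_def using open_cone_over open_pgl_act_vimage[OF V(3)] by blast
  moreover have "u \<in> W" using u(1) \<gamma>(2) by (simp add: W_def cone_over_def)
  moreover have "W \<subseteq> cone_over \<Omega>"
    using V(4) act_mem_iff[OF \<gamma>(1)] unfolding W_def cone_over_def by blast
  moreover have "q (proj_class v) \<in> U" "(A ** B *v v) $ None \<noteq> 0"
    "\<phi> (q (proj_class v)) = affine_vec (A ** B *v v)" if "v \<in> W" for v
  proof -
    have v: "v \<noteq> 0" "pgl_act \<gamma> (proj_class v) \<in> V" using that by (auto simp: W_def cone_over_def)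
    have q: "q (proj_class v) = q (pgl_act \<gamma> (proj_class v))" using q_act[OF \<gamma>(1)] by simp
    then show "q (proj_class v) \<in> U" using v(2) V(1) by simp
    have nz: "A ** B *v v \<noteq> 0" using inv v(1) matrix_vector_mult_nonzero by blast
    have act: "pgl_act g (pgl_act \<gamma> (proj_class v)) = proj_class (A ** B *v v)"
      using A B v(1) by (simp add: pgl_act_class matrix_vector_mult_nonzero matrix_vector_mul_assoc)
    then have "proj_class (A ** B *v v) \<in> affine_patch" using V(6) v(2) by (metis image_subset_iff)
    then show "(A ** B *v v) $ None \<noteq> 0" using proj_class_mem_affine_patch[OF nz] by blast
    have "inv_into V q (q (proj_class v)) = pgl_act \<gamma> (proj_class v)"
      unfolding q using inv_into_f_f[OF V(5) v(2)] .
    then show "\<phi> (q (proj_class v)) = affine_vec (A ** B *v v)"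
      unfolding V(2) using act affine_coords_class[OF nz] by simp
  qed
  ultimately show thesis using that[OF inv] by blast
qed

text \<open>If \<open>A\<close> represents the projective coordinates of the chart, the vector
  \<open>affine_point x\<close> pulled back by the inverse of \<open>A\<close> lies over the chart
  point with coordinates \<open>x\<close>. The inverse chart thus has an affine lift to the
  cone.\<close>

lemma chart_inverse_form:
  assumes c: "(U, \<phi>) \<in> manifold_atlas \<Omega> \<Gamma>"
  shows "\<exists>N. open (\<phi> ` U) \<and>
    (\<forall>x\<in>\<phi> ` U. N *v affine_point x \<in> cone_over \<Omega> \<and> inv_into U \<phi> x = q (proj_class (N *v affine_point x))) \<and>
    inj_on \<phi> U \<and> continuous_map (subtopology (manifold_top \<Omega> \<Gamma>) U) euclidean \<phi>"
proof -
  obtain V g where V: "U = q ` V" "\<phi> = affine_coords \<circ> pgl_act g \<circ> inv_into V q"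
    "open V" "V \<subseteq> \<Omega>" "inj_on q V" "pgl_act g ` V \<subseteq> affine_patch"
    using c unfolding manifold_atlas_def by blast
  obtain A where A: "invertible A" "g = pgl_class A" using pgl_class_cases by blast
  then obtain N where N: "A ** N = mat 1" "N ** A = mat 1" unfolding invertible_def by blast
  then have "invertible N" unfolding invertible_def by blast
  define s where "s x = N *v affine_point x" for x
  have s0: "s x \<noteq> 0" for x
    unfolding s_def using \<open>invertible N\<close> affine_point_nonzero matrix_vector_mult_nonzero by blast
  have As: "A *v s x = affine_point x" for x by (simp add: s_def matrix_vector_mul_assoc N)
  have \<phi>q: "\<phi> (q v) = affine_coords (pgl_act g v)" if "v \<in> V" for v
    unfolding V(2) using inv_into_f_f[OF V(5) that] by simp
  have \<phi>s: "affine_coords (pgl_act g (proj_class (s x))) = x" for x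
    using A s0 As by (simp add: pgl_act_class affine_coords_class affine_point_nonzero affine_vec_point)
  have coords: "(A *v u) $ None \<noteq> 0" "affine_coords (pgl_act g (proj_class u)) = affine_vec (A *v u)"
    if "u \<in> cone_over V" for u
  proof -
    have u: "u \<noteq> 0" "proj_class u \<in> V" using that by (auto simp: cone_over_def)
    have nz: "A *v u \<noteq> 0" using A u matrix_vector_mult_nonzero by blast
    have "proj_class (A *v u) \<in> affine_patch" using V(6) u A pgl_act_class by (metis image_subset_iff)
    then show "(A *v u) $ None \<noteq> 0" using proj_class_mem_affine_patch[OF nz] by blast
    show "affine_coords (pgl_act g (proj_class u)) = affine_vec (A *v u)"
      using A u by (simp add: pgl_act_class affine_coords_class nz)
  qed
  have sv: "proj_class (s (affine_coords (pgl_act g v))) = v" if v: "v \<in> V" for v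
  proof -
    obtain u where u: "u \<noteq> 0" "v = proj_class u" using proj_class_cases by blast
    have cu: "u \<in> cone_over V" using u v by (simp add: cone_over_def)
    have "s (affine_coords (pgl_act g v)) = inverse ((A *v u) $ None) *s (N *v (A *v u))"
      unfolding u(2) coords(2)[OF cu] s_def affine_point_vec[OF coords(1)[OF cu]]
      by (simp add: scalar_mult_eq_scaleR matrix_vector_mult_scaleR)
    also have "N *v (A *v u) = u" by (simp add: matrix_vector_mul_assoc N)
    finally show ?thesis using u(2) coords(1)[OF cu] by (simp add: proj_class_scale)
  qed
  have image: "\<phi> ` U = {x. proj_class (s x) \<in> V}"
  proof (intro equalityI subsetI)
    fix x assume "x \<in> \<phi> ` U"
    then show "x \<in> {x. proj_class (s x) \<in> V}" using V(1) \<phi>q sv by auto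
  next
    fix x assume "x \<in> {x. proj_class (s x) \<in> V}"
    then show "x \<in> \<phi> ` U" using V(1) \<phi>q[of "proj_class (s x)"] \<phi>s by (force simp: image_iff)
  qed
  have cont_s: "continuous_on UNIV s"
  proof -
    have "s = (\<lambda>x. N *v affine_point 0 + (N *v affine_direction x))"
      unfolding s_def by (rule ext, subst affine_point_eq) (rule matrix_vector_right_distrib)
    moreover have "bounded_linear (\<lambda>x. N *v affine_direction x)"
      using linear_compose[OF linear_affine_direction matrix_vector_mul_linear[of N]]
      by (simp add: linear_conv_bounded_linear o_def)
    ultimately show ?thesis by (simp add: continuous_on_add linear_continuous_on)
  qed
  have "open (\<phi> ` U)"
  proof -
    have "\<phi> ` U = s -` cone_over V" unfolding image using s0 by (auto simp: cone_over_def)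
    then show ?thesis using cont_s V(3) open_cone_over[of V] by (simp add: open_vimage)
  qed
  moreover have inj: "inj_on \<phi> U"
    unfolding V(1) by (rule inj_onI) (metis (mono_tags, opaque_lifting) \<phi>q imageE sv)
  moreover have "s x \<in> cone_over \<Omega> \<and> inv_into U \<phi> x = q (proj_class (s x))" if "x \<in> \<phi> ` U" for x
  proof -
    have mem: "proj_class (s x) \<in> V" using that image by blast
    then have "\<phi> (q (proj_class (s x))) = x" using \<phi>q \<phi>s by simp
    then have "inv_into U \<phi> x = q (proj_class (s x))"
      using inj mem V(1) by (intro inv_into_f_eq) auto
    then show ?thesis using mem V(4) s0 by (auto simp: cone_over_def)
  qed
  moreover have "continuous_map (subtopology (manifold_top \<Omega> \<Gamma>) U) euclidean \<phi>"
    unfolding continuous_map_def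
  proof (intro conjI allI impI)
    fix T :: "(real ^ 'n) set" assume "openin euclidean T"
    then have T: "open T" by simp
    define V' where "V' = {v \<in> V. affine_coords (pgl_act g v) \<in> T}"
    have "cone_over V' = cone_over V \<inter> (\<lambda>u. affine_vec (A *v u)) -` T"
      using coords(2) by (auto simp: V'_def cone_over_def)
    moreover have "open (cone_over V \<inter> (\<lambda>u. affine_vec (A *v u)) -` T)"
    proof (rule continuous_open_preimage[OF _ _ T])
      show "open (cone_over V)" using V(3) open_cone_over by blast
      show "continuous_on (cone_over V) (\<lambda>u. affine_vec (A *v u))"
        by (intro continuous_on_affine_vec coords(1) linear_continuous_on matrix_vector_mul_bounded_linear)
    qed
    ultimately have "open V'" using open_cone_over by metis
    then have "openin (manifold_top \<Omega> \<Gamma>) (q ` V')" using V(4) by (intro openin_q_image) (auto simp: V'_def)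
    moreover have "{p \<in> topspace (subtopology (manifold_top \<Omega> \<Gamma>) U). \<phi> p \<in> T} = q ` V'"
      using V(4) \<phi>q by (auto simp: V(1) V'_def)
    moreover have "q ` V' \<subseteq> U" by (auto simp: V'_def V(1))
    ultimately show "openin (subtopology (manifold_top \<Omega> \<Gamma>) U) {p \<in> topspace (subtopology (manifold_top \<Omega> \<Gamma>) U). \<phi> p \<in> T}"
      unfolding openin_subtopology by (intro exI[of _ "q ` V'"]) auto
  qed auto
  ultimately show ?thesis unfolding s_def by blast
qed

end

section \<open>The tangent bundle and the homeomorphism\<close>

text \<open>A chart of the quotient pulled back to the cone over \<open>\<Omega>\<close>, so that
  derivatives can be taken in a vector space.\<close>

definition lift_coords ::
  "(real, 'n::finite) pgl set \<Rightarrow> ((real, 'n) projective_space set \<Rightarrow> real ^ 'n)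
     \<Rightarrow> real ^ ('n option) \<Rightarrow> real ^ 'n" where
  "lift_coords \<Gamma> \<phi> v = \<phi> (orbit_of pgl_act \<Gamma> (proj_class v))"

text \<open>The image of the tangent vector \<open>w\<close> at \<open>u\<close> under the differential of the composite projection
  \<open>\<real>\<^sup>n\<^sup>+\<^sup>1 \<supset> \<pi>\<^sup>-\<^sup>1(\<Omega>) \<rightarrow> \<Omega> \<rightarrow> M\<close>.\<close>
definition tangent_class ::
  "(real, 'n::finite) projective_space set \<Rightarrow> (real, 'n) pgl set
     \<Rightarrow> real ^ ('n option) \<Rightarrow> real ^ ('n option)
     \<Rightarrow> ((real, 'n) projective_space set, real ^ 'n) tangent_rep set" where
  "tangent_class \<Omega> \<Gamma> u w =
     {((U, \<phi>), p, y) | U \<phi> p y. (U, \<phi>) \<in> manifold_atlas \<Omega> \<Gamma> \<and> p \<in> U \<and>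
        p = orbit_of pgl_act \<Gamma> (proj_class u) \<and> y = frechet_derivative (lift_coords \<Gamma> \<phi>) (at u) w}"

lemma mem_tangent_class:
  "((U, \<phi>), p, y) \<in> tangent_class \<Omega> \<Gamma> u w \<longleftrightarrow>
     (U, \<phi>) \<in> manifold_atlas \<Omega> \<Gamma> \<and> p \<in> U \<and>
     p = orbit_of pgl_act \<Gamma> (proj_class u) \<and> y = frechet_derivative (lift_coords \<Gamma> \<phi>) (at u) w"
  by (auto simp: tangent_class_def)

text \<open>A fixed choice of the matrix from \<open>chart_inverse_form\<close> for each chart,
  needed to define a lift on the disjoint union of all charts.\<close>

definition chart_matrix ::
  "(real, 'n::finite) projective_space set \<Rightarrow> (real, 'n) pgl set
     \<Rightarrow> ((real, 'n) projective_space set, real ^ 'n) chart \<Rightarrow> real ^ ('n option) ^ ('n option)" where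
  "chart_matrix \<Omega> \<Gamma> c = (SOME N. \<forall>x\<in>snd c ` fst c. N *v affine_point x \<in> cone_over \<Omega> \<and>
     inv_into (fst c) (snd c) x = orbit_of pgl_act \<Gamma> (proj_class (N *v affine_point x)))"

context projective_manifold
begin

lemma tangent_class_cases:
  assumes "t \<in> tangent_class \<Omega> \<Gamma> u w"
  obtains U \<phi> where "t = ((U, \<phi>), q (proj_class u), frechet_derivative (lift_coords \<Gamma> \<phi>) (at u) w)"
    "(U, \<phi>) \<in> manifold_atlas \<Omega> \<Gamma>" "q (proj_class u) \<in> U"
  using assms unfolding tangent_class_def by blast

lemma tangent_class_cong:
  assumes "q (proj_class u) = q (proj_class u')"
    and "\<And>U \<phi>. (U, \<phi>) \<in> manifold_atlas \<Omega> \<Gamma> \<Longrightarrow> q (proj_class u) \<in> U \<Longrightarrow>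
      frechet_derivative (lift_coords \<Gamma> \<phi>) (at u) w = frechet_derivative (lift_coords \<Gamma> \<phi>) (at u') w'"
  shows "tangent_class \<Omega> \<Gamma> u w = tangent_class \<Omega> \<Gamma> u' w'"
proof -
  have "((U, \<phi>), p, y) \<in> tangent_class \<Omega> \<Gamma> u w \<longleftrightarrow> ((U, \<phi>), p, y) \<in> tangent_class \<Omega> \<Gamma> u' w'" for U \<phi> p y
    unfolding mem_tangent_class using assms by metis
  then show ?thesis by (intro equalityI subrelI) (metis surj_pair)+
qed

lemma tangent_class_nonempty: "u \<in> cone_over \<Omega> \<Longrightarrow> tangent_class \<Omega> \<Gamma> u w \<noteq> {}"
proof -
  assume "u \<in> cone_over \<Omega>"
  then obtain U \<phi> where "(U, \<phi>) \<in> manifold_atlas \<Omega> \<Gamma>" "q (proj_class u) \<in> U"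
    using exists_chart[of "proj_class u"] by (auto simp: cone_over_def)
  then show "tangent_class \<Omega> \<Gamma> u w \<noteq> {}" using mem_tangent_class by blast
qed

lemma lift_coords_derivative:
  assumes c: "(U, \<phi>) \<in> manifold_atlas \<Omega> \<Gamma>" and u: "u \<in> cone_over \<Omega>" "q (proj_class u) \<in> U"
  obtains A W where "invertible A" "open W" "u \<in> W" "W \<subseteq> cone_over \<Omega>"
    "\<And>v. v \<in> W \<Longrightarrow> q (proj_class v) \<in> U" "\<And>v. v \<in> W \<Longrightarrow> (A *v v) $ None \<noteq> 0"
    "\<And>v. v \<in> W \<Longrightarrow> (lift_coords \<Gamma> \<phi> has_derivative (\<lambda>h. affine_deriv (A *v v) (A *v h))) (at v)"
proof -
  obtain A W where W: "invertible A" "open W" "u \<in> W" "W \<subseteq> cone_over \<Omega>"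
    "\<And>v. v \<in> W \<Longrightarrow> q (proj_class v) \<in> U" "\<And>v. v \<in> W \<Longrightarrow> (A *v v) $ None \<noteq> 0"
    "\<And>v. v \<in> W \<Longrightarrow> \<phi> (q (proj_class v)) = affine_vec (A *v v)"
    using chart_local_form[OF c u] by metis
  have "(lift_coords \<Gamma> \<phi> has_derivative (\<lambda>h. affine_deriv (A *v v) (A *v h))) (at v)" if "v \<in> W" for v
  proof (rule has_derivative_transform_within_open[OF _ W(2) that])
    have "((*v) A has_derivative (*v) A) (at v)"
      by (intro bounded_linear_imp_has_derivative matrix_vector_mul_bounded_linear)
    from has_derivative_compose[OF this has_derivative_affine_vec[OF W(6)[OF that]]]
    show "((\<lambda>v. affine_vec (A *v v)) has_derivative (\<lambda>h. affine_deriv (A *v v) (A *v h))) (at v)" .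
    show "\<And>v. v \<in> W \<Longrightarrow> affine_vec (A *v v) = lift_coords \<Gamma> \<phi> v" by (simp add: W(7) lift_coords_def)
  qed
  then show thesis using that W(1-6) by blast
qed

lemma lift_coords_differentiable:
  assumes "(U, \<phi>) \<in> manifold_atlas \<Omega> \<Gamma>" "u \<in> cone_over \<Omega>" "q (proj_class u) \<in> U"
  shows "(lift_coords \<Gamma> \<phi> has_derivative frechet_derivative (lift_coords \<Gamma> \<phi>) (at u)) (at u)"
  using lift_coords_derivative[OF assms] frechet_derivative_works differentiable_def by metis

text \<open>In the coordinates given by \<open>A\<close> this is \<open>affine_deriv_eq_iff\<close>:
  the differential of the projection from the cone kills exactly the radial direction.\<close>

lemma frechet_derivative_lift_coords_eq_iff:
  assumes "(U, \<phi>) \<in> manifold_atlas \<Omega> \<Gamma>" "u \<in> cone_over \<Omega>" "q (proj_class u) \<in> U"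
  shows "frechet_derivative (lift_coords \<Gamma> \<phi>) (at u) w = frechet_derivative (lift_coords \<Gamma> \<phi>) (at u) w'
    \<longleftrightarrow> (\<exists>d. w' = w + d *\<^sub>R u)"
proof -
  obtain A W where W: "invertible A" "u \<in> W" "(A *v u) $ None \<noteq> 0"
    "(lift_coords \<Gamma> \<phi> has_derivative (\<lambda>h. affine_deriv (A *v u) (A *v h))) (at u)"
    using lift_coords_derivative[OF assms] by metis
  obtain B where B: "B ** A = mat 1" using W(1) unfolding invertible_def by blast
  have "A *v w' = A *v w + d *\<^sub>R (A *v u) \<longleftrightarrow> w' = w + d *\<^sub>R u" for d
  proof
    assume "A *v w' = A *v w + d *\<^sub>R (A *v u)"
    then have "B *v (A *v w') = B *v (A *v (w + d *\<^sub>R u))"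
      by (simp add: matrix_vector_right_distrib matrix_vector_mult_scaleR)
    then show "w' = w + d *\<^sub>R u" by (simp add: matrix_vector_mul_assoc B)
  qed (simp add: matrix_vector_right_distrib matrix_vector_mult_scaleR)
  then show ?thesis
    unfolding frechet_derivative_at[OF W(4), symmetric] by (simp add: affine_deriv_eq_iff[OF W(3)])
qed

lemma chart_matrix:
  assumes "(U, \<phi>) \<in> manifold_atlas \<Omega> \<Gamma>" "x \<in> \<phi> ` U"
  defines "N \<equiv> chart_matrix \<Omega> \<Gamma> (U, \<phi>)"
  shows "N *v affine_point x \<in> cone_over \<Omega>" "inv_into U \<phi> x = q (proj_class (N *v affine_point x))"
proof -
  have "\<exists>N. \<forall>x\<in>\<phi> ` U. N *v affine_point x \<in> cone_over \<Omega> \<and> inv_into U \<phi> x = q (proj_class (N *v affine_point x))"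
    using chart_inverse_form[OF assms(1)] by blast
  from someI_ex[OF this] have "\<forall>x\<in>\<phi> ` U. N *v affine_point x \<in> cone_over \<Omega> \<and>
      inv_into U \<phi> x = q (proj_class (N *v affine_point x))"
    unfolding N_def chart_matrix_def fst_conv snd_conv .
  then show "N *v affine_point x \<in> cone_over \<Omega>" "inv_into U \<phi> x = q (proj_class (N *v affine_point x))"
    using assms(2) by blast+
qed

lemma chart_open_inj:
  assumes "(U, \<phi>) \<in> manifold_atlas \<Omega> \<Gamma>"
  shows "open (\<phi> ` U)" "inj_on \<phi> U" "continuous_map (subtopology (manifold_top \<Omega> \<Gamma>) U) euclidean \<phi>"
  using chart_inverse_form[OF assms] by blast+

lemma has_derivative_chart_section:
  "((\<lambda>x. N *v affine_point x) has_derivative (\<lambda>y. N *v affine_direction y)) (at x)"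
  by (rule has_derivative_compose[OF has_derivative_affine_point
        bounded_linear_imp_has_derivative[OF matrix_vector_mul_bounded_linear]])

text \<open>Near the chart point the lifted coordinates composed with the affine section
  \<open>?s\<close> are the identity; differentiating shows that the lifted direction represents
  \<open>y\<close>.\<close>

lemma tangent_class_chart_section:
  assumes c: "(U, \<phi>) \<in> manifold_atlas \<Omega> \<Gamma>" and p: "p \<in> U"
  defines "N \<equiv> chart_matrix \<Omega> \<Gamma> (U, \<phi>)"
  shows "((U, \<phi>), p, y) \<in> tangent_class \<Omega> \<Gamma> (N *v affine_point (\<phi> p)) (N *v affine_direction y)"
proof -
  let ?s = "\<lambda>x. N *v affine_point x"
  note inverse_form = chart_matrix[OF c, folded N_def] and chart = chart_open_inj[OF c]
  have x: "\<phi> p \<in> \<phi> ` U" using p by blast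
  have qs: "q (proj_class (?s x)) = inv_into U \<phi> x" if "x \<in> \<phi> ` U" for x using inverse_form(2)[OF that] by simp
  have qp: "q (proj_class (?s (\<phi> p))) = p" using qs[OF x] inv_into_f_f[OF chart(2) p] by simp
  have "(lift_coords \<Gamma> \<phi> has_derivative frechet_derivative (lift_coords \<Gamma> \<phi>) (at (?s (\<phi> p)))) (at (?s (\<phi> p)))"
    by (rule lift_coords_differentiable[OF c inverse_form(1)[OF x]]) (simp add: qp p)
  from has_derivative_compose[OF has_derivative_chart_section this]
  have "((\<lambda>x. lift_coords \<Gamma> \<phi> (?s x)) has_derivative
      (\<lambda>y. frechet_derivative (lift_coords \<Gamma> \<phi>) (at (?s (\<phi> p))) (N *v affine_direction y))) (at (\<phi> p))" .
  moreover have "((\<lambda>x. lift_coords \<Gamma> \<phi> (?s x)) has_derivative (\<lambda>y. y)) (at (\<phi> p))"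
  proof (rule has_derivative_transform_within_open[OF has_derivative_ident chart(1) x])
    show "x' = lift_coords \<Gamma> \<phi> (?s x')" if "x' \<in> \<phi> ` U" for x'
      using that by (simp add: lift_coords_def qs f_inv_into_f)
  qed
  ultimately have "frechet_derivative (lift_coords \<Gamma> \<phi>) (at (?s (\<phi> p))) (N *v affine_direction y) = y"
    by (metis has_derivative_unique)
  then show ?thesis using c p qp by (simp add: mem_tangent_class)
qed

lemma q_class_act: "u \<noteq> 0 \<Longrightarrow> invertible A \<Longrightarrow> pgl_class A \<in> \<Gamma> \<Longrightarrow> q (proj_class (A *v u)) = q (proj_class u)"
  using q_act[of "pgl_class A" "proj_class u"] by (simp add: pgl_act_class)

text \<open>The lifted coordinates are invariant under the matrix; differentiate this identity by
  the chain rule.\<close>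

lemma tangent_class_act:
  assumes A: "invertible A" "pgl_class A \<in> \<Gamma>" and u: "u \<in> cone_over \<Omega>"
  shows "tangent_class \<Omega> \<Gamma> (A *v u) (A *v w) = tangent_class \<Omega> \<Gamma> u w"
proof -
  have nz: "u \<noteq> 0" using u by (simp add: cone_over_def)
  have qA: "q (proj_class (A *v u)) = q (proj_class u)" by (rule q_class_act[OF nz A])
  have Au: "A *v u \<in> cone_over \<Omega>" using mem_cone_over_act[OF A] u by blast
  have "frechet_derivative (lift_coords \<Gamma> \<phi>) (at (A *v u)) (A *v w) = frechet_derivative (lift_coords \<Gamma> \<phi>) (at u) w"
    if c: "(U, \<phi>) \<in> manifold_atlas \<Omega> \<Gamma>" "q (proj_class u) \<in> U" for U \<phi>
  proof -
    have "(lift_coords \<Gamma> \<phi> has_derivative frechet_derivative (lift_coords \<Gamma> \<phi>) (at (A *v u))) (at (A *v u))"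
      by (rule lift_coords_differentiable[OF c(1) Au]) (simp add: qA c(2))
    from has_derivative_compose[OF bounded_linear_imp_has_derivative[OF matrix_vector_mul_bounded_linear] this]
    have "((\<lambda>v. lift_coords \<Gamma> \<phi> (A *v v)) has_derivative
        (\<lambda>h. frechet_derivative (lift_coords \<Gamma> \<phi>) (at (A *v u)) (A *v h))) (at u)" .
    moreover have "((\<lambda>v. lift_coords \<Gamma> \<phi> (A *v v)) has_derivative frechet_derivative (lift_coords \<Gamma> \<phi>) (at u)) (at u)"
    proof (rule has_derivative_transform_within_open[OF lift_coords_differentiable[OF c(1) u c(2)]])
      show "open (- {0 :: real ^ 'n option})" by (simp add: open_Compl)
      show "lift_coords \<Gamma> \<phi> v = lift_coords \<Gamma> \<phi> (A *v v)" if "v \<in> - {0}" for v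
        using that q_class_act[OF _ A, of v] by (simp add: lift_coords_def)
    qed (use nz in simp)
    ultimately show ?thesis by (metis has_derivative_unique)
  qed
  then show ?thesis by (intro tangent_class_cong qA) (simp add: qA)
qed

text \<open>Equal classes have equal base orbits, which gives an element of \<open>\<Gamma>\<close>;
  comparison of the vectors in one chart then leaves only a radial term.\<close>

lemma tangent_class_eq_imp:
  assumes u: "u \<in> cone_over \<Omega>" "u' \<in> cone_over \<Omega>"
    and eq: "tangent_class \<Omega> \<Gamma> u w = tangent_class \<Omega> \<Gamma> u' w'"
  obtains A d where "invertible A" "pgl_class A \<in> \<Gamma>" "u' = A *v u" "w' = A *v w + d *\<^sub>R u'"
proof -
  have nz: "u \<noteq> 0" "u' \<noteq> 0" using u by (simp_all add: cone_over_def)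
  obtain t where "t \<in> tangent_class \<Omega> \<Gamma> u' w'" using tangent_class_nonempty[OF u(2), of w'] by auto
  then obtain U \<phi> where c: "(U, \<phi>) \<in> manifold_atlas \<Omega> \<Gamma>" "q (proj_class u') \<in> U"
    by (rule tangent_class_cases)
  then have "((U, \<phi>), q (proj_class u'), frechet_derivative (lift_coords \<Gamma> \<phi>) (at u') w') \<in> tangent_class \<Omega> \<Gamma> u w"
    unfolding eq mem_tangent_class by blast
  then have "q (proj_class u') = q (proj_class u)" unfolding mem_tangent_class by blast
  then obtain \<gamma> where \<gamma>: "\<gamma> \<in> \<Gamma>" "proj_class u' = pgl_act \<gamma> (proj_class u)" using q_eq_iff by metis
  obtain A0 where A0: "invertible A0" "\<gamma> = pgl_class A0" using pgl_class_cases by blast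
  then have "proj_class (A0 *v u) = proj_class u'" using \<gamma>(2) nz by (simp add: pgl_act_class)
  then obtain k where k: "k \<noteq> 0" "u' = k *s (A0 *v u)"
    using nz A0 matrix_vector_mult_nonzero proj_class_eq_iff by metis
  \<comment> \<open>Among the matrices of the same projective transformation, this one maps
    \<open>u\<close> to \<open>u'\<close> itself, not just to a multiple.\<close>
  define A where "A = matrix_smult k A0"
  have A: "invertible A" "pgl_class A \<in> \<Gamma>" using pgl_class_smult[OF k(1) A0(1)] A0(2) \<gamma>(1) by (simp_all add: A_def)
  have Au: "u' = A *v u" using k(2) matrix_smult_vector_mult[of k A0 1 u] by (simp add: A_def)
  have "tangent_class \<Omega> \<Gamma> u' (A *v w) = tangent_class \<Omega> \<Gamma> u' w'"
    using tangent_class_act[OF A u(1)] eq Au by simp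
  moreover have "((U, \<phi>), q (proj_class u'), frechet_derivative (lift_coords \<Gamma> \<phi>) (at u') w') \<in> tangent_class \<Omega> \<Gamma> u' w'"
    using c mem_tangent_class by blast
  ultimately have "frechet_derivative (lift_coords \<Gamma> \<phi>) (at u') (A *v w) = frechet_derivative (lift_coords \<Gamma> \<phi>) (at u') w'"
    using mem_tangent_class by metis
  then obtain d where "w' = A *v w + d *\<^sub>R u'" using frechet_derivative_lift_coords_eq_iff[OF c(1) u(2) c(2)] by blast
  then show thesis using that A Au by blast
qed

lemma tangent_class_shift:
  assumes "u \<in> cone_over \<Omega>"
  shows "tangent_class \<Omega> \<Gamma> u (w + d *\<^sub>R u) = tangent_class \<Omega> \<Gamma> u w"
proof -
  have "frechet_derivative (lift_coords \<Gamma> \<phi>) (at u) (w + d *\<^sub>R u) = frechet_derivative (lift_coords \<Gamma> \<phi>) (at u) w"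
    if "(U, \<phi>) \<in> manifold_atlas \<Omega> \<Gamma>" "q (proj_class u) \<in> U" for U \<phi>
    using frechet_derivative_lift_coords_eq_iff[OF that(1) assms that(2), of w "w + d *\<^sub>R u"] by auto
  then show ?thesis by (intro tangent_class_cong refl)
qed

lemma tangent_class_zero:
  assumes u: "u \<in> cone_over \<Omega>"
  shows "tangent_class \<Omega> \<Gamma> u 0 = zero_section (manifold_atlas \<Omega> \<Gamma>) (q (proj_class u))"
proof -
  have "frechet_derivative (lift_coords \<Gamma> \<phi>) (at u) 0 = 0"
    if "(U, \<phi>) \<in> manifold_atlas \<Omega> \<Gamma>" "q (proj_class u) \<in> U" for U \<phi>
    using has_derivative_linear[OF lift_coords_differentiable[OF that(1) u that(2)]] by (rule linear_0)
  then show ?thesis unfolding tangent_class_def zero_section_def by force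
qed

end

section \<open>Isomorphisms and their differentials\<close>

lemma induced_map_orbit:
  assumes g: "manifold_isomorphism \<Omega> \<Gamma> \<Omega>' \<Gamma>' g"
  shows "induced_map g (orbit_of pgl_act \<Gamma> x) = orbit_of pgl_act \<Gamma>' (pgl_act g x)"
proof -
  have \<Gamma>': "\<Gamma>' = (\<lambda>\<gamma>. pgl_mult (pgl_mult g \<gamma>) (inv\<^bsub>PGL\<^esub> g)) ` \<Gamma>"
    using g unfolding manifold_isomorphism_def PGL_simps by simp
  show ?thesis
    unfolding induced_map_def orbit_of_def \<Gamma>' image_image
    by (simp add: pgl_act_mult pgl_act_inv)
qed

lemma induced_complex_map_orbit:
  assumes g: "manifold_isomorphism \<Omega> \<Gamma> \<Omega>' \<Gamma>' g"
  shows "induced_complex_map g (orbit_of (\<lambda>\<gamma>. pgl_act (complex_pgl \<gamma>)) \<Gamma> z)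
    = orbit_of (\<lambda>\<gamma>. pgl_act (complex_pgl \<gamma>)) \<Gamma>' (pgl_act (complex_pgl g) z)"
proof -
  interpret group "PGL :: (real, 'a) pgl monoid" by (rule group_PGL)
  have \<Gamma>': "\<Gamma>' = (\<lambda>\<gamma>. pgl_mult (pgl_mult g \<gamma>) (inv\<^bsub>PGL\<^esub> g)) ` \<Gamma>"
    using g unfolding manifold_isomorphism_def PGL_simps by simp
  have "pgl_mult (inv\<^bsub>PGL\<^esub> g) g = pgl_one" using l_inv[of g] by (simp add: PGL_simps)
  then have "pgl_mult (complex_pgl (inv\<^bsub>PGL\<^esub> g)) (complex_pgl g) = pgl_one"
    by (simp add: complex_pgl_one flip: complex_pgl_mult)
  then have "pgl_act (complex_pgl (inv\<^bsub>PGL\<^esub> g)) (pgl_act (complex_pgl g) z) = z" for z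
    by (simp add: pgl_act_one flip: pgl_act_mult)
  then show ?thesis
    unfolding induced_complex_map_def orbit_of_def \<Gamma>' image_image
    by (simp add: complex_pgl_mult pgl_act_mult)
qed

text \<open>With \<open>k\<close> the identity matrix this computes the equivalence classes of the tangent bundle;
  in general it computes the differential of an isomorphism.\<close>
lemma tangent_rel_tangent_class:
  assumes M: "projective_manifold \<Omega> \<Gamma>" and M': "projective_manifold \<Omega>' \<Gamma>'"
    and k: "invertible k" "manifold_isomorphism \<Omega> \<Gamma> \<Omega>' \<Gamma>' (pgl_class k)"
    and u: "u \<in> cone_over \<Omega>" and t: "t \<in> tangent_class \<Omega> \<Gamma> u w"
  shows "tangent_rel (manifold_atlas \<Omega> \<Gamma>) (manifold_atlas \<Omega>' \<Gamma>') (induced_map (pgl_class k)) `` {t}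
    = tangent_class \<Omega>' \<Gamma>' (k *v u) (k *v w)"
proof -
  interpret M: projective_manifold \<Omega> \<Gamma> by (rule M)
  interpret M': projective_manifold \<Omega>' \<Gamma>' by (rule M')
  let ?h = "induced_map (pgl_class k)"
  have image: "pgl_act (pgl_class k) ` \<Omega> = \<Omega>'" using k(2) unfolding manifold_isomorphism_def by simp
  have hq: "?h (M.q (proj_class v)) = M'.q (proj_class (k *v v))" if "v \<noteq> 0" for v
    using induced_map_orbit[OF k(2)] that k(1) by (simp add: pgl_act_class)
  have cone: "k *v v \<in> cone_over \<Omega>' \<longleftrightarrow> v \<in> cone_over \<Omega>" for v by (rule mem_cone_over_image[OF k(1) image])
  have nz: "u \<noteq> 0" using u by (simp add: cone_over_def)
  obtain U \<phi> where t': "t = ((U, \<phi>), M.q (proj_class u), frechet_derivative (lift_coords \<Gamma> \<phi>) (at u) w)"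
    and c: "(U, \<phi>) \<in> manifold_atlas \<Omega> \<Gamma>" "M.q (proj_class u) \<in> U"
    by (rule M.tangent_class_cases[OF t])
  define p where "p = M.q (proj_class u)"
  have p: "p \<in> U" "?h p = M'.q (proj_class (k *v u))" using c hq[OF nz] by (simp_all add: p_def)
  \<comment> \<open>On the cone near \<open>u\<close>, \<open>?T\<close> after the lifted chart
    equals the lifted target chart after \<open>k\<close>. Differentiating both sides gives the
    equation.\<close>
  have main: "frechet_derivative (\<psi> \<circ> ?h \<circ> inv_into U \<phi>) (at (\<phi> p)) (frechet_derivative (lift_coords \<Gamma> \<phi>) (at u) w)
      = frechet_derivative (lift_coords \<Gamma>' \<psi>) (at (k *v u)) (k *v w)"
    if c': "(V, \<psi>) \<in> manifold_atlas \<Omega>' \<Gamma>'" "?h p \<in> V" for V \<psi>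
  proof -
    define N where "N = chart_matrix \<Omega> \<Gamma> (U, \<phi>)"
    let ?s = "\<lambda>x. N *v affine_point x" and ?T = "\<psi> \<circ> ?h \<circ> inv_into U \<phi>"
    note inverse_form = M.chart_matrix[OF c(1), folded N_def] and chart = M.chart_open_inj[OF c(1)]
    have x: "\<phi> p \<in> \<phi> ` U" using p by blast
    have hs: "M'.q (proj_class (k *v ?s x)) = ?h (inv_into U \<phi> x)" if "x \<in> \<phi> ` U" for x
      using inverse_form[OF that] hq[of "?s x"] by (simp add: cone_over_def)
    have "(lift_coords \<Gamma>' \<psi> has_derivative frechet_derivative (lift_coords \<Gamma>' \<psi>) (at (k *v ?s (\<phi> p)))) (at (k *v ?s (\<phi> p)))"
    proof (rule M'.lift_coords_differentiable[OF c'(1)])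
      show "k *v ?s (\<phi> p) \<in> cone_over \<Omega>'" using cone inverse_form(1)[OF x] by simp
      show "M'.q (proj_class (k *v ?s (\<phi> p))) \<in> V" using hs[OF x] c'(2) inv_into_f_f[OF chart(2) p(1)] by simp
    qed
    \<comment> \<open>Differentiability of \<open>?T\<close> must be known before the chain rule
      applies; the affine section shows it by factoring \<open>?T\<close> through the cone.\<close>
    from has_derivative_compose[OF M.has_derivative_chart_section
        has_derivative_compose[OF bounded_linear_imp_has_derivative[OF matrix_vector_mul_bounded_linear] this]]
    have "?T differentiable at (\<phi> p)"
      unfolding differentiable_def
    proof (intro exI, rule has_derivative_transform_within_open[OF _ chart(1) x])
      show "lift_coords \<Gamma>' \<psi> (k *v ?s x) = ?T x" if "x \<in> \<phi> ` U" for x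
        using hs[OF that] by (simp add: lift_coords_def)
    qed
    then have "(?T has_derivative frechet_derivative ?T (at (\<phi> p))) (at (lift_coords \<Gamma> \<phi> u))"
      by (simp add: frechet_derivative_works lift_coords_def p_def)
    from has_derivative_compose[OF M.lift_coords_differentiable[OF c(1) u c(2)] this]
    have 1: "((\<lambda>v. ?T (lift_coords \<Gamma> \<phi> v)) has_derivative
        (\<lambda>w. frechet_derivative ?T (at (\<phi> p)) (frechet_derivative (lift_coords \<Gamma> \<phi>) (at u) w))) (at u)" .
    have "(lift_coords \<Gamma>' \<psi> has_derivative frechet_derivative (lift_coords \<Gamma>' \<psi>) (at (k *v u))) (at (k *v u))"
      by (rule M'.lift_coords_differentiable[OF c'(1)]) (use cone u c'(2) p(2) in simp_all)
    from has_derivative_compose[OF bounded_linear_imp_has_derivative[OF matrix_vector_mul_bounded_linear] this]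
    have 2: "((\<lambda>v. lift_coords \<Gamma>' \<psi> (k *v v)) has_derivative
        (\<lambda>w. frechet_derivative (lift_coords \<Gamma>' \<psi>) (at (k *v u)) (k *v w))) (at u)" .
    obtain A W where W: "open W" "u \<in> W" "W \<subseteq> cone_over \<Omega>" "\<And>v. v \<in> W \<Longrightarrow> M.q (proj_class v) \<in> U"
      using M.chart_local_form[OF c(1) u c(2)] by metis
    have "((\<lambda>v. ?T (lift_coords \<Gamma> \<phi> v)) has_derivative
        (\<lambda>w. frechet_derivative (lift_coords \<Gamma>' \<psi>) (at (k *v u)) (k *v w))) (at u)"
    proof (rule has_derivative_transform_within_open[OF 2 W(1,2)])
      fix v assume v: "v \<in> W"
      then have "v \<noteq> 0" using W(3) by (auto simp: cone_over_def)
      then show "lift_coords \<Gamma>' \<psi> (k *v v) = ?T (lift_coords \<Gamma> \<phi> v)"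
        using inv_into_f_f[OF chart(2) W(4)[OF v]] by (simp add: lift_coords_def hq)
    qed
    then show ?thesis using has_derivative_unique[OF 1] by metis
  qed
  show ?thesis
  proof (intro equalityI subsetI)
    fix t2 assume "t2 \<in> tangent_rel (manifold_atlas \<Omega> \<Gamma>) (manifold_atlas \<Omega>' \<Gamma>') ?h `` {t}"
    then obtain V \<psi> where "t2 = ((V, \<psi>), ?h p, frechet_derivative (\<psi> \<circ> ?h \<circ> inv_into U \<phi>) (at (\<phi> p)) (frechet_derivative (lift_coords \<Gamma> \<phi>) (at u) w))"
      "(V, \<psi>) \<in> manifold_atlas \<Omega>' \<Gamma>'" "?h p \<in> V"
      unfolding tangent_rel_def t' p_def by blast
    then show "t2 \<in> tangent_class \<Omega>' \<Gamma>' (k *v u) (k *v w)"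
      using main p(2) by (simp add: mem_tangent_class)
  next
    fix t2 assume "t2 \<in> tangent_class \<Omega>' \<Gamma>' (k *v u) (k *v w)"
    then obtain V \<psi> where "t2 = ((V, \<psi>), M'.q (proj_class (k *v u)), frechet_derivative (lift_coords \<Gamma>' \<psi>) (at (k *v u)) (k *v w))"
      and V: "(V, \<psi>) \<in> manifold_atlas \<Omega>' \<Gamma>'" "M'.q (proj_class (k *v u)) \<in> V"
      by (rule M'.tangent_class_cases)
    then have "t2 = ((V, \<psi>), ?h p, frechet_derivative (\<psi> \<circ> ?h \<circ> inv_into U \<phi>) (at (\<phi> p)) (frechet_derivative (lift_coords \<Gamma> \<phi>) (at u) w))"
      using main[OF V(1)] p(2) by simp
    then show "t2 \<in> tangent_rel (manifold_atlas \<Omega> \<Gamma>) (manifold_atlas \<Omega>' \<Gamma>') ?h `` {t}"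
      unfolding tangent_rel_def t' p_def[symmetric] using V p c by (auto simp: p_def)
  qed
qed

section \<open>The tangent bundle as a quotient of pairs of vectors\<close>

context projective_manifold
begin

lemma isomorphism_one: "manifold_isomorphism \<Omega> \<Gamma> \<Omega> \<Gamma> (pgl_class (mat 1))"
proof -
  interpret group "PGL :: (real, 'n) pgl monoid" by (rule group_PGL)
  have "\<one>\<^bsub>PGL\<^esub> \<otimes>\<^bsub>PGL\<^esub> \<gamma> \<otimes>\<^bsub>PGL\<^esub> inv\<^bsub>PGL\<^esub> \<one>\<^bsub>PGL\<^esub> = \<gamma>" for \<gamma> :: "(real, 'n) pgl"
    using l_one[of \<gamma>] r_one[of \<gamma>] by (simp add: PGL_simps(3))
  then show ?thesis
    unfolding manifold_isomorphism_def pgl_one.abs_eq[symmetric] PGL_simps(2)[symmetric]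
    by (simp add: PGL_simps(2) pgl_act_one)
qed

lemma tangent_rel_id:
  assumes "u \<in> cone_over \<Omega>" "t \<in> tangent_class \<Omega> \<Gamma> u w"
  shows "tangent_rel (manifold_atlas \<Omega> \<Gamma>) (manifold_atlas \<Omega> \<Gamma>) id `` {t} = tangent_class \<Omega> \<Gamma> u w"
proof -
  have "induced_map (pgl_class (mat 1) :: (real, 'n) pgl) = id"
    unfolding induced_map_def pgl_one.abs_eq[symmetric] by (auto simp: pgl_act_one)
  then show ?thesis
    using tangent_rel_tangent_class[OF projective_manifold_axioms projective_manifold_axioms
        invertible_mat_1 isomorphism_one assms] by simp
qed

abbreviation "bundle_reps \<equiv>
  sum_topology (\<lambda>c. prod_topology (subtopology (manifold_top \<Omega> \<Gamma>) (fst c)) euclidean) (manifold_atlas \<Omega> \<Gamma>)"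

abbreviation "TM \<equiv> tangent_bundle_top (manifold_top \<Omega> \<Gamma>) (manifold_atlas \<Omega> \<Gamma>)"

text \<open>Lifts a coordinate representative to a pair of vectors. It plays the same part for the
  tangent bundle as \<open>balance\<close> does for the tube.\<close>

definition tangent_section ::
  "((real, 'n) projective_space set, real ^ 'n) tangent_rep \<Rightarrow> (real ^ ('n option)) \<times> (real ^ ('n option))" where
  "tangent_section t = (case t of (c, p, y) \<Rightarrow>
     (chart_matrix \<Omega> \<Gamma> c *v affine_point (snd c p), chart_matrix \<Omega> \<Gamma> c *v affine_direction y))"

lemma topspace_bundle_reps: "(c, p, y) \<in> topspace bundle_reps \<longleftrightarrow> c \<in> manifold_atlas \<Omega> \<Gamma> \<and> p \<in> fst c"
  using atlas_subset[of "fst c" "snd c"] by auto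

lemma quotient_map_bundle_reps:
  "quotient_map bundle_reps TM (\<lambda>t. tangent_rel (manifold_atlas \<Omega> \<Gamma>) (manifold_atlas \<Omega> \<Gamma>) id `` {t})"
  unfolding tangent_bundle_top_def by (rule quotient_map_quotient_topology)

lemma tangent_section:
  assumes "t \<in> topspace bundle_reps"
  shows "fst (tangent_section t) \<in> cone_over \<Omega>"
    "tangent_rel (manifold_atlas \<Omega> \<Gamma>) (manifold_atlas \<Omega> \<Gamma>) id `` {t}
      = tangent_class \<Omega> \<Gamma> (fst (tangent_section t)) (snd (tangent_section t))"
proof -
  obtain U \<phi> p y where t: "t = ((U, \<phi>), p, y)" by (metis surj_pair)
  have c: "(U, \<phi>) \<in> manifold_atlas \<Omega> \<Gamma>" "p \<in> U" using assms unfolding t topspace_bundle_reps by simp_all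
  show mem: "fst (tangent_section t) \<in> cone_over \<Omega>"
    unfolding t tangent_section_def using chart_matrix(1)[OF c(1)] c(2) by simp
  have "t \<in> tangent_class \<Omega> \<Gamma> (fst (tangent_section t)) (snd (tangent_section t))"
    unfolding t tangent_section_def using tangent_class_chart_section[OF c] by simp
  then show "tangent_rel (manifold_atlas \<Omega> \<Gamma>) (manifold_atlas \<Omega> \<Gamma>) id `` {t}
      = tangent_class \<Omega> \<Gamma> (fst (tangent_section t)) (snd (tangent_section t))"
    by (rule tangent_rel_id[OF mem])
qed

lemma continuous_map_from_sum:
  assumes "\<And>i. i \<in> I \<Longrightarrow> continuous_map (X i) Y (\<lambda>x. f (i, x))"
  shows "continuous_map (sum_topology X I) Y f"
  unfolding continuous_map_def
proof (intro conjI allI impI)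
  show "f \<in> topspace (sum_topology X I) \<rightarrow> topspace Y"
    using continuous_map_funspace[OF assms] by (force simp: Pi_iff)
  fix U assume U: "openin Y U"
  have "{x. (i, x) \<in> {z \<in> topspace (sum_topology X I). f z \<in> U}} = {x \<in> topspace (X i). f (i, x) \<in> U}"
    if "i \<in> I" for i
    using that by auto
  then show "openin (sum_topology X I) {z \<in> topspace (sum_topology X I). f z \<in> U}"
    unfolding openin_sum_topology using openin_continuous_map_preimage[OF assms U] by auto
qed

lemma continuous_map_tangent_section:
  "continuous_map bundle_reps (top_of_set (cone_over \<Omega> \<times> UNIV)) tangent_section"
proof -
  have "continuous_map (prod_topology (subtopology (manifold_top \<Omega> \<Gamma>) (fst c)) euclidean) euclidean
      (\<lambda>x. tangent_section (c, x))" if c: "c \<in> manifold_atlas \<Omega> \<Gamma>" for c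
  proof -
    have cont: "continuous_map (subtopology (manifold_top \<Omega> \<Gamma>) (fst c)) euclidean (snd c)"
      using chart_open_inj(3)[of "fst c" "snd c"] c by simp
    have "continuous_on UNIV (\<lambda>x. N *v affine_point x)" for N :: "real ^ ('n option) ^ ('n option)"
      by (intro continuous_at_imp_continuous_on ballI has_derivative_continuous[OF has_derivative_chart_section])
    then have 1: "continuous_map euclidean euclidean (\<lambda>x. chart_matrix \<Omega> \<Gamma> c *v affine_point x)" by simp
    have "continuous_on UNIV (\<lambda>x. N *v affine_direction x)" for N :: "real ^ ('n option) ^ ('n option)"
      using linear_compose[OF linear_affine_direction matrix_vector_mul_linear[of N]]
      by (intro linear_continuous_on) (simp add: linear_conv_bounded_linear o_def)
    then have 2: "continuous_map euclidean euclidean (\<lambda>x. chart_matrix \<Omega> \<Gamma> c *v affine_direction x)" by simp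
    have "continuous_map (prod_topology (subtopology (manifold_top \<Omega> \<Gamma>) (fst c)) euclidean) (prod_topology euclidean euclidean)
      (\<lambda>x. (((\<lambda>x. chart_matrix \<Omega> \<Gamma> c *v affine_point x) \<circ> (snd c \<circ> fst)) x, ((\<lambda>x. chart_matrix \<Omega> \<Gamma> c *v affine_direction x) \<circ> snd) x))"
      by (intro continuous_map_pairedI continuous_map_compose[OF _ 1] continuous_map_compose[OF _ 2]
          continuous_map_compose[OF continuous_map_fst cont] continuous_map_snd)
    then show ?thesis by (simp add: tangent_section_def case_prod_beta o_def)
  qed
  then have "continuous_map bundle_reps euclidean tangent_section"
    by (rule continuous_map_from_sum)
  moreover have "tangent_section \<in> topspace bundle_reps \<rightarrow> cone_over \<Omega> \<times> UNIV"
    using tangent_section(1) by (auto simp: mem_Times_iff simp del: topspace_sum_topology)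
  ultimately show ?thesis by (simp add: continuous_map_in_subtopology del: topspace_sum_topology)
qed

text \<open>Over a neighbourhood on which one chart is used, a representative depends on
  \<open>(u, w)\<close> by an explicit continuous formula; the projection of the bundle then gives
  the class.\<close>

lemma continuous_map_tangent_class_local:
  assumes "u \<in> cone_over \<Omega>"
  obtains W where "open W" "u \<in> W" "W \<subseteq> cone_over \<Omega>"
    "continuous_map (top_of_set (W \<times> UNIV)) TM (\<lambda>(u, w). tangent_class \<Omega> \<Gamma> u w)"
proof -
  obtain U \<phi> where c: "(U, \<phi>) \<in> manifold_atlas \<Omega> \<Gamma>" "q (proj_class u) \<in> U"
    using exists_chart[of "proj_class u"] assms by (auto simp: cone_over_def)
  obtain A W where W: "invertible A" "open W" "u \<in> W" "W \<subseteq> cone_over \<Omega>"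
    "\<And>v. v \<in> W \<Longrightarrow> q (proj_class v) \<in> U" "\<And>v. v \<in> W \<Longrightarrow> (A *v v) $ None \<noteq> 0"
    "\<And>v. v \<in> W \<Longrightarrow> (lift_coords \<Gamma> \<phi> has_derivative (\<lambda>h. affine_deriv (A *v v) (A *v h))) (at v)"
    using lift_coords_derivative[OF c(1) assms c(2)] by metis
  define r where "r z = (q (proj_class (fst z)), affine_deriv (A *v fst z) (A *v snd z))" for z
  have W0: "W \<subseteq> - {0}" using W(4) by (auto simp: cone_over_def)
  have "continuous_map (top_of_set (W \<times> UNIV)) (top_of_set \<Omega>) (\<lambda>z. proj_class (fst z))"
    using W(4) continuous_on_compose2[OF continuous_on_subset[OF continuous_on_proj_class W0]
        continuous_on_fst[OF continuous_on_id], of "W \<times> UNIV"]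
    by (auto simp: continuous_map_in_subtopology cone_over_def)
  from continuous_map_compose[OF this continuous_map_q]
  have "continuous_map (top_of_set (W \<times> UNIV)) (manifold_top \<Omega> \<Gamma>) (\<lambda>z. q (proj_class (fst z)))"
    by (simp add: o_def)
  then have 1: "continuous_map (top_of_set (W \<times> UNIV)) (subtopology (manifold_top \<Omega> \<Gamma>) U) (\<lambda>z. q (proj_class (fst z)))"
    using W(5) by (auto simp: continuous_map_in_subtopology)
  have "continuous_on (W \<times> UNIV) (\<lambda>z. affine_deriv (A *v fst z) (A *v snd z))"
    by (intro continuous_on_affine_deriv W(6)
        bounded_linear.continuous_on[OF matrix_vector_mul_bounded_linear] continuous_intros) auto
  then have 2: "continuous_map (top_of_set (W \<times> UNIV)) euclidean (\<lambda>z. affine_deriv (A *v fst z) (A *v snd z))"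
    by simp
  have "continuous_map (top_of_set (W \<times> UNIV)) (prod_topology (subtopology (manifold_top \<Omega> \<Gamma>) U) euclidean) r"
    unfolding r_def by (intro continuous_map_pairedI 1 2)
  then have 3: "continuous_map (top_of_set (W \<times> UNIV)) bundle_reps (Pair (U, \<phi>) \<circ> r)"
    by (rule continuous_map_compose)
      (use continuous_map_component_injection[OF c(1), of "\<lambda>c. prod_topology (subtopology (manifold_top \<Omega> \<Gamma>) (fst c)) euclidean"] in simp)
  have "continuous_map (top_of_set (W \<times> UNIV)) TM
      ((\<lambda>t. tangent_rel (manifold_atlas \<Omega> \<Gamma>) (manifold_atlas \<Omega> \<Gamma>) id `` {t}) \<circ> (Pair (U, \<phi>) \<circ> r))"
    by (rule continuous_map_compose[OF 3 quotient_imp_continuous_map[OF quotient_map_bundle_reps]])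
  then have "continuous_map (top_of_set (W \<times> UNIV)) TM (\<lambda>(u, w). tangent_class \<Omega> \<Gamma> u w)"
  proof (rule continuous_map_eq)
    fix z assume "z \<in> topspace (top_of_set (W \<times> (UNIV :: (real ^ 'n option) set)))"
    then obtain v w where z: "z = (v, w)" "v \<in> W" by auto
    have rz: "((U, \<phi>), r z) \<in> tangent_class \<Omega> \<Gamma> v w"
      unfolding z(1) r_def by (simp add: mem_tangent_class c(1) W(5)[OF z(2)] frechet_derivative_at[OF W(7)[OF z(2)], symmetric])
    have "v \<in> cone_over \<Omega>" using W(4) z(2) by blast
    then show "((\<lambda>t. tangent_rel (manifold_atlas \<Omega> \<Gamma>) (manifold_atlas \<Omega> \<Gamma>) id `` {t}) \<circ> (Pair (U, \<phi>) \<circ> r)) z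
        = (case z of (u, w) \<Rightarrow> tangent_class \<Omega> \<Gamma> u w)"
      using tangent_rel_id[OF _ rz] by (simp only: o_apply z(1) prod.case)
  qed
  then show thesis using that W(2-4) by blast
qed

text \<open>Composed with the continuous \<open>tangent_section\<close>, the map becomes the
  projection that defines the topology of the bundle.\<close>

lemma quotient_map_tangent_class:
  "quotient_map (top_of_set (cone_over \<Omega> \<times> UNIV)) TM (\<lambda>(u, w). tangent_class \<Omega> \<Gamma> u w)"
    (is "quotient_map ?X _ ?B")
proof (rule quotient_map_from_composition)
  show "continuous_map bundle_reps ?X tangent_section" by (rule continuous_map_tangent_section)
  show "quotient_map bundle_reps TM (?B \<circ> tangent_section)"
    by (rule quotient_map_eq[OF quotient_map_bundle_reps]) (simp add: tangent_section(2) case_prod_beta del: topspace_sum_topology)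
  show "continuous_map ?X TM ?B"
    unfolding continuous_map_def
  proof (intro conjI allI impI)
    show "?B \<in> topspace ?X \<rightarrow> topspace TM"
    proof
      fix z :: "(real ^ ('n option)) \<times> (real ^ ('n option))" assume "z \<in> topspace ?X"
      then obtain W where "fst z \<in> W" "continuous_map (top_of_set (W \<times> UNIV)) TM ?B"
        using continuous_map_tangent_class_local[of "fst z"] by (metis mem_Times_iff topspace_euclidean_subtopology)
      then show "?B z \<in> topspace TM"
        by (auto dest!: continuous_map_funspace simp: Pi_iff case_prod_beta)
    qed
    fix T assume T: "openin TM T"
    show "openin ?X {z \<in> topspace ?X. ?B z \<in> T}"
    proof (subst openin_subopen, intro ballI)
      fix z assume "z \<in> {z \<in> topspace ?X. ?B z \<in> T}"
      then have z: "fst z \<in> cone_over \<Omega>" "?B z \<in> T" by (auto simp: mem_Times_iff)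
      obtain W where W: "open W" "fst z \<in> W" "W \<subseteq> cone_over \<Omega>" "continuous_map (top_of_set (W \<times> UNIV)) TM ?B"
        using continuous_map_tangent_class_local[OF z(1)] by metis
      have "openin (top_of_set (W \<times> UNIV)) {z \<in> W \<times> UNIV. ?B z \<in> T}"
        using openin_continuous_map_preimage[OF W(4) T] by simp
      then have "open {z \<in> W \<times> UNIV. ?B z \<in> T}"
        using W(1) openin_open_trans open_Times by blast
      then have "openin ?X {z \<in> W \<times> UNIV. ?B z \<in> T}"
        by (rule open_subset[rotated]) (use W(3) in auto)
      then show "\<exists>S. openin ?X S \<and> z \<in> S \<and> S \<subseteq> {z \<in> topspace ?X. ?B z \<in> T}"
        by (rule_tac exI[of _ "{z \<in> W \<times> UNIV. ?B z \<in> T}"]) (use W z in \<open>auto simp: mem_Times_iff\<close>)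
    qed
  qed
qed

definition tube_class :: "real ^ ('n option) \<Rightarrow> real ^ ('n option) \<Rightarrow> (complex, 'n) projective_space set" where
  "tube_class u w = orbit_of (\<lambda>\<gamma>. pgl_act (complex_pgl \<gamma>)) \<Gamma> (tube_point \<Omega> u w)"

lemma quotient_map_tube_class:
  "quotient_map (top_of_set (cone_over \<Omega> \<times> UNIV)) (complexification_top \<Omega> \<Gamma>) (\<lambda>(u, w). tube_class u w)"
proof -
  obtain C where "open_convex_cone C" "symmetrize C = cone_over \<Omega>"
    using projectively_convex_cone[OF convex_domain open_domain] by blast
  then interpret convex_domain C \<Omega> by (simp add: convex_domain_def convex_domain_axioms_def)
  have "quotient_map (top_of_set (cone_over \<Omega> \<times> UNIV)) (complexification_top \<Omega> \<Gamma>)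
      (orbit_of (\<lambda>\<gamma>. pgl_act (complex_pgl \<gamma>)) \<Gamma> \<circ> (\<lambda>(u, w). tube_point \<Omega> u w))"
    unfolding complexification_top_def
    by (rule quotient_map_compose[OF quotient_map_tube_point quotient_map_quotient_topology])
  then show ?thesis unfolding tube_class_def case_prod_beta o_def .
qed

text \<open>Both fibres consist of the pairs obtained by \<open>\<Gamma>\<close>, common real
  scaling and radial shifts. The matrix of a projective transformation is free up to a scalar, so
  scaling and \<open>\<Gamma>\<close> merge into one matrix.\<close>

lemma tube_class_eq_iff:
  assumes u: "u \<in> cone_over \<Omega>" "u' \<in> cone_over \<Omega>"
  shows "tube_class u w = tube_class u' w' \<longleftrightarrow> tangent_class \<Omega> \<Gamma> u w = tangent_class \<Omega> \<Gamma> u' w'"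
proof -
  obtain C where "open_convex_cone C" "symmetrize C = cone_over \<Omega>"
    using projectively_convex_cone[OF convex_domain open_domain] by blast
  then interpret convex_domain C \<Omega> by (simp add: convex_domain_def convex_domain_axioms_def)
  have nz: "u \<noteq> 0" "u' \<noteq> 0" using u by (simp_all add: cone_over_def)
  have orbit: "tube_class u w = tube_class u' w' \<longleftrightarrow>
      (\<exists>\<gamma>\<in>\<Gamma>. tube_point \<Omega> u' w' = pgl_act (complex_pgl \<gamma>) (tube_point \<Omega> u w))"
    unfolding tube_class_def
    by (rule orbit_of_eq_iff[OF subgroup]) (simp_all add: complex_pgl_mult pgl_act_mult complex_pgl_one pgl_act_one)
  have equiv: "pgl_act (complex_pgl (pgl_class A)) (tube_point \<Omega> u w) = tube_point \<Omega> (A *v u) (A *v w)"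
    if "invertible A" "pgl_class A \<in> \<Gamma>" for A
    using tube_point_equivariant[OF that(1) image_domain[OF that(2)] nz(1)] by simp
  show ?thesis
  proof
    assume "tube_class u w = tube_class u' w'"
    then obtain \<gamma> where \<gamma>: "\<gamma> \<in> \<Gamma>" "tube_point \<Omega> u' w' = pgl_act (complex_pgl \<gamma>) (tube_point \<Omega> u w)"
      using orbit by blast
    obtain A where A: "invertible A" "\<gamma> = pgl_class A" using pgl_class_cases by blast
    have Au: "A *v u \<in> cone_over \<Omega>" using mem_cone_over_act A \<gamma>(1) u(1) by simp
    have "tube_point \<Omega> (A *v u) (A *v w) = tube_point \<Omega> u' w'" using equiv A \<gamma> by simp
    then obtain a d where ad: "a \<noteq> 0" "u' = a *\<^sub>R (A *v u)" "w' = a *\<^sub>R (A *v w) + d *\<^sub>R (A *v u)"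
      using tube_point_eq_iff[OF Au u(2)] by blast
    define B where "B = matrix_smult a A"
    have B: "invertible B" "pgl_class B \<in> \<Gamma>" using pgl_class_smult[OF ad(1) A(1)] A(2) \<gamma>(1) by (simp_all add: B_def)
    have Bv: "B *v v = a *\<^sub>R (A *v v)" for v
      using matrix_smult_vector_mult[of a A 1 v] by (simp add: B_def scalar_mult_eq_scaleR)
    have "w' = B *v w + (d / a) *\<^sub>R (B *v u)" "u' = B *v u" using ad by (simp_all add: Bv)
    then show "tangent_class \<Omega> \<Gamma> u w = tangent_class \<Omega> \<Gamma> u' w'"
      using tangent_class_act[OF B u(1), of w] tangent_class_shift[of "B *v u" "B *v w"] u(2) by simp
  next
    assume "tangent_class \<Omega> \<Gamma> u w = tangent_class \<Omega> \<Gamma> u' w'"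
    then obtain A d where A: "invertible A" "pgl_class A \<in> \<Gamma>" "u' = A *v u" "w' = A *v w + d *\<^sub>R u'"
      by (rule tangent_class_eq_imp[OF u])
    have "tube_point \<Omega> (A *v u) (A *v w) = tube_point \<Omega> u' w'"
      using tube_point_eq_iff[OF u(2,2), of "A *v w" w'] A(3,4)
      by (metis scaleR_one zero_neq_one)
    then show "tube_class u w = tube_class u' w'" using orbit equiv A(1,2) by metis
  qed
qed

lemma tube_class_zero:
  assumes u: "u \<in> cone_over \<Omega>"
  shows "tube_class u 0 = manifold_inclusion (q (proj_class u))"
proof -
  obtain C where "open_convex_cone C" "symmetrize C = cone_over \<Omega>"
    using projectively_convex_cone[OF convex_domain open_domain] by blast
  then interpret convex_domain C \<Omega> by (simp add: convex_domain_def convex_domain_axioms_def)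
  show ?thesis
    unfolding tube_class_def tube_point_zero[OF u] manifold_inclusion_def orbit_of_def image_image
    by (simp add: complex_point_act)
qed

end

text \<open>On points of the complexification the choice is unique by
  \<open>tube_class_eq_iff\<close>. Only \<open>\<Omega>\<close> and \<open>\<Gamma>\<close> enter,
  so one function serves all manifolds, as \<open>natural\<close> demands.\<close>

definition tube_to_tangent ::
  "(real, 'n::finite) projective_space set \<Rightarrow> (real, 'n) pgl set \<Rightarrow> (complex, 'n) projective_space set
     \<Rightarrow> ((real, 'n) projective_space set, real ^ 'n) tangent_rep set" where
  "tube_to_tangent \<Omega> \<Gamma> z = (SOME \<xi>. \<exists>u w. u \<in> cone_over \<Omega> \<and>
     z = orbit_of (\<lambda>\<gamma>. pgl_act (complex_pgl \<gamma>)) \<Gamma> (tube_point \<Omega> u w) \<and> \<xi> = tangent_class \<Omega> \<Gamma> u w)"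

context projective_manifold
begin

lemma tube_to_tangent_class:
  assumes "u \<in> cone_over \<Omega>"
  shows "tube_to_tangent \<Omega> \<Gamma> (tube_class u w) = tangent_class \<Omega> \<Gamma> u w"
  unfolding tube_to_tangent_def tube_class_def[symmetric]
proof (rule some_equality)
  show "\<xi> = tangent_class \<Omega> \<Gamma> u w"
    if "\<exists>v x. v \<in> cone_over \<Omega> \<and> tube_class u w = tube_class v x \<and> \<xi> = tangent_class \<Omega> \<Gamma> v x" for \<xi>
    using that tube_class_eq_iff assms by metis
qed (use assms in blast)

lemma topspace_complexification_cases:
  assumes "z \<in> topspace (complexification_top \<Omega> \<Gamma>)"
  obtains u w where "u \<in> cone_over \<Omega>" "z = tube_class u w"
proof -
  have "z \<in> (\<lambda>(u, w). tube_class u w) ` (cone_over \<Omega> \<times> UNIV)"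
    using assms unfolding quotient_imp_surjective_map[OF quotient_map_tube_class, symmetric] by simp
  then show thesis using that by (elim imageE) (simp add: mem_Times_iff case_prod_beta)
qed

text \<open>Composing with the quotient map \<open>tube_class\<close> yields the quotient map
  \<open>tangent_class\<close>, so the map itself is a quotient map; agreement of the fibres makes
  it injective.\<close>

lemma homeomorphic_map_tube_to_tangent:
  "homeomorphic_map (complexification_top \<Omega> \<Gamma>) TM (tube_to_tangent \<Omega> \<Gamma>)"
  unfolding homeomorphic_map_def
proof
  let ?X = "top_of_set (cone_over \<Omega> \<times> (UNIV :: (real ^ 'n option) set))"
  have B: "quotient_map ?X TM (tube_to_tangent \<Omega> \<Gamma> \<circ> (\<lambda>(u, w). tube_class u w))"
    by (rule quotient_map_eq[OF quotient_map_tangent_class]) (auto simp: tube_to_tangent_class)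
  then have "continuous_map (complexification_top \<Omega> \<Gamma>) TM (tube_to_tangent \<Omega> \<Gamma>)"
    using continuous_compose_quotient_map[OF quotient_map_tube_class] quotient_imp_continuous_map by blast
  then show "quotient_map (complexification_top \<Omega> \<Gamma>) TM (tube_to_tangent \<Omega> \<Gamma>)"
    using quotient_map_from_composition[OF quotient_imp_continuous_map[OF quotient_map_tube_class] _ B] by blast
  show "inj_on (tube_to_tangent \<Omega> \<Gamma>) (topspace (complexification_top \<Omega> \<Gamma>))"
    by (rule inj_onI) (metis topspace_complexification_cases tube_to_tangent_class tube_class_eq_iff)
qed

lemma tube_to_tangent_zero_section:
  assumes "p \<in> topspace (manifold_top \<Omega> \<Gamma>)"
  shows "tube_to_tangent \<Omega> \<Gamma> (manifold_inclusion p) = zero_section (manifold_atlas \<Omega> \<Gamma>) p"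
proof -
  obtain x where x: "x \<in> \<Omega>" "p = q x" using assms by auto
  obtain u where u: "u \<noteq> 0" "x = proj_class u" using proj_class_cases by blast
  have "u \<in> cone_over \<Omega>" using x u by (simp add: cone_over_def)
  then show ?thesis using tube_to_tangent_class[of u 0] tangent_class_zero tube_class_zero x u by simp
qed

end

lemma natural_tube_to_tangent:
  "natural (tube_to_tangent :: (real, 'n::finite) projective_space set \<Rightarrow> (real, 'n) pgl set \<Rightarrow> _ \<Rightarrow> _)"
  unfolding natural_def
proof (intro allI impI ballI, elim conjE)
  fix \<Omega> :: "(real, 'n) projective_space set" and \<Gamma> \<Omega>' \<Gamma>' g z
  assume M: "convex_projective_manifold \<Omega> \<Gamma>" and M': "convex_projective_manifold \<Omega>' \<Gamma>'"
    and g: "manifold_isomorphism \<Omega> \<Gamma> \<Omega>' \<Gamma>' g" and z: "z \<in> topspace (complexification_top \<Omega> \<Gamma>)"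
  interpret M: projective_manifold \<Omega> \<Gamma> by standard (rule M)
  interpret M': projective_manifold \<Omega>' \<Gamma>' by standard (rule M')
  obtain k where k: "invertible k" "g = pgl_class k" using pgl_class_cases by blast
  obtain u w where uw: "u \<in> cone_over \<Omega>" "z = M.tube_class u w" by (rule M.topspace_complexification_cases[OF z])
  have nz: "u \<noteq> 0" using uw(1) by (simp add: cone_over_def)
  have image: "pgl_act (pgl_class k) ` \<Omega> = \<Omega>'" using g unfolding manifold_isomorphism_def k(2) by simp
  have ku: "k *v u \<in> cone_over \<Omega>'" using mem_cone_over_image[OF k(1) image] uw(1) by simp
  have "induced_complex_map g z = M'.tube_class (k *v u) (k *v w)"
    unfolding uw(2) M.tube_class_def M'.tube_class_def induced_complex_map_orbit[OF g]
    using tube_point_equivariant[OF k(1) image nz] by (simp add: k(2))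
  then have "tube_to_tangent \<Omega>' \<Gamma>' (induced_complex_map g z) = tangent_class \<Omega>' \<Gamma>' (k *v u) (k *v w)"
    using M'.tube_to_tangent_class[OF ku] by simp
  also have "\<dots> = differential (manifold_atlas \<Omega> \<Gamma>) (manifold_atlas \<Omega>' \<Gamma>') (induced_map g) (tangent_class \<Omega> \<Gamma> u w)"
  proof -
    have "tangent_rel (manifold_atlas \<Omega> \<Gamma>) (manifold_atlas \<Omega>' \<Gamma>') (induced_map g) `` {t}
        = tangent_class \<Omega>' \<Gamma>' (k *v u) (k *v w)" if "t \<in> tangent_class \<Omega> \<Gamma> u w" for t
      using tangent_rel_tangent_class[OF M.projective_manifold_axioms M'.projective_manifold_axioms k(1) _ uw(1) that] g k(2)
      by simp
    \<comment> \<open>The differential is a union over representatives. All contribute the same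
      class, and there is at least one.\<close>
    then show ?thesis
      using M.tangent_class_nonempty[OF uw(1), of w] unfolding differential_def by blast
  qed
  also have "tangent_class \<Omega> \<Gamma> u w = tube_to_tangent \<Omega> \<Gamma> z" using M.tube_to_tangent_class[OF uw(1)] uw(2) by simp
  finally show "tube_to_tangent \<Omega>' \<Gamma>' (induced_complex_map g z) =
    differential (manifold_atlas \<Omega> \<Gamma>) (manifold_atlas \<Omega>' \<Gamma>') (induced_map g) (tube_to_tangent \<Omega> \<Gamma> z)" .
qed

theorem theorem5p3:
  shows "\<exists>f :: (real, 'n::finite) projective_space set \<Rightarrow> (real, 'n) pgl set
             \<Rightarrow> (complex, 'n) projective_space set
             \<Rightarrow> ((real, 'n) projective_space set, real ^ 'n) tangent_rep set.
    natural f \<and>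
    (\<forall>\<Omega> \<Gamma>. convex_projective_manifold \<Omega> \<Gamma> \<longrightarrow>
       homeomorphic_map (complexification_top \<Omega> \<Gamma>)
         (tangent_bundle_top (manifold_top \<Omega> \<Gamma>) (manifold_atlas \<Omega> \<Gamma>)) (f \<Omega> \<Gamma>) \<and>
       (\<forall>p \<in> topspace (manifold_top \<Omega> \<Gamma>).
          f \<Omega> \<Gamma> (manifold_inclusion p) = zero_section (manifold_atlas \<Omega> \<Gamma>) p))"
proof (intro exI[of _ tube_to_tangent] conjI allI impI ballI)
  fix \<Omega> :: "(real, 'n) projective_space set" and \<Gamma> assume "convex_projective_manifold \<Omega> \<Gamma>"
  then interpret projective_manifold \<Omega> \<Gamma> by unfold_locales
  show "homeomorphic_map (complexification_top \<Omega> \<Gamma>) TM (tube_to_tangent \<Omega> \<Gamma>)"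
    by (rule homeomorphic_map_tube_to_tangent)
  show "tube_to_tangent \<Omega> \<Gamma> (manifold_inclusion p) = zero_section (manifold_atlas \<Omega> \<Gamma>) p"
    if "p \<in> topspace (manifold_top \<Omega> \<Gamma>)" for p
    using that by (rule tube_to_tangent_zero_section)
qed (rule natural_tube_to_tangent)

end
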